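(* Let $1\le k,m\le n-1$, $2m\le n-k$, and $f\in L^1(V_{n,m})$. Then $$F^*_{m,k}F_{m,k}f=\tilde c\,Q^{n-k-m}f,\qquad \tilde c=\frac{2^m\,\pi^{(n-m)m/2}\,\Gamma_m((n-k)/2)}{\Gamma_m(n/2)\,\Gamma_m((n-k-m)/2)}.$$
   Context: $V_{n,m}=\{v\in M_{n,m}(\mathbb R): v'v=I_m\}$ is the Stiefel manifold of orthonormal $m$-frames in $\mathbb R^n$ ($v'$ is the transpose), with $O(n)$-invariant probability measure $d_*v$. For a square matrix $a$, $|a|=|\det a|$. $\Gamma_m(\alpha)=\pi^{m(m-1)/4}\prod_{j=0}^{m-1}\Gamma(\alpha-j/2)$. Funk transform and its dual ($k+m\le n$): $$(F_{m,k}f)(u)=\int_{V_{n-k,m}} f\Big(g_u\begin{bmatrix}\omega\\ 0\end{bmatrix}\Big)d_*\omega,\quad u\in V_{n,k};\qquad (F^*_{m,k}\varphi)(v)=\int_{V_{n-m,k}}\varphi\Big(g_v\begin{bmatrix}\theta\\ 0\end{bmatrix}\Big)d_*\theta,\quad v\in V_{n,m},$$ where $g_u,g_v\in O(n)$ are any matrices with $g_u\begin{bmatrix}0\\ I_k\end{bmatrix}=u$, $g_v\begin{bmatrix}0\\ I_m\end{bmatrix}=v$. Sine transform: $(Q^\alpha f)(u)=\int_{V_{n,m}}f(v)\,|I_m-v'uu'v|^{(\alpha+m-n)/2}\,d_*v$, $u\in V_{n,m}$.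
   Formalization: The printed constant c̃ is false for probability measures (n=4, k=m=1, f=1 gives 4π instead of 1); the formal theorem uses c̃ divided by 2^m π^{(n-m)m/2}/Γ_m((n-m)/2), with equality for almost every v. *)

theory Defs
  imports "HOL-Analysis.Analysis"
begin

text \<open>
  An \<open>n \<times> m\<close> matrix is an element of \<open>real^'m^'n\<close> with \<open>CARD('n) = n\<close>, \<open>CARD('m) = m\<close>.
  Stacking an \<open>'a\<close>-indexed block of rows on top of a \<open>'b\<close>-indexed one gives a matrix with
  rows indexed by \<open>'a + 'b\<close>.
\<close>

definition stiefel :: "(real^'m^'n) set" where
  "stiefel = {v. transpose v ** v = mat 1}"

text \<open>
  The invariant Borel probability measure exists and is unique as soon as the Stiefel manifold is
  nonempty, i.e. \<open>CARD('m) \<le> CARD('n)\<close>; otherwise the description denotes nothing.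
\<close>

definition stiefel_measure :: "(real^'m^'n) measure" where
  "stiefel_measure = (THE \<mu>.
     sets \<mu> = sets (restrict_space borel stiefel) \<and>
     emeasure \<mu> (space \<mu>) = 1 \<and>
     (\<forall>g::real^'n^'n. orthogonal_matrix g \<longrightarrow> distr \<mu> \<mu> (\<lambda>v. g ** v) = \<mu>))"

definition upper_block :: "real^'m^'a \<Rightarrow> real^'m^('a + 'b::finite)" where
  "upper_block w = (\<chi> i. case i of Inl a \<Rightarrow> w $ a | Inr b \<Rightarrow> 0)"

definition lower_block :: "real^'m^'b \<Rightarrow> real^'m^('a::finite + 'b)" where
  "lower_block w = (\<chi> i. case i of Inl a \<Rightarrow> 0 | Inr b \<Rightarrow> w $ b)"

text \<open>
  The matrix \<open>g\<^sub>u\<close> with \<open>g\<^sub>u [0; I\<^sub>k] = u\<close>. Its \<open>n\<close> columns are indexed by \<open>'a + 'k\<close> with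
  \<open>CARD('a) = n - k\<close>, so that it acts on block columns, while its rows are indexed by \<open>'n\<close>;
  hence orthogonality is spelled out as a two-sided condition instead of \<open>orthogonal_matrix\<close>.
  By invariance of the measure the integrals below do not depend on which \<open>g\<^sub>u\<close> is chosen.
\<close>

definition frame_completion :: "real^'k^'n \<Rightarrow> real^('a::finite + 'k)^'n" where
  "frame_completion u = (SOME g.
     transpose g ** g = mat 1 \<and> g ** transpose g = mat 1 \<and> g ** lower_block (mat 1) = u)"

text \<open>
  The type argument is the row index type of the integration variable: it has \<open>n - k\<close> elements
  for the Funk transform and \<open>n - m\<close> elements for the dual one. A predicate named
  \<open>..._exists\<close> says that the integral defining the transform converges absolutely; where it does
  not, the value of the transform is \<open>0\<close> by the convention for the Bochner integral.
\<close>

definition funk_integrand ::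
    "(real^'m^'n \<Rightarrow> complex) \<Rightarrow> real^'k^'n \<Rightarrow> real^'m^'a \<Rightarrow> complex" where
  "funk_integrand f u \<omega> = f (frame_completion u ** (upper_block \<omega> :: real^'m^('a + 'k)))"

definition funk_exists ::
    "'a::finite itself \<Rightarrow> (real^'m^'n \<Rightarrow> complex) \<Rightarrow> real^'k^'n \<Rightarrow> bool" where
  "funk_exists _ f u \<longleftrightarrow> integrable stiefel_measure (funk_integrand f u :: real^'m^'a \<Rightarrow> complex)"

definition funk ::
    "'a::finite itself \<Rightarrow> (real^'m^'n \<Rightarrow> complex) \<Rightarrow> real^'k^'n \<Rightarrow> complex" where
  "funk _ f u = (LINT (\<omega>::real^'m^'a) | stiefel_measure. funk_integrand f u \<omega>)"

definition dual_funk_integrand ::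
    "(real^'k^'n \<Rightarrow> complex) \<Rightarrow> real^'m^'n \<Rightarrow> real^'k^'b \<Rightarrow> complex" where
  "dual_funk_integrand \<phi> v \<theta> = \<phi> (frame_completion v ** (upper_block \<theta> :: real^'k^('b + 'm)))"

definition dual_funk_exists ::
    "'b::finite itself \<Rightarrow> (real^'k^'n \<Rightarrow> complex) \<Rightarrow> real^'m^'n \<Rightarrow> bool" where
  "dual_funk_exists _ \<phi> v \<longleftrightarrow>
     integrable stiefel_measure (dual_funk_integrand \<phi> v :: real^'k^'b \<Rightarrow> complex)"

definition dual_funk ::
    "'b::finite itself \<Rightarrow> (real^'k^'n \<Rightarrow> complex) \<Rightarrow> real^'m^'n \<Rightarrow> complex" where
  "dual_funk _ \<phi> v = (LINT (\<theta>::real^'k^'b) | stiefel_measure. dual_funk_integrand \<phi> v \<theta>)"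

definition sine_integrand ::
    "real \<Rightarrow> (real^'m^'n \<Rightarrow> complex) \<Rightarrow> real^'m^'n \<Rightarrow> real^'m^'n \<Rightarrow> complex" where
  "sine_integrand \<alpha> f u v =
     f v * of_real (\<bar>det (mat 1 - transpose v ** u ** transpose u ** v)\<bar>
                      powr ((\<alpha> + real CARD('m) - real CARD('n)) / 2))"

definition sine_exists :: "real \<Rightarrow> (real^'m^'n \<Rightarrow> complex) \<Rightarrow> real^'m^'n \<Rightarrow> bool" where
  "sine_exists \<alpha> f u \<longleftrightarrow> integrable stiefel_measure (sine_integrand \<alpha> f u)"

definition sine_transform :: "real \<Rightarrow> (real^'m^'n \<Rightarrow> complex) \<Rightarrow> real^'m^'n \<Rightarrow> complex" where
  "sine_transform \<alpha> f u = (LINT v | stiefel_measure. sine_integrand \<alpha> f u v)"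

definition siegel_gamma :: "nat \<Rightarrow> real \<Rightarrow> real" where
  "siegel_gamma m \<alpha> =
     pi powr (real m * (real m - 1) / 4) * (\<Prod>j<m. Gamma (\<alpha> - real j / 2))"

text \<open>
  The volume of the Stiefel manifold of \<open>m\<close>-frames in \<open>N\<close>-space for the standard unnormalized
  invariant measure (for \<open>m = 1\<close>: the area of the unit sphere in \<open>N\<close>-space).
\<close>

definition stiefel_volume :: "nat \<Rightarrow> nat \<Rightarrow> real" where
  "stiefel_volume N m = 2 ^ m * pi powr (real N * real m / 2) / siegel_gamma m (real N / 2)"

definition funk_sine_const :: "nat \<Rightarrow> nat \<Rightarrow> nat \<Rightarrow> real" where
  "funk_sine_const n k m =
     2 ^ m * pi powr ((real n - real m) * real m / 2) * siegel_gamma m ((real n - real k) / 2) /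
     (siegel_gamma m (real n / 2) * siegel_gamma m ((real n - real k - real m) / 2))"

text \<open>
  \<open>funk_sine_const n k m\<close> is the constant that is printed in the source for the identity between
  the composition of the Funk transforms and the sine transform. It belongs to an unnormalized
  measure on \<open>m\<close>-frames in \<open>(n - m)\<close>-space; when all integrals are taken with respect to
  probability measures, as in the definitions above, the constant in the identity is
  \<open>funk_sine_const n k m / stiefel_volume (n - m) m\<close>, as one sees from \<open>f = 1\<close>. For instance, for
  \<open>n = 4\<close>, \<open>k = m = 1\<close> the composition of the Funk transforms maps \<open>1\<close> to \<open>1\<close>, the sine transform
  maps \<open>1\<close> to \<open>4 / \<pi>\<close>, and \<open>funk_sine_const 4 1 1 = \<pi>\<^sup>2\<close>, \<open>stiefel_volume 3 1 = 4 \<pi>\<close>.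
\<close>

end

theory Submission
  imports Defs "HOL-Probability.Probability"
begin

text \<open>
  Let \<open>X\<close> be a Gaussian matrix with \<open>n\<close> rows and \<open>m\<close> columns and \<open>X = w T\<close> its Gram-Schmidt
  decomposition. Equivariance makes the frame \<open>w\<close> uniformly distributed and independent of \<open>T\<close>; the
  columns of \<open>T\<close> are independent, with Gaussian entries above the diagonal and with the \<open>j\<close>-th diagonal
  entry (\<open>j = 0, 1, \<dots>\<close>) distributed like the norm of a Gaussian vector in dimension \<open>n - j\<close>. Lowering \<open>n\<close> by \<open>k\<close>
  therefore multiplies the law of \<open>T\<close> by a constant times \<open>|T|\<^sup>-\<^sup>k\<close>.

  A uniform frame orthogonal to \<open>u\<close> is the frame of the projection of \<open>X\<close> off the columns of \<open>u\<close>. Choose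
  \<open>J\<close> so that the columns of \<open>J\<close> and \<open>v\<close> form an orthonormal basis and write \<open>X = J A + v B\<close>. The
  composition of the two Funk transforms takes \<open>u = J \<theta>\<close> with \<open>\<theta>\<close> uniform, which replaces \<open>A\<close> by
  its projection off \<open>\<theta>\<close>. Averaged over \<open>\<theta>\<close> this only changes the law of the triangular factor of \<open>A\<close>,
  that is, it inserts the density \<open>c |A'A|\<^sup>-\<^sup>k\<^sup>/\<^sup>2\<close>. Since \<open>A'A = T'(I - w'vv'w)T\<close> with \<open>T\<close> independent of
  \<open>w\<close>, what remains is the sine transform.
\<close>

section \<open>Gaussian measures\<close>

text \<open>Gaussian matrices replace an explicit calculus of invariant measures: they are products,
  so Fubini and changes of density work column by column, and orthogonal maps preserve them. The
  manifold measure is given by a description, so an invariant probability has to be constructed and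
  shown unique before any integral can be evaluated: the frame of a Gaussian matrix gives existence,
  averaging over the orthogonal group uniqueness. Origin of the constant: the density between the
  triangular laws of dimensions d and d - k is \<open>gamma_ratio d k m\<close> times |T|^-k. It
  enters with d = n - m, for A. Once |A'A|^(-k/2) is written as kernel times |T|^-k, the factor
  |T|^-k belongs to d = n, where multiplication by \<open>gamma_ratio n k m\<close> normalises it;
  the quotient of the two ratios is left. The condition 2m <= n - k, that is m + k <= n - m, keeps
  all Gamma arguments positive. The computation is done for nonnegative functions and recorded as an
  equality of measures; integrability of f against the kernel, which holds for almost every v, then
  carries it to complex f.\<close>

text \<open>By Fubini, two translation-invariant measures satisfy \<open>\<mu>(A) \<lambda>(B) = \<mu>(B) \<lambda>(A)\<close>; take for \<open>B\<close> the unit ball, which \<open>f\<close> preserves.\<close>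

lemma distr_orthogonal_transformation_lborel:
  fixes f :: "'a::euclidean_space \<Rightarrow> 'a"
  assumes f: "orthogonal_transformation f"
  shows "distr lborel borel f = lborel"
proof -
  have lf: "linear f" using f by (rule orthogonal_transformation_linear)
  have bij: "bij f" using f by (rule orthogonal_transformation_bij)
  have fm[measurable]: "f \<in> borel_measurable borel"
    by (intro borel_measurable_continuous_onI linear_continuous_on)
       (simp add: lf linear_linear)
  define \<mu> where "\<mu> = distr lborel borel f"
  have sets_\<mu>[measurable_cong, simp]: "sets \<mu> = sets borel" by (simp add: \<mu>_def)
  have ball: "f -` ball 0 r = ball (0::'a) r" for r
    using f by (auto simp: orthogonal_transformation)
  have \<mu>_ball: "emeasure \<mu> (ball 0 r) = emeasure lborel (ball (0::'a) r)" for r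
    unfolding \<mu>_def by (subst emeasure_distr) (auto simp: ball)
  interpret \<mu>: sigma_finite_measure \<mu>
  proof
    show "\<exists>A. countable A \<and> A \<subseteq> sets \<mu> \<and> \<Union>A = space \<mu> \<and> (\<forall>a\<in>A. emeasure \<mu> a \<noteq> \<infinity>)"
    proof (intro exI conjI)
      show "countable (range (\<lambda>n::nat. ball (0::'a) (real n)))" by simp
      show "range (\<lambda>n::nat. ball (0::'a) (real n)) \<subseteq> sets \<mu>" by auto
      show "\<Union> (range (\<lambda>n::nat. ball (0::'a) (real n))) = space \<mu>"
        using reals_Archimedean2 by (auto simp: sets_eq_imp_space_eq[OF sets_\<mu>])
      show "\<forall>a\<in>range (\<lambda>n::nat. ball (0::'a) (real n)). emeasure \<mu> a \<noteq> \<infinity>"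
        using \<mu>_ball emeasure_lborel_ball_finite by (auto simp: less_top)
    qed
  qed
  interpret L: sigma_finite_measure "lborel :: 'a measure" by (rule sigma_finite_lborel)
  interpret P: pair_sigma_finite \<mu> "lborel :: 'a measure" ..
  have trans_L: "(\<integral>\<^sup>+x. g (x + y) \<partial>lborel) = (\<integral>\<^sup>+x. g x \<partial>lborel)"
    if [measurable]: "g \<in> borel_measurable borel" for g and y :: 'a
    by (subst (2) lborel_affine[of 1 y]) (simp_all add: nn_integral_density nn_integral_distr add.commute)
  have refl_L: "(\<integral>\<^sup>+x. g (y - x) \<partial>lborel) = (\<integral>\<^sup>+x. g x \<partial>lborel)"
    if [measurable]: "g \<in> borel_measurable borel" for g and y :: 'a
    by (subst (2) lborel_affine[of "-1" y]) (simp_all add: nn_integral_density nn_integral_distr add.commute)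
  have trans_\<mu>: "(\<integral>\<^sup>+x. g (x + y) \<partial>\<mu>) = (\<integral>\<^sup>+x. g x \<partial>\<mu>)"
    if [measurable]: "g \<in> borel_measurable borel" for g and y :: 'a
  proof -
    obtain z where z: "y = f z" using bij by (metis bij_pointE)
    have "(\<integral>\<^sup>+x. g (x + y) \<partial>\<mu>) = (\<integral>\<^sup>+x. g (f (x + z)) \<partial>lborel)"
      by (simp add: \<mu>_def nn_integral_distr z linear_add[OF lf])
    also have "\<dots> = (\<integral>\<^sup>+x. g (f x) \<partial>lborel)" by (rule trans_L) simp
    finally show ?thesis by (simp add: \<mu>_def nn_integral_distr)
  qed
  \<comment> \<open>For fixed x the integral over y is the Lebesgue measure of B. After the
    exchange, substituting x - y for x under \<open>\<mu>\<close> moves the shift to A, and the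
    reflection y -> x - y then integrates A to its Lebesgue measure.\<close>
  have swap: "emeasure \<mu> A * emeasure lborel B = emeasure \<mu> B * emeasure lborel A"
    if [measurable]: "A \<in> sets borel" "B \<in> sets borel" for A B
  proof -
    have "emeasure \<mu> A * emeasure lborel B = (\<integral>\<^sup>+x. indicator A x * emeasure lborel B \<partial>\<mu>)"
      by (simp add: nn_integral_multc)
    also have "\<dots> = (\<integral>\<^sup>+x. \<integral>\<^sup>+y. indicator A x * indicator B (y + x) \<partial>lborel \<partial>\<mu>)"
      by (intro nn_integral_cong) (simp add: nn_integral_cmult trans_L)
    also have "\<dots> = (\<integral>\<^sup>+y. \<integral>\<^sup>+x. indicator A x * indicator B (y + x) \<partial>\<mu> \<partial>lborel)"
      by (rule P.Fubini'[symmetric], measurable)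
    also have "\<dots> = (\<integral>\<^sup>+y. \<integral>\<^sup>+x. indicator A (x - y) * indicator B x \<partial>\<mu> \<partial>lborel)"
    proof (rule nn_integral_cong)
      fix y :: 'a
      have "(\<integral>\<^sup>+x. indicator A ((x + y) - y) * indicator B (x + y) \<partial>\<mu>)
          = (\<integral>\<^sup>+x. indicator A (x - y) * indicator B x \<partial>\<mu>)"
        by (rule trans_\<mu>[of "\<lambda>x. indicator A (x - y) * indicator B x"]) measurable
      then show "(\<integral>\<^sup>+x. indicator A x * indicator B (y + x) \<partial>\<mu>)
          = (\<integral>\<^sup>+x. indicator A (x - y) * indicator B x \<partial>\<mu>)" by (simp add: add.commute)
    qed
    also have "\<dots> = (\<integral>\<^sup>+x. \<integral>\<^sup>+y. indicator A (x - y) * indicator B x \<partial>lborel \<partial>\<mu>)"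
      by (rule P.Fubini', measurable)
    also have "\<dots> = (\<integral>\<^sup>+x. emeasure lborel A * indicator B x \<partial>\<mu>)"
      by (intro nn_integral_cong) (simp add: nn_integral_multc refl_L)
    finally show ?thesis by (simp add: nn_integral_multc mult.commute)
  qed
  have "emeasure (distr lborel borel f) A = emeasure lborel A" if A: "A \<in> sets borel" for A
  proof -
    let ?b = "emeasure lborel (ball (0::'a) 1)"
    have "?b * emeasure \<mu> A = ?b * emeasure lborel A"
      using swap[OF A, of "ball 0 1"] \<mu>_ball[of 1] by (simp add: mult.commute)
    moreover have "?b \<noteq> 0"
      by (simp add: emeasure_ball unit_ball_vol_pos less_imp_neq[symmetric])
    moreover have "?b \<noteq> \<infinity>" using emeasure_lborel_ball_finite[of "0::'a" 1] by (simp add: less_top)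
    ultimately show ?thesis by (simp add: ennreal_mult_cancel_left \<mu>_def)
  qed
  then show ?thesis by (intro measure_eqI) auto
qed

text \<open>A product measure is characterised by its values on boxes when the factors are
  sigma-finite, which is why the reweighted factors are assumed to be so. On a box the integrand is
  a product of one-variable functions.\<close>

lemma density_PiM:
  assumes fin: "finite I"
    and M: "\<And>i. sigma_finite_measure (M i)"
    and sf: "\<And>i. sigma_finite_measure (density (M i) (h i))"
    and h[measurable]: "\<And>i. h i \<in> borel_measurable (M i)"
  shows "PiM I (\<lambda>i. density (M i) (h i)) = density (PiM I M) (\<lambda>x. \<Prod>i\<in>I. h i (x i))"
proof -
  interpret M: product_sigma_finite M by (rule product_sigma_finite.intro) (rule M)
  interpret D: product_sigma_finite "\<lambda>i. density (M i) (h i)" by (rule product_sigma_finite.intro) (rule sf)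
  have hm: "(\<lambda>x. \<Prod>i\<in>I. h i (x i)) \<in> borel_measurable (PiM I M)" using fin by measurable
  show ?thesis
  proof (rule D.PiM_eqI[OF fin, symmetric])
    show "sets (density (PiM I M) (\<lambda>x. \<Prod>i\<in>I. h i (x i))) = sets (PiM I (\<lambda>i. density (M i) (h i)))"
      by (simp cong: sets_PiM_cong)
    fix A assume A: "\<And>i. i \<in> I \<Longrightarrow> A i \<in> sets (density (M i) (h i))"
    then have [measurable]: "i \<in> I \<Longrightarrow> A i \<in> sets (M i)" for i by simp
    have "emeasure (density (PiM I M) (\<lambda>x. \<Prod>i\<in>I. h i (x i))) (Pi\<^sub>E I A)
      = (\<integral>\<^sup>+x. (\<Prod>i\<in>I. h i (x i)) * indicator (Pi\<^sub>E I A) x \<partial>PiM I M)"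
      using fin by (intro emeasure_density hm sets_PiM_I_finite) auto
    also have "\<dots> = (\<integral>\<^sup>+x. (\<Prod>i\<in>I. h i (x i) * indicator (A i) (x i)) \<partial>PiM I M)"
      using fin
      by (intro nn_integral_cong)
         (auto simp: prod.distrib space_PiM PiE_iff indicator_def prod_zero_iff)
    also have "\<dots> = (\<Prod>i\<in>I. \<integral>\<^sup>+x. h i x * indicator (A i) x \<partial>M i)"
      by (rule M.product_nn_integral_prod[OF fin]) measurable
    also have "\<dots> = (\<Prod>i\<in>I. emeasure (density (M i) (h i)) (A i))"
      by (intro prod.cong) (auto simp: emeasure_density)
    finally show "emeasure (density (PiM I M) (\<lambda>x. \<Prod>i\<in>I. h i (x i))) (Pi\<^sub>E I A)
      = (\<Prod>i\<in>I. emeasure (density (M i) (h i)) (A i))" .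
  qed
qed

text \<open>The normal law of variance 1/2. With exponent -t^2 the radial densities below carry
  Gamma factors but no dimension-dependent powers of 2.\<close>

definition gauss1 :: "real measure" where
  "gauss1 = density lborel (\<lambda>t. ennreal (exp (- t\<^sup>2) / sqrt pi))"

definition gauss :: "'a::euclidean_space measure" where
  "gauss = density lborel (\<lambda>x. ennreal (exp (- (x \<bullet> x)) / sqrt pi ^ DIM('a)))"

lemma sets_gauss1[simp, measurable_cong]: "sets gauss1 = sets borel" by (simp add: gauss1_def)
lemma space_gauss1[simp]: "space gauss1 = UNIV" by (simp add: gauss1_def)
lemma sets_gauss[simp, measurable_cong]: "sets gauss = sets borel" by (simp add: gauss_def)
lemma space_gauss[simp]: "space gauss = UNIV" by (simp add: gauss_def)

lemma prob_space_gauss1: "prob_space gauss1"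
proof -
  have "gauss1 = density lborel (\<lambda>x. ennreal (normal_density 0 (1 / sqrt 2) x))"
    by (simp add: gauss1_def normal_density_def power_divide)
  with prob_space_normal_density[of "1 / sqrt 2" 0] show ?thesis by simp
qed

lemma gauss_eq_distr_Basis:
  "(gauss :: 'a::euclidean_space measure) = distr (PiM Basis (\<lambda>_. gauss1)) borel (\<lambda>t. \<Sum>b\<in>Basis. t b *\<^sub>R b)"
    (is "_ = distr _ _ ?s")
proof -
  have h: "exp (- (?s t \<bullet> ?s t)) / sqrt pi ^ DIM('a) = (\<Prod>b\<in>Basis. exp (- (t b)\<^sup>2) / sqrt pi)" for t
    by (simp add: inner_sum_left inner_sum_right inner_Basis sum.delta if_distrib
        exp_sum[symmetric] sum_negf prod_dividef power2_eq_square cong: if_cong)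
  have "PiM (Basis::'a set) (\<lambda>_. gauss1)
      = density (PiM Basis (\<lambda>_. lborel)) (\<lambda>t. \<Prod>b\<in>Basis. ennreal (exp (- (t b)\<^sup>2) / sqrt pi))"
    unfolding gauss1_def
  proof (rule density_PiM)
    show "sigma_finite_measure (density lborel (\<lambda>t. ennreal (exp (- t\<^sup>2) / sqrt pi)))"
      using prob_space_gauss1 unfolding gauss1_def prob_space_def finite_measure_def by simp
  qed (auto intro: sigma_finite_lborel)
  also have "\<dots> = density (PiM Basis (\<lambda>_. lborel)) (\<lambda>t. ennreal (exp (- (?s t \<bullet> ?s t)) / sqrt pi ^ DIM('a)))"
    by (simp add: h prod_ennreal)
  finally show ?thesis
    unfolding gauss_def by (simp add: lborel_eq[where 'a='a] density_distr)
qed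

lemma prob_space_gauss: "prob_space gauss"
proof -
  interpret prob_space gauss1 by (rule prob_space_gauss1)
  interpret product_prob_space "\<lambda>_. gauss1" ..
  show ?thesis unfolding gauss_eq_distr_Basis by (intro prob_space.prob_space_distr prob_space_PiM prob_space_gauss1) simp
qed

lemma distr_orthogonal_transformation_gauss:
  fixes f :: "'a::euclidean_space \<Rightarrow> 'a"
  assumes f: "orthogonal_transformation f"
  shows "distr gauss borel f = gauss"
proof -
  have [measurable]: "f \<in> borel_measurable borel"
    using orthogonal_transformation_linear[OF f]
    by (intro borel_measurable_continuous_onI linear_continuous_on) (simp add: linear_linear)
  have ff: "f x \<bullet> f x = x \<bullet> x" for x
    using f by (simp add: orthogonal_transformation_def)
  have "gauss = density (distr lborel borel f) (\<lambda>x::'a. ennreal (exp (- (x \<bullet> x)) / sqrt pi ^ DIM('a)))"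
    by (simp add: gauss_def distr_orthogonal_transformation_lborel[OF f])
  also have "\<dots> = distr (density lborel (\<lambda>x::'a. ennreal (exp (- (f x \<bullet> f x)) / sqrt pi ^ DIM('a)))) borel f"
    by (rule density_distr) auto
  finally show ?thesis by (simp add: ff gauss_def)
qed

text \<open>Matching the family with the standard basis defines an orthogonal transformation, which
  preserves the Gaussian law; relabelling coordinates along the bijection finishes. The index set is
  arbitrary, so that coordinates can be numbered by naturals or by the basis of another
  space.\<close>

lemma gauss_eq_distr_orthonormal:
  fixes B :: "'i \<Rightarrow> 'a::euclidean_space"
  assumes fin: "finite I" and card: "card I = DIM('a)"
    and B: "\<And>i j. i \<in> I \<Longrightarrow> j \<in> I \<Longrightarrow> B i \<bullet> B j = (if i = j then 1 else 0)"
  shows "gauss = distr (PiM I (\<lambda>_. gauss1)) borel (\<lambda>t. \<Sum>i\<in>I. t i *\<^sub>R B i)"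
proof -
  obtain \<sigma> where \<sigma>: "bij_betw \<sigma> (Basis::'a set) I"
    using fin card by (metis finite_same_card_bij finite_Basis)
  define f where "f = (\<lambda>x::'a. \<Sum>b\<in>Basis. (x \<bullet> b) *\<^sub>R B (\<sigma> b))"
  have B\<sigma>: "B (\<sigma> b) \<bullet> B (\<sigma> c) = (if b = c then 1 else 0)" if "b \<in> Basis" "c \<in> Basis" for b c
    using \<sigma> that B[of "\<sigma> b" "\<sigma> c"] by (auto simp: bij_betw_def inj_on_def)
  have lin: "linear f"
    unfolding f_def by (intro linearI) (simp_all add: inner_add_left scaleR_add_left sum.distrib scaleR_sum_right)
  have "orthogonal_transformation f"
    unfolding orthogonal_transformation_def
  proof (intro conjI allI lin)
    fix v w
    show "f v \<bullet> f w = v \<bullet> w"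
      by (simp add: f_def inner_sum_left inner_sum_right B\<sigma> euclidean_inner[of v w] mult.commute sum.delta if_distrib
          cong: if_cong sum.cong)
  qed
  then have "gauss = distr gauss borel f" by (simp add: distr_orthogonal_transformation_gauss)
  also have "\<dots> = distr (PiM Basis (\<lambda>_. gauss1)) borel (\<lambda>t. f (\<Sum>b\<in>Basis. t b *\<^sub>R b))"
    using lin by (subst gauss_eq_distr_Basis, subst distr_distr)
      (auto simp: comp_def linear_linear intro!: borel_measurable_continuous_onI linear_continuous_on)
  also have "PiM (Basis::'a set) (\<lambda>_. gauss1)
     = distr (PiM I (\<lambda>_. gauss1)) (PiM Basis (\<lambda>_. gauss1)) (\<lambda>t. \<lambda>b\<in>Basis. t (\<sigma> b))"
    using \<sigma> by (intro distr_PiM_reindex[symmetric] prob_space_gauss1) (auto simp: bij_betw_def)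
  also have "distr \<dots> borel (\<lambda>t. f (\<Sum>b\<in>Basis. t b *\<^sub>R b))
     = distr (PiM I (\<lambda>_. gauss1)) borel (\<lambda>t. f (\<Sum>b\<in>Basis. t (\<sigma> b) *\<^sub>R b))"
  proof (subst distr_distr)
    show "(\<lambda>t. \<lambda>b\<in>Basis. t (\<sigma> b)) \<in> PiM I (\<lambda>_. gauss1) \<rightarrow>\<^sub>M PiM (Basis::'a set) (\<lambda>_. gauss1)"
      using \<sigma> by (intro measurable_restrict measurable_component_singleton) (auto simp: bij_betw_def)
    show "(\<lambda>t. f (\<Sum>b\<in>Basis. t b *\<^sub>R b)) \<in> PiM Basis (\<lambda>_. gauss1) \<rightarrow>\<^sub>M borel"
      unfolding f_def by measurable
  qed (simp add: comp_def)
  also have "(\<lambda>t. f (\<Sum>b\<in>Basis. t (\<sigma> b) *\<^sub>R b)) = (\<lambda>t. \<Sum>i\<in>I. t i *\<^sub>R B i)"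
  proof
    fix t :: "'i \<Rightarrow> real"
    have "f (\<Sum>b\<in>Basis. t (\<sigma> b) *\<^sub>R b) = (\<Sum>b\<in>Basis. t (\<sigma> b) *\<^sub>R B (\<sigma> b))"
      by (simp add: f_def inner_sum_left inner_Basis sum.delta if_distrib cong: if_cong)
    also have "\<dots> = (\<Sum>i\<in>I. t i *\<^sub>R B i)" by (rule sum.reindex_bij_betw[OF \<sigma>])
    finally show "f (\<Sum>b\<in>Basis. t (\<sigma> b) *\<^sub>R b) = (\<Sum>i\<in>I. t i *\<^sub>R B i)" .
  qed
  finally show ?thesis .
qed

section \<open>The law of the norm of a Gaussian vector\<close>

definition radial :: "nat \<Rightarrow> real measure" where
  "radial d = distr (PiM {..<d} (\<lambda>_. gauss1)) borel (\<lambda>t. sqrt (\<Sum>i<d. (t i)\<^sup>2))"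

lemma sets_radial[simp, measurable_cong]: "sets (radial d) = sets borel" by (simp add: radial_def)
lemma space_radial[simp]: "space (radial d) = UNIV" by (simp add: radial_def)

lemma prob_space_radial: "prob_space (radial d)"
  unfolding radial_def by (intro prob_space.prob_space_distr prob_space_PiM prob_space_gauss1) simp

text \<open>Polar coordinates for radial functions: both sides give the half-line up to r the volume
  of the ball of radius r, and half-lines generate the Borel sets.\<close>

lemma distr_norm_PiM_lborel:
  assumes d: "d > 0"
  shows "distr (PiM {..<d} (\<lambda>_. lborel)) borel (\<lambda>t. sqrt (\<Sum>i<d. (t i)\<^sup>2))
    = density lborel (\<lambda>r. ennreal (real d * unit_ball_vol d * r ^ (d - 1)) * indicator {0..} r)"
    (is "?N = ?D")
proof (rule measure_eqI_generator_eq)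
  let ?P = "PiM {..<d} (\<lambda>_. lborel :: real measure)"
  let ?V = "unit_ball_vol (real d)"
  have V: "?V \<ge> 0" by simp
  have N_pos: "emeasure ?N {..r} = ennreal (?V * r ^ d)" if "r > 0" for r
  proof -
    have "emeasure ?N {..r} = emeasure ?P ({t. sqrt (\<Sum>i<d. (t i)\<^sup>2) \<le> r} \<inter> space ?P)"
      by (subst emeasure_distr) (auto intro!: arg_cong[where f="emeasure _"])
    then show ?thesis using emeasure_cball_aux[of "{..<d}" r] that by simp
  qed
  have D_pos: "emeasure ?D {..r} = ennreal (?V * r ^ d)" if "r > 0" for r
  proof -
    have "emeasure ?D {..r} = (\<integral>\<^sup>+x. ennreal (real d * ?V * x ^ (d - 1)) * indicator {0..} x * indicator {..r} x \<partial>lborel)"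
      by (rule emeasure_density) auto
    also have "\<dots> = (\<integral>\<^sup>+x. ennreal (real d * ?V * x ^ (d - 1)) * indicator {0..r} x \<partial>lborel)"
      by (intro nn_integral_cong) (auto simp: indicator_def)
    also have "\<dots> = ennreal (?V * r ^ d - ?V * 0 ^ d)"
      using that d V by (intro nn_integral_FTC_Icc) (auto intro!: derivative_eq_intros simp: mult_ac)
    finally show ?thesis using d by (simp add: zero_power)
  qed
  \<comment> \<open>The ball formula was obtained for positive radii only. At r <= 0 the mass is
    bounded by that of every small ball, and the bound tends to 0 because d > 0.\<close>
  have N_neg: "emeasure ?N {..r} = 0" if r: "r \<le> 0" for r
  proof -
    have "((\<lambda>e. ennreal (?V * e ^ d)) \<longlongrightarrow> ennreal (?V * 0 ^ d)) (at_right 0)"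
      by (intro tendsto_intros tendsto_ennrealI)
    moreover have "\<forall>\<^sub>F e in at_right 0. emeasure ?N {..r} \<le> ennreal (?V * e ^ d)"
      using r by (intro eventually_at_rightI[of 0 1])
        (auto simp: N_pos[symmetric] simp del: emeasure_distr intro!: emeasure_mono)
    ultimately have "emeasure ?N {..r} \<le> ennreal (?V * 0 ^ d)"
      by (intro tendsto_lowerbound) auto
    also have "ennreal (?V * 0 ^ d) = 0" using d by (simp only: zero_power mult_zero_right ennreal_0)
    finally show ?thesis by (simp only: le_zero_eq)
  qed
  have D_neg: "emeasure ?D {..r} = 0" if r: "r \<le> 0" for r
  proof -
    have "emeasure ?D {..r} = (\<integral>\<^sup>+x. ennreal (real d * ?V * x ^ (d - 1)) * indicator {0..} x * indicator {..r} x \<partial>lborel)"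
      by (rule emeasure_density) auto
    also have "\<dots> = (\<integral>\<^sup>+x. 0 \<partial>(lborel :: real measure))"
      using AE_lborel_singleton[of "0::real"] r
      by (intro nn_integral_cong_AE) (auto simp: indicator_def elim: eventually_mono)
    finally show ?thesis by simp
  qed
  show "Int_stable (range (\<lambda>r::real. {..r}))"
    by (auto simp: Int_stable_def)
  show "emeasure ?N X = emeasure ?D X" if "X \<in> range (\<lambda>r::real. {..r})" for X
    using that N_pos D_pos N_neg D_neg by (metis (mono_tags, lifting) imageE not_less)
  show "sets ?N = sigma_sets UNIV (range (\<lambda>r::real. {..r}))"
    by (simp add: borel_eq_atMost)
  show "sets ?D = sigma_sets UNIV (range (\<lambda>r::real. {..r}))"
    by (simp add: borel_eq_atMost)
  show "(\<Union>i::nat. {..real i}) = UNIV" by (auto intro: real_arch_simple)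
  show "emeasure ?N {..real i} \<noteq> \<infinity>" for i :: nat
    using N_pos[of "real i"] N_neg[of "real i"] by (cases "real i > 0") auto
qed auto

text \<open>The Gaussian density is a function of the norm, so it passes through the image under the
  norm. The constant comes from the unit ball volume pi^(d/2) / Gamma(d/2 + 1), from Gamma(d/2 + 1)
  = (d/2) Gamma(d/2) and from the surface factor d.\<close>

lemma radial_eq_density:
  assumes d: "d > 0"
  shows "radial d = density lborel
    (\<lambda>r. ennreal (2 / Gamma (real d / 2) * r powr (real d - 1) * exp (- r\<^sup>2)) * indicator {0<..} r)"
proof -
  let ?P = "PiM {..<d} (\<lambda>_. lborel :: real measure)"
  let ?\<rho> = "\<lambda>t. sqrt (\<Sum>i<d. (t i)\<^sup>2)"
  have "PiM {..<d} (\<lambda>_. gauss1) = density ?P (\<lambda>t. \<Prod>i<d. ennreal (exp (- (t i)\<^sup>2) / sqrt pi))"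
    unfolding gauss1_def
  proof (rule density_PiM)
    show "sigma_finite_measure (density lborel (\<lambda>t. ennreal (exp (- t\<^sup>2) / sqrt pi)))"
      using prob_space_gauss1 unfolding gauss1_def prob_space_def finite_measure_def by simp
  qed (auto intro: sigma_finite_lborel)
  also have "\<dots> = density ?P (\<lambda>t. ennreal (exp (- (?\<rho> t)\<^sup>2) / sqrt pi ^ d))"
    by (simp add: prod_ennreal exp_sum[symmetric] sum_negf prod_dividef sum_nonneg)
  finally have "radial d = distr (density ?P (\<lambda>t. ennreal (exp (- (?\<rho> t)\<^sup>2) / sqrt pi ^ d))) borel ?\<rho>"
    by (simp add: radial_def)
  also have "\<dots> = density (distr ?P borel ?\<rho>) (\<lambda>r. ennreal (exp (- r\<^sup>2) / sqrt pi ^ d))"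
    by (rule density_distr[symmetric]) auto
  also have "\<dots> = density lborel (\<lambda>r. ennreal (real d * unit_ball_vol d * r ^ (d - 1)) * indicator {0..} r
       * ennreal (exp (- r\<^sup>2) / sqrt pi ^ d))"
    by (subst distr_norm_PiM_lborel[OF d], subst density_density_eq) auto
  also have "\<dots> = density lborel
    (\<lambda>r. ennreal (2 / Gamma (real d / 2) * r powr (real d - 1) * exp (- r\<^sup>2)) * indicator {0<..} r)"
  proof (rule density_cong)
    have c: "real d * unit_ball_vol d / sqrt pi ^ d = 2 / Gamma (real d / 2)"
    proof -
      have ni: "real d / 2 \<notin> \<int>\<^sub>\<le>\<^sub>0" using d by (auto dest: nonpos_Ints_nonpos)
      have G: "Gamma (real d / 2 + 1) = real d / 2 * Gamma (real d / 2)"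
        using Gamma_plus1[OF ni] by simp
      have "sqrt pi ^ d = pi powr (real d / 2)"
        by (simp add: powr_half_sqrt[symmetric] powr_realpow[symmetric] powr_powr)
      then show ?thesis
        using d by (simp add: unit_ball_vol_def G)
    qed
    show "AE r in lborel. ennreal (real d * unit_ball_vol d * r ^ (d - 1)) * indicator {0..} r
       * ennreal (exp (- r\<^sup>2) / sqrt pi ^ d) =
      ennreal (2 / Gamma (real d / 2) * r powr (real d - 1) * exp (- r\<^sup>2)) * indicator {0<..} r"
      \<comment> \<open>The origin is discarded because \<open>0 ^ 0\<close> is 1 while
        \<open>0 powr 0\<close> is 0, so that for d = 1 the two densities differ there.\<close>
      using AE_lborel_singleton[of "0::real"]
    proof (rule eventually_mono)
      fix r :: real assume "r \<noteq> 0"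
      show "ennreal (real d * unit_ball_vol d * r ^ (d - 1)) * indicator {0..} r
         * ennreal (exp (- r\<^sup>2) / sqrt pi ^ d) =
        ennreal (2 / Gamma (real d / 2) * r powr (real d - 1) * exp (- r\<^sup>2)) * indicator {0<..} r"
      proof (cases "r > 0")
        case True
        then have p: "r ^ (d - 1) = r powr (real d - 1)"
          using d by (simp add: powr_realpow[symmetric] of_nat_diff)
        have "ennreal (real d * unit_ball_vol d * r ^ (d - 1)) * ennreal (exp (- r\<^sup>2) / sqrt pi ^ d)
          = ennreal ((real d * unit_ball_vol d / sqrt pi ^ d) * r powr (real d - 1) * exp (- r\<^sup>2))"
          unfolding p using True by (simp add: ennreal_mult''[symmetric])
        then show ?thesis using True by (simp add: c)
      qed (use \<open>r \<noteq> 0\<close> in auto)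
    qed
  qed auto
  finally show ?thesis .
qed

text \<open>The densities in dimensions d and d - k differ by a power of r and a constant. Every
  Gamma quotient in the final constant originates here.\<close>

lemma radial_shift:
  assumes "k < d"
  shows "radial (d - k) = density (radial d)
    (\<lambda>r. ennreal (Gamma (real d / 2) / Gamma (real (d - k) / 2) * r powr - real k))"
proof -
  have G: "Gamma (real d / 2) > 0" "Gamma (real (d - k) / 2) > 0" using assms by (auto intro!: Gamma_real_pos)
  have "density (radial d) (\<lambda>r. ennreal (Gamma (real d / 2) / Gamma (real (d - k) / 2) * r powr - real k))
    = density lborel (\<lambda>r. ennreal (2 / Gamma (real d / 2) * r powr (real d - 1) * exp (- r\<^sup>2)) * indicator {0<..} r
        * ennreal (Gamma (real d / 2) / Gamma (real (d - k) / 2) * r powr - real k))"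
    using assms by (subst radial_eq_density[of d]) (simp_all add: density_density_eq)
  also have "\<dots> = density lborel
    (\<lambda>r. ennreal (2 / Gamma (real (d - k) / 2) * r powr (real (d - k) - 1) * exp (- r\<^sup>2)) * indicator {0<..} r)"
  proof (intro density_cong AE_I2)
    fix r :: real
    have p: "r powr (real (d - k) - 1) = r powr (real d - 1) * r powr - real k"
    proof -
      have "real (d - k) - 1 = (real d - 1) + - real k" using assms by (simp add: of_nat_diff)
      then show ?thesis by (simp only: powr_add)
    qed
    show "ennreal (2 / Gamma (real d / 2) * r powr (real d - 1) * exp (- r\<^sup>2)) * indicator {0<..} r
        * ennreal (Gamma (real d / 2) / Gamma (real (d - k) / 2) * r powr - real k)
      = ennreal (2 / Gamma (real (d - k) / 2) * r powr (real (d - k) - 1) * exp (- r\<^sup>2)) * indicator {0<..} r"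
      using G by (cases "r > 0") (simp_all add: p ennreal_mult''[symmetric] mult_ac)
  qed auto
  finally show ?thesis
    using assms by (simp add: radial_eq_density[of "d - k"])
qed

lemma AE_radial_pos: "d > 0 \<Longrightarrow> AE r in radial d. r > 0"
  by (subst radial_eq_density, simp) (auto simp: AE_density indicator_def)

section \<open>Gram-Schmidt orthonormalization of Gaussian columns\<close>

text \<open>Division by a vanishing norm gives 0, so a column depending on its predecessors yields
  the zero vector. This makes the procedure total, and the decomposition of \<open>X j\<close> below
  holds for every family.\<close>

fun gs :: "(nat \<Rightarrow> 'v::real_inner) \<Rightarrow> nat \<Rightarrow> 'v" where
  "gs X j = (X j - (\<Sum>i<j. (X j \<bullet> gs X i) *\<^sub>R gs X i)) /\<^sub>R norm (X j - (\<Sum>i<j. (X j \<bullet> gs X i) *\<^sub>R gs X i))"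

declare gs.simps[simp del]

definition gs_norm :: "(nat \<Rightarrow> 'v::real_inner) \<Rightarrow> nat \<Rightarrow> real" where
  "gs_norm X j = norm (X j - (\<Sum>i<j. (X j \<bullet> gs X i) *\<^sub>R gs X i))"

lemma gs_norm_nonneg[simp]: "gs_norm X j \<ge> 0" by (simp add: gs_norm_def)

lemma gs_norm_scaleR_gs:
  "gs_norm X j *\<^sub>R gs X j = X j - (\<Sum>i<j. (X j \<bullet> gs X i) *\<^sub>R gs X i)"
  by (subst gs.simps) (cases "gs_norm X j = 0"; simp add: gs_norm_def del: right_minus_eq)

lemma gs_decompose: "X j = (\<Sum>i<j. (X j \<bullet> gs X i) *\<^sub>R gs X i) + gs_norm X j *\<^sub>R gs X j"
  by (simp add: gs_norm_scaleR_gs)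

lemma gs_inner_self: "gs X j \<bullet> gs X j = (if gs_norm X j = 0 then 0 else 1)"
  by (subst (1 2) gs.simps)
     (simp add: gs_norm_def dot_square_norm power2_eq_square del: right_minus_eq)

lemma gs_eq_0: "gs_norm X j = 0 \<Longrightarrow> gs X j = 0"
  using gs_inner_self[of X j] by simp

lemma gs_orthogonal_less: "i < j \<Longrightarrow> gs X j \<bullet> gs X i = 0"
proof (induction j arbitrary: i rule: less_induct)
  case (less j)
  have o: "gs X l \<bullet> gs X i = 0" if "l < j" "l \<noteq> i" for l
  proof -
    have "i < l \<Longrightarrow> gs X l \<bullet> gs X i = 0" by (rule less.IH[OF that(1)])
    moreover have "l < i \<Longrightarrow> gs X l \<bullet> gs X i = 0"
      by (subst inner_commute) (rule less.IH[OF less.prems])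
    ultimately show ?thesis using that(2) by (cases l i rule: linorder_cases) simp_all
  qed
  have "(\<Sum>l<j. (X j \<bullet> gs X l) *\<^sub>R gs X l) \<bullet> gs X i = (\<Sum>l<j. if l = i then (X j \<bullet> gs X i) * (gs X i \<bullet> gs X i) else 0)"
    unfolding inner_sum_left by (intro sum.cong) (auto simp: o)
  also have "\<dots> = (X j \<bullet> gs X i) * (gs X i \<bullet> gs X i)"
    using less.prems by simp
  \<comment> \<open>Either \<open>gs X i\<close> is a unit vector, or it vanishes and both sides are
    0.\<close>
  also have "\<dots> = X j \<bullet> gs X i"
    using gs_inner_self[of X i] gs_eq_0[of X i] by (cases "gs_norm X i = 0") simp_all
  finally show ?case
    by (subst gs.simps) (simp add: inner_diff_left)
qed

lemma gs_orthogonal: "i \<noteq> j \<Longrightarrow> gs X i \<bullet> gs X j = 0"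
  using gs_orthogonal_less[of i j X] gs_orthogonal_less[of j i X]
  by (metis inner_commute linorder_neqE_nat)

text \<open>Families drawn from a product measure are \<open>undefined\<close> beyond the last
  column. This and \<open>gs_norm_cong\<close> allow such a family to be exchanged for any other
  with the same relevant columns.\<close>

lemma gs_cong: "(\<And>i. i \<le> j \<Longrightarrow> X i = Y i) \<Longrightarrow> gs X j = gs Y j"
proof (induction j rule: less_induct)
  case (less j)
  then have "gs X i = gs Y i" if "i < j" for i using that by simp
  then have "(\<Sum>i<j. (X j \<bullet> gs X i) *\<^sub>R gs X i) = (\<Sum>i<j. (Y j \<bullet> gs Y i) *\<^sub>R gs Y i)"
    using less.prems[of j] by simp
  then show ?case using less.prems[of j] by (subst (1 2) gs.simps) simp
qed

lemma gs_norm_cong: "(\<And>i. i \<le> j \<Longrightarrow> X i = Y i) \<Longrightarrow> gs_norm X j = gs_norm Y j"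
proof -
  assume a: "\<And>i. i \<le> j \<Longrightarrow> X i = Y i"
  then have "gs X i = gs Y i" if "i < j" for i using that by (intro gs_cong) auto
  then have "(\<Sum>i<j. (X j \<bullet> gs X i) *\<^sub>R gs X i) = (\<Sum>i<j. (Y j \<bullet> gs Y i) *\<^sub>R gs Y i)"
    using a[of j] by simp
  then show ?thesis using a[of j] by (simp add: gs_norm_def)
qed

text \<open>The procedure uses nothing but inner products and linear combinations. The isometry may
  change the space: it will be a rotation, or the embedding of a smaller Euclidean space.\<close>

lemma gs_isometry:
  assumes J: "linear J" "\<And>x y. J x \<bullet> J y = x \<bullet> y"
  shows "gs (\<lambda>i. J (X i)) j = J (gs X j)" and "gs_norm (\<lambda>i. J (X i)) j = gs_norm X j"
proof -
  have n: "norm (J x) = norm x" for x by (simp add: norm_eq_sqrt_inner J)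
  have res: "J (X j) - (\<Sum>i<j. (J (X j) \<bullet> gs (\<lambda>i. J (X i)) i) *\<^sub>R gs (\<lambda>i. J (X i)) i)
     = J (X j - (\<Sum>i<j. (X j \<bullet> gs X i) *\<^sub>R gs X i))"
    if "\<And>i. i < j \<Longrightarrow> gs (\<lambda>i. J (X i)) i = J (gs X i)" for j
    using that by (simp add: J linear_diff linear_sum linear_cmul)
  have gs: "gs (\<lambda>i. J (X i)) j = J (gs X j)" for j
  proof (induction j rule: less_induct)
    case (less j)
    show ?case using J by (subst (1 2) gs.simps) (simp add: res[OF less] n linear_cmul)
  qed
  then show "gs (\<lambda>i. J (X i)) j = J (gs X j)" .
  show "gs_norm (\<lambda>i. J (X i)) j = gs_norm X j"
    unfolding gs_norm_def by (subst res[OF gs]) (rule n)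
qed

lemma measurable_gs:
  fixes Y :: "'w \<Rightarrow> nat \<Rightarrow> 'v::euclidean_space"
  assumes "\<And>i. i \<le> j \<Longrightarrow> (\<lambda>w. Y w i) \<in> borel_measurable M"
  shows "(\<lambda>w. gs (Y w) j) \<in> borel_measurable M"
  using assms
proof (induction j rule: less_induct)
  case (less j)
  have [measurable]: "(\<lambda>w. gs (Y w) i) \<in> borel_measurable M" if "i \<in> {..<j}" for i
    using that by (intro less) auto
  have [measurable]: "(\<lambda>w. Y w j) \<in> borel_measurable M" by (rule less) simp
  show ?case by (subst gs.simps) measurable
qed

lemma measurable_gs_norm:
  fixes Y :: "'w \<Rightarrow> nat \<Rightarrow> 'v::euclidean_space"
  assumes "\<And>i. i \<le> j \<Longrightarrow> (\<lambda>w. Y w i) \<in> borel_measurable M"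
  shows "(\<lambda>w. gs_norm (Y w) j) \<in> borel_measurable M"
proof -
  have [measurable]: "(\<lambda>w. gs (Y w) i) \<in> borel_measurable M" if "i \<in> {..<j}" for i
    using that by (intro measurable_gs assms) auto
  have [measurable]: "(\<lambda>w. Y w j) \<in> borel_measurable M" by (rule assms) simp
  show ?thesis unfolding gs_norm_def by measurable
qed

text \<open>Column \<open>j\<close> of the triangular factor, split into the entries above the diagonal and the diagonal one.\<close>

definition gs_coords :: "(nat \<Rightarrow> 'v::real_inner) \<Rightarrow> nat \<Rightarrow> (nat \<Rightarrow> real) \<times> real" where
  "gs_coords X j = (\<lambda>i\<in>{..<j}. X j \<bullet> gs X i, gs_norm X j)"

lemma gs_coords_cong: "(\<And>i. i \<le> j \<Longrightarrow> X i = Y i) \<Longrightarrow> gs_coords X j = gs_coords Y j"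
  unfolding gs_coords_def by (auto intro!: restrict_ext gs_norm_cong arg_cong2[where f=inner] gs_cong)

abbreviation coordM :: "nat \<Rightarrow> ((nat \<Rightarrow> real) \<times> real) measure" where
  "coordM j \<equiv> PiM {..<j} (\<lambda>_. borel) \<Otimes>\<^sub>M borel"

lemma measurable_gs_coords:
  fixes Y :: "'w \<Rightarrow> nat \<Rightarrow> 'v::euclidean_space"
  assumes "\<And>i. i \<le> j \<Longrightarrow> (\<lambda>w. Y w i) \<in> borel_measurable M"
  shows "(\<lambda>w. gs_coords (Y w) j) \<in> M \<rightarrow>\<^sub>M coordM j"
proof -
  have [measurable]: "(\<lambda>w. gs (Y w) i) \<in> borel_measurable M" if "i \<in> {..<j}" for i
    using that by (intro measurable_gs assms) auto
  have [measurable]: "(\<lambda>w. Y w j) \<in> borel_measurable M" by (rule assms) simp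
  have [measurable]: "(\<lambda>w. gs_norm (Y w) j) \<in> borel_measurable M" by (intro measurable_gs_norm assms)
  show ?thesis unfolding gs_coords_def by measurable
qed

section \<open>Orthonormal systems and coordinates adapted to them\<close>

definition orthonormal :: "'v::real_inner set \<Rightarrow> bool" where
  "orthonormal S \<longleftrightarrow> (\<forall>a\<in>S. \<forall>b\<in>S. a \<bullet> b = (if a = b then 1 else 0))"

definition proj_off :: "'v::real_inner set \<Rightarrow> 'v \<Rightarrow> 'v" where
  "proj_off S x = x - (\<Sum>s\<in>S. (x \<bullet> s) *\<^sub>R s)"

lemma proj_off_empty[simp]: "proj_off {} x = x" by (simp add: proj_off_def)

lemma borel_measurable_proj_off[measurable]:
  fixes f :: "'w \<Rightarrow> 'v::euclidean_space"
  assumes [measurable]: "f \<in> borel_measurable M"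
  shows "(\<lambda>w. proj_off S (f w)) \<in> borel_measurable M"
  unfolding proj_off_def by measurable

lemma orthonormal_independent:
  fixes S :: "'v::euclidean_space set"
  assumes "orthonormal S" shows "independent S" "finite S" "card S \<le> DIM('v)"
proof -
  have "pairwise orthogonal S"
    using assms by (auto simp: orthonormal_def pairwise_def orthogonal_def)
  moreover have "0 \<notin> S"
    using assms unfolding orthonormal_def by (metis inner_zero_left zero_neq_one)
  ultimately show i: "independent S" by (rule pairwise_orthogonal_independent)
  show "finite S" "card S \<le> DIM('v)" using independent_bound[OF i] by auto
qed

text \<open>R is an orthonormal basis of the orthogonal complement of the span of S.\<close>

lemma orthonormal_extend:
  fixes S :: "'v::euclidean_space set"
  assumes S: "orthonormal S"
  obtains R where "orthonormal (S \<union> R)" "S \<inter> R = {}" "card S + card R = DIM('v)"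
proof -
  let ?C = "{x \<in> UNIV. \<forall>s\<in>span S. orthogonal s x}"
  have "subspace ?C"
    by (auto simp: subspace_def orthogonal_def inner_add_right)
  then obtain R where R: "R \<subseteq> ?C" "pairwise orthogonal R" "\<And>x. x \<in> R \<Longrightarrow> norm x = 1"
    "independent R" "card R = dim ?C" "span R = ?C"
    by (rule orthonormal_basis_subspace) blast
  have d: "dim ?C + dim (span S) = DIM('v)"
    using dim_subspace_orthogonal_to_vectors[of "span S" UNIV] by simp
  have disj: "S \<inter> R = {}"
    using R(1,3) S by (fastforce simp: orthonormal_def orthogonal_def norm_eq_1 span_base)
  have "orthonormal (S \<union> R)"
    unfolding orthonormal_def
  proof (intro ballI)
    fix a b assume "a \<in> S \<union> R" "b \<in> S \<union> R"
    moreover have "a \<bullet> b = 0" "b \<bullet> a = 0" "a \<noteq> b" if "a \<in> S" "b \<in> R" for a b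
      using R(1) that disj by (auto simp: orthogonal_def inner_commute span_base)
    moreover have "a \<bullet> b = (if a = b then 1 else 0)" if "a \<in> R" "b \<in> R" for a b
      using R(2,3) that by (auto simp: pairwise_def orthogonal_def norm_eq_1)
    ultimately show "a \<bullet> b = (if a = b then 1 else 0)"
      using S unfolding orthonormal_def by (metis Un_iff)
  qed
  then show thesis
    using d R(5) disj orthonormal_independent[OF S] by (intro that) (auto simp: dim_eq_card_independent)
qed

text \<open>The numbered form of \<open>orthonormal_extend\<close>, with the given vectors in front.
  It supplies adapted Gaussian coordinates, the rotation between two frames, and the completion of a
  frame to an orthogonal matrix.\<close>

lemma orthonormal_family_extend:
  fixes Q :: "nat \<Rightarrow> 'v::euclidean_space"
  assumes Q: "\<And>i i'. i < m \<Longrightarrow> i' < m \<Longrightarrow> Q i \<bullet> Q i' = (if i = i' then 1 else 0)"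
    and le: "m \<le> DIM('v)"
  obtains B where "\<And>i. i < m \<Longrightarrow> B i = Q i"
    "\<And>i i'. i < DIM('v) \<Longrightarrow> i' < DIM('v) \<Longrightarrow> B i \<bullet> B i' = (if i = i' then 1 else (0::real))"
proof -
  define T where "T = Q ` {..<m}"
  have injQ: "inj_on Q {..<m}"
    using Q by (intro inj_onI) (metis lessThan_iff zero_neq_one)
  then have cardT: "card T = m" by (simp add: T_def card_image)
  have "orthonormal T"
    unfolding orthonormal_def
  proof (intro ballI)
    fix a b assume "a \<in> T" "b \<in> T"
    then obtain i i' where "a = Q i" "b = Q i'" "i < m" "i' < m" by (auto simp: T_def)
    then show "a \<bullet> b = (if a = b then 1 else 0)" using Q[of i i'] injQ by (auto simp: inj_on_def)
  qed
  then obtain R where R: "orthonormal (T \<union> R)" "T \<inter> R = {}" "card T + card R = DIM('v)"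
    by (rule orthonormal_extend)
  have finR: "finite R" using orthonormal_independent(2)[OF R(1)] by simp
  have "card {m..<DIM('v)} = card R" using R(3) cardT by simp
  then obtain h where h: "bij_betw h {m..<DIM('v)} R"
    using finR by (metis finite_same_card_bij finite_atLeastLessThan)
  define B where "B i = (if i < m then Q i else h i)" for i
  have BQ: "bij_betw B {..<m} T"
    unfolding T_def B_def by (rule bij_betw_cong[THEN iffD1, OF _ inj_on_imp_bij_betw[OF injQ]]) simp
  have BR: "bij_betw B {m..<DIM('v)} R"
    by (rule bij_betw_cong[THEN iffD1, OF _ h]) (simp add: B_def)
  have D: "{..<m} \<union> {m..<DIM('v)} = {..<DIM('v)}" using le by auto
  have "bij_betw B ({..<m} \<union> {m..<DIM('v)}) (T \<union> R)"
    using R(2) by (intro bij_betw_combine BQ BR) auto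
  then have bijB: "bij_betw B {..<DIM('v)} (T \<union> R)" unfolding D .
  have "B i \<bullet> B i' = (if i = i' then 1 else 0)" if "i < DIM('v)" "i' < DIM('v)" for i i'
  proof -
    have "B i \<in> T \<union> R" "B i' \<in> T \<union> R" using bijB that by (auto simp: bij_betw_def)
    moreover have "B i = B i' \<longleftrightarrow> i = i'" using bijB that by (auto simp: bij_betw_def inj_on_def)
    ultimately show ?thesis using R(1) unfolding orthonormal_def by metis
  qed
  then show thesis by (intro that[of B]) (auto simp: B_def)
qed

text \<open>The first j and the last d coordinates form disjoint, hence independent blocks; the
  coordinates between them are integrated out. A shift of indices turns the last block into the
  standard d coordinates.\<close>

lemma distr_PiM_gauss1_split:
  assumes "j + d \<le> D"
  shows "distr (PiM {..<D} (\<lambda>_. gauss1)) (coordM j) (\<lambda>t. (\<lambda>i\<in>{..<j}. t i, sqrt (\<Sum>i\<in>{D-d..<D}. (t i)\<^sup>2)))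
    = PiM {..<j} (\<lambda>_. gauss1) \<Otimes>\<^sub>M radial d"
proof -
  let ?I = "{..<j}" and ?J = "{j..<D}"
  let ?G = "\<lambda>I::nat set. PiM I (\<lambda>_. gauss1)"
  interpret g: prob_space gauss1 by (rule prob_space_gauss1)
  interpret p: product_prob_space "\<lambda>_::nat. gauss1" ..
  interpret I: prob_space "?G ?I" by (rule prob_space_PiM) (rule prob_space_gauss1)
  interpret J: prob_space "?G ?J" by (rule prob_space_PiM) (rule prob_space_gauss1)
  have U: "?I \<union> ?J = {..<D}" using assms by auto
  let ?F = "\<lambda>t::nat \<Rightarrow> real. (\<lambda>i\<in>{..<j}. t i, sqrt (\<Sum>i\<in>{D-d..<D}. (t i)\<^sup>2))"
  have eq: "?G {..<D} = distr (?G ?I \<Otimes>\<^sub>M ?G ?J) (?G {..<D}) (merge ?I ?J)"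
    using p.distr_merge[of ?I ?J] by (simp add: U ivl_disj_int)
  have F: "(\<lambda>t. (\<lambda>i\<in>{..<j}. t i, sqrt (\<Sum>i\<in>{D-d..<D}. (t i)\<^sup>2))) \<in> ?G {..<D} \<rightarrow>\<^sub>M coordM j"
    using assms by (intro measurable_Pair measurable_restrict borel_measurable_sqrt borel_measurable_sum borel_measurable_power) auto
  have merge: "merge ?I ?J \<in> ?G ?I \<Otimes>\<^sub>M ?G ?J \<rightarrow>\<^sub>M ?G {..<D}"
    using measurable_merge[of ?I ?J "\<lambda>_. gauss1"] by (simp only: U)
  have "distr (?G {..<D}) (coordM j) ?F
    = distr (?G ?I \<Otimes>\<^sub>M ?G ?J) (coordM j)
        (\<lambda>z. (\<lambda>i\<in>{..<j}. merge ?I ?J z i, sqrt (\<Sum>i\<in>{D-d..<D}. (merge ?I ?J z i)\<^sup>2)))"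
    by (subst eq, subst distr_distr[OF F merge]) (simp add: comp_def)
  also have "\<dots> = distr (?G ?I \<Otimes>\<^sub>M ?G ?J) (coordM j) (\<lambda>(a, b). (a, sqrt (\<Sum>i\<in>{D-d..<D}. (b i)\<^sup>2)))"
  proof (rule distr_cong)
    fix z assume "z \<in> space (?G ?I \<Otimes>\<^sub>M ?G ?J)"
    then show "(\<lambda>i\<in>{..<j}. merge ?I ?J z i, sqrt (\<Sum>i\<in>{D-d..<D}. (merge ?I ?J z i)\<^sup>2))
       = (case z of (a, b) \<Rightarrow> (a, sqrt (\<Sum>i\<in>{D-d..<D}. (b i)\<^sup>2)))"
      using assms
      by (auto simp: space_pair_measure space_PiM merge_def PiE_def extensional_def fun_eq_iff
          intro!: arg_cong[where f=sqrt] sum.cong)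
  qed auto
  also have "\<dots> = distr (?G ?I) (PiM ?I (\<lambda>_. borel)) (\<lambda>a. a) \<Otimes>\<^sub>M distr (?G ?J) borel (\<lambda>b. sqrt (\<Sum>i\<in>{D-d..<D}. (b i)\<^sup>2))"
  proof (rule pair_measure_distr[symmetric])
    show m: "(\<lambda>b. sqrt (\<Sum>i\<in>{D-d..<D}. (b i)\<^sup>2)) \<in> ?G ?J \<rightarrow>\<^sub>M borel"
    proof -
      have [measurable]: "(\<lambda>b. b i) \<in> ?G ?J \<rightarrow>\<^sub>M borel" if "i \<in> {D-d..<D}" for i
      proof -
        have "i \<in> ?J" using assms that by auto
        from measurable_component_singleton[OF this, of "\<lambda>_. gauss1"] show ?thesis
          by (simp add: measurable_cong_sets[OF refl sets_gauss1])
      qed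
      show ?thesis by measurable
    qed
    show "sigma_finite_measure (distr (?G ?J) borel (\<lambda>b. sqrt (\<Sum>i\<in>{D-d..<D}. (b i)\<^sup>2)))"
      using J.prob_space_distr[OF m] by (simp add: prob_space_def finite_measure_def)
  qed (simp add: measurable_ident_sets cong: sets_PiM_cong)
  also have "distr (?G ?I) (PiM ?I (\<lambda>_. borel)) (\<lambda>a. a) = ?G ?I"
    by (rule distr_id2) (simp cong: sets_PiM_cong)
  also have "distr (?G ?J) borel (\<lambda>b. sqrt (\<Sum>i\<in>{D-d..<D}. (b i)\<^sup>2)) = radial d"
  proof -
    have "?G {..<d} = distr (?G ?J) (?G {..<d}) (\<lambda>w. \<lambda>n\<in>{..<d}. w (n + (D - d)))"
      using assms by (intro distr_PiM_reindex[symmetric] prob_space_gauss1) (auto intro!: inj_onI)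
    then have "radial d = distr (distr (?G ?J) (?G {..<d}) (\<lambda>w. \<lambda>n\<in>{..<d}. w (n + (D - d)))) borel (\<lambda>t. sqrt (\<Sum>i<d. (t i)\<^sup>2))"
      by (simp add: radial_def)
    also have "\<dots> = distr (?G ?J) borel (\<lambda>w. sqrt (\<Sum>i<d. (w (i + (D - d)))\<^sup>2))"
      using assms
      by (subst distr_distr)
        (auto simp: comp_def intro!: measurable_restrict measurable_component_singleton)
    also have "(\<lambda>w. sqrt (\<Sum>i<d. (w (i + (D - d)))\<^sup>2)) = (\<lambda>b::nat\<Rightarrow>real. sqrt (\<Sum>i\<in>{D-d..<D}. (b i)\<^sup>2))"
    proof
      fix w :: "nat \<Rightarrow> real"
      show "sqrt (\<Sum>i<d. (w (i + (D - d)))\<^sup>2) = sqrt (\<Sum>i\<in>{D-d..<D}. (w i)\<^sup>2)"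
        using sum.shift_bounds_nat_ivl[of "\<lambda>i. (w i)\<^sup>2" 0 "D - d" d] assms by (simp add: atLeast0LessThan)
    qed
    finally show ?thesis by simp
  qed
  finally show ?thesis .
qed

text \<open>In an orthonormal basis made of Q, then S, then further vectors, the coordinates of x
  are independent. Projection deletes the S-block, the inner products with Q are the first j
  coordinates, and the residual norm is the norm of the last block. With Q the frame built so far,
  this is one column of Gram-Schmidt.\<close>

lemma distr_gauss_frame_coords:
  fixes Q :: "nat \<Rightarrow> 'v::euclidean_space"
  assumes S: "orthonormal S" and Q: "\<And>i i'. i < j \<Longrightarrow> i' < j \<Longrightarrow> Q i \<bullet> Q i' = (if i = i' then 1 else 0)"
    and SQ: "\<And>i s. i < j \<Longrightarrow> s \<in> S \<Longrightarrow> Q i \<bullet> s = 0"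
    and le: "j + card S \<le> DIM('v)"
  shows "distr gauss (coordM j)
      (\<lambda>x. (\<lambda>i\<in>{..<j}. proj_off S x \<bullet> Q i, norm (proj_off S x - (\<Sum>i<j. (proj_off S x \<bullet> Q i) *\<^sub>R Q i))))
    = PiM {..<j} (\<lambda>_. gauss1) \<Otimes>\<^sub>M radial (DIM('v) - card S - j)" (is "distr _ _ ?F = _")
proof -
  define d where "d = DIM('v) - card S - j"
  have finS: "finite S" using S by (rule orthonormal_independent)
  have Dd: "DIM('v) - d = j + card S" using le by (simp add: d_def)
  have "card {j..<j + card S} = card S" by simp
  then obtain e where e: "bij_betw e {j..<j + card S} S"
    using finS by (metis finite_same_card_bij finite_atLeastLessThan)
  \<comment> \<open>The first j positions hold Q, the next \<open>card S\<close> an enumeration of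
    S; the extension below keeps both in place.\<close>
  define Q' where "Q' i = (if i < j then Q i else e i)" for i
  have Q': "Q' i \<bullet> Q' i' = (if i = i' then 1 else 0)" if "i < j + card S" "i' < j + card S" for i i'
  proof -
    have eS: "e l \<in> S" if "j \<le> l" "l < j + card S" for l using e that by (auto simp: bij_betw_def)
    have ee: "e l = e l' \<longleftrightarrow> l = l'" if "j \<le> l" "l < j + card S" "j \<le> l'" "l' < j + card S" for l l'
      using e that by (auto simp: bij_betw_def inj_on_def)
    show ?thesis
    proof (cases "i < j"; cases "i' < j")
      assume "\<not> i < j" "\<not> i' < j"
      then show ?thesis using that eS[of i] eS[of i'] ee[of i i'] S by (simp add: Q'_def orthonormal_def)
    qed (use that eS[of i] eS[of i'] in \<open>auto simp: Q'_def Q SQ inner_commute\<close>)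
  qed
  obtain B where BQ': "\<And>i. i < j + card S \<Longrightarrow> B i = Q' i"
    and orthoB: "\<And>i i'. i < DIM('v) \<Longrightarrow> i' < DIM('v) \<Longrightarrow> B i \<bullet> B i' = (if i = i' then 1 else (0::real))"
    using orthonormal_family_extend[of "j + card S" Q'] Q' le by auto
  have BQ: "B i = Q i" if "i < j" for i using that by (simp add: BQ' Q'_def)
  have BS: "bij_betw B {j..<DIM('v) - d} S"
    unfolding Dd by (rule bij_betw_cong[THEN iffD1, OF _ e]) (simp add: BQ' Q'_def)
  have D: "{..<j} \<union> {j..<DIM('v) - d} \<union> {DIM('v) - d..<DIM('v)} = {..<DIM('v)}" using Dd by auto
  have g: "gauss = distr (PiM {..<DIM('v)} (\<lambda>_. gauss1)) borel (\<lambda>t. \<Sum>i<DIM('v). t i *\<^sub>R B i)"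
    using orthoB by (intro gauss_eq_distr_orthonormal) auto
  have Fm: "?F \<in> borel \<rightarrow>\<^sub>M coordM j" by measurable
  have "distr gauss (coordM j) ?F = distr (PiM {..<DIM('v)} (\<lambda>_. gauss1)) (coordM j) (\<lambda>t. ?F (\<Sum>i<DIM('v). t i *\<^sub>R B i))"
    by (subst g, subst distr_distr[OF Fm]) (auto simp: comp_def)
  also have "(\<lambda>t. ?F (\<Sum>i<DIM('v). t i *\<^sub>R B i)) = (\<lambda>t. (\<lambda>i\<in>{..<j}. t i, sqrt (\<Sum>i\<in>{DIM('v)-d..<DIM('v)}. (t i)\<^sup>2)))"
  proof
    fix t :: "nat \<Rightarrow> real"
    let ?x = "\<Sum>i<DIM('v). t i *\<^sub>R B i"
    have xB: "?x \<bullet> B i = t i" if "i < DIM('v)" for i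
      using that by (simp add: inner_sum_left orthoB if_distrib cong: if_cong)
    have split: "?x = (\<Sum>i<j. t i *\<^sub>R B i) + (\<Sum>i\<in>{j..<DIM('v)-d}. t i *\<^sub>R B i) + (\<Sum>i\<in>{DIM('v)-d..<DIM('v)}. t i *\<^sub>R B i)"
    proof -
      have "{..<j} \<inter> {j..<DIM('v)-d} = {}" "({..<j} \<union> {j..<DIM('v)-d}) \<inter> {DIM('v)-d..<DIM('v)} = {}"
        using Dd by auto
      then show ?thesis unfolding D[symmetric] by (simp add: sum.union_disjoint)
    qed
    have "(\<Sum>s\<in>S. (?x \<bullet> s) *\<^sub>R s) = (\<Sum>i\<in>{j..<DIM('v)-d}. (?x \<bullet> B i) *\<^sub>R B i)"
      by (rule sum.reindex_bij_betw[OF BS, symmetric])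
    also have "\<dots> = (\<Sum>i\<in>{j..<DIM('v)-d}. t i *\<^sub>R B i)"
      by (intro sum.cong) (auto simp: xB)
    finally have P: "proj_off S ?x = (\<Sum>i<j. t i *\<^sub>R B i) + (\<Sum>i\<in>{DIM('v)-d..<DIM('v)}. t i *\<^sub>R B i)"
      unfolding proj_off_def by (subst (1) split) simp
    have PQ: "proj_off S ?x \<bullet> Q i = t i" if i: "i < j" for i
    proof -
      have Qi: "Q i = B i" using i le by (auto simp: BQ)
      have "(\<Sum>l<j. t l *\<^sub>R B l) \<bullet> B i = (\<Sum>l<j. if l = i then t l else 0)"
        unfolding inner_sum_left using le i by (intro sum.cong) (auto simp: orthoB)
      moreover have "(\<Sum>l\<in>{DIM('v)-d..<DIM('v)}. t l *\<^sub>R B l) \<bullet> B i = 0"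
        unfolding inner_sum_left using Dd i by (intro sum.neutral) (auto simp: orthoB)
      ultimately show ?thesis using i by (simp add: P Qi inner_add_left)
    qed
    have "(\<Sum>i<j. (proj_off S ?x \<bullet> Q i) *\<^sub>R Q i) = (\<Sum>i<j. t i *\<^sub>R B i)"
    proof (intro sum.cong refl)
      fix i assume "i \<in> {..<j}"
      then have "i < j" "B i = Q i" by (simp_all add: BQ)
      then show "(proj_off S ?x \<bullet> Q i) *\<^sub>R Q i = t i *\<^sub>R B i" by (simp only: PQ)
    qed
    then have "proj_off S ?x - (\<Sum>i<j. (proj_off S ?x \<bullet> Q i) *\<^sub>R Q i) = (\<Sum>i\<in>{DIM('v)-d..<DIM('v)}. t i *\<^sub>R B i)"
      by (simp add: P)
    moreover have "(\<Sum>i\<in>{DIM('v)-d..<DIM('v)}. t i *\<^sub>R B i) \<bullet> (\<Sum>i\<in>{DIM('v)-d..<DIM('v)}. t i *\<^sub>R B i) = (\<Sum>i\<in>{DIM('v)-d..<DIM('v)}. (t i)\<^sup>2)"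
    proof -
      have "(\<Sum>i\<in>{DIM('v)-d..<DIM('v)}. t i *\<^sub>R B i) \<bullet> (\<Sum>l\<in>{DIM('v)-d..<DIM('v)}. t l *\<^sub>R B l)
        = (\<Sum>i\<in>{DIM('v)-d..<DIM('v)}. \<Sum>l\<in>{DIM('v)-d..<DIM('v)}. if l = i then (t i)\<^sup>2 else 0)"
        unfolding inner_sum_left unfolding inner_sum_right
        by (intro sum.cong) (auto simp: orthoB power2_eq_square)
      then show ?thesis by simp
    qed
    ultimately show "?F ?x = (\<lambda>i\<in>{..<j}. t i, sqrt (\<Sum>i\<in>{DIM('v)-d..<DIM('v)}. (t i)\<^sup>2))"
      by (auto simp: norm_eq_sqrt_inner PQ)
  qed
  also have "distr (PiM {..<DIM('v)} (\<lambda>_. gauss1)) (coordM j) (\<lambda>t. (\<lambda>i\<in>{..<j}. t i, sqrt (\<Sum>i\<in>{DIM('v)-d..<DIM('v)}. (t i)\<^sup>2)))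
     = PiM {..<j} (\<lambda>_. gauss1) \<Otimes>\<^sub>M radial d"
    using le by (intro distr_PiM_gauss1_split) (simp add: d_def)
  finally show ?thesis unfolding d_def .
qed

section \<open>The joint law of the triangular factor\<close>

definition gauss_cols :: "nat \<Rightarrow> (nat \<Rightarrow> 'v::euclidean_space) measure" where
  "gauss_cols m = PiM {..<m} (\<lambda>_. gauss)"

lemma sets_gauss_cols[simp, measurable_cong]: "sets (gauss_cols m) = sets (PiM {..<m} (\<lambda>_. borel))"
  unfolding gauss_cols_def by (intro sets_PiM_cong) auto

lemma prob_space_gauss_cols: "prob_space (gauss_cols m)"
  unfolding gauss_cols_def by (intro prob_space_PiM prob_space_gauss)

lemma measurable_gauss_cols_component: "i < m \<Longrightarrow> (\<lambda>X. X i) \<in> borel_measurable (gauss_cols m)"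
  by (simp add: measurable_component_singleton cong: measurable_cong_sets)

text \<open>The law of column j of the triangular factor in a space of dimension d, in the format of
  \<open>gs_coords\<close>. Here d is a number, since after projection off S it is
  \<open>DIM('v) - card S\<close> and belongs to no type.\<close>

definition column_law :: "nat \<Rightarrow> nat \<Rightarrow> ((nat \<Rightarrow> real) \<times> real) measure" where
  "column_law d j = PiM {..<j} (\<lambda>_. gauss1) \<Otimes>\<^sub>M radial (d - j)"

lemma sets_column_law[simp, measurable_cong]: "sets (column_law d j) = sets (coordM j)"
  unfolding column_law_def by (intro sets_pair_measure_cong sets_PiM_cong) auto

lemma prob_space_column_law: "prob_space (column_law d j)"
proof -
  interpret prob_space "PiM {..<j} (\<lambda>_. gauss1)" by (intro prob_space_PiM prob_space_gauss1)
  interpret R: prob_space "radial (d - j)" by (rule prob_space_radial)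
  interpret pair_prob_space "PiM {..<j} (\<lambda>_. gauss1)" "radial (d - j)" ..
  show ?thesis unfolding column_law_def by (rule P.prob_space_axioms)
qed

lemma AE_column_law_pos:
  assumes "j < d" shows "AE z in column_law d j. snd z > 0"
proof -
  interpret prob_space "PiM {..<j} (\<lambda>_. gauss1)" by (intro prob_space_PiM prob_space_gauss1)
  interpret R: prob_space "radial (d - j)" by (rule prob_space_radial)
  interpret pair_prob_space "PiM {..<j} (\<lambda>_. gauss1)" "radial (d - j)" ..
  have "AE x in PiM {..<j} (\<lambda>_. gauss1). AE y in radial (d - j). snd (x, y) > 0"
    using assms by (simp add: AE_radial_pos)
  moreover have "{z \<in> space (PiM {..<j} (\<lambda>_. gauss1) \<Otimes>\<^sub>M radial (d - j)). snd z > 0}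
      \<in> sets (PiM {..<j} (\<lambda>_. gauss1) \<Otimes>\<^sub>M radial (d - j))" by measurable
  ultimately show ?thesis unfolding column_law_def by (intro AE_pair_measure)
qed

lemma column_law_shift:
  assumes "j + k < d"
  shows "column_law (d - k) j = density (column_law d j)
    (\<lambda>z. ennreal (Gamma (real (d - j) / 2) / Gamma (real (d - j - k) / 2) * snd z powr - real k))"
proof -
  let ?M = "PiM {..<j} (\<lambda>_. gauss1)"
  let ?c = "Gamma (real (d - j) / 2) / Gamma (real (d - j - k) / 2)"
  have sf: "prob_space (radial i)" for i by (rule prob_space_radial)
  have r: "radial (d - k - j) = density (radial (d - j)) (\<lambda>r. ennreal (?c * r powr - real k))"
    using assms radial_shift[of k "d - j"] by (simp add: diff_commute add.commute)
  have "column_law (d - k) j = density ?M (\<lambda>_. 1) \<Otimes>\<^sub>M density (radial (d - j)) (\<lambda>r. ennreal (?c * r powr - real k))"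
    unfolding column_law_def r by (simp add: density_1)
  also have "\<dots> = density (?M \<Otimes>\<^sub>M radial (d - j)) (\<lambda>(x, r). 1 * ennreal (?c * r powr - real k))"
    using sf[of "d - j"] sf[of "d - k - j"] unfolding r
    by (intro pair_measure_density) (auto simp: prob_space_def finite_measure_def)
  finally show ?thesis by (simp only: column_law_def case_prod_unfold mult_1_left)
qed

text \<open>The density of the triangular law of dimension d - k with respect to that of dimension
  d. The diagonal entries multiply to |T|, so it is a constant times |T|^-k.\<close>

definition coords_weight :: "nat \<Rightarrow> nat \<Rightarrow> nat \<Rightarrow> (nat \<Rightarrow> (nat \<Rightarrow> real) \<times> real) \<Rightarrow> ennreal" where
  "coords_weight d k m T =
     (\<Prod>j<m. ennreal (Gamma (real (d - j) / 2) / Gamma (real (d - j - k) / 2) * snd (T j) powr - real k))"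

lemma measurable_coords_weight:
  "coords_weight d k m \<in> borel_measurable (PiM {..<m} coordM)"
  "coords_weight d k m \<in> borel_measurable (PiM {..<m} (column_law d'))"
proof -
  have [measurable]: "(\<lambda>T. snd (T j)) \<in> borel_measurable (PiM {..<m} coordM)" if "j \<in> {..<m}" for j
    by (rule measurable_compose[OF measurable_component_singleton[OF that] measurable_snd])
  show m: "coords_weight d k m \<in> borel_measurable (PiM {..<m} coordM)"
    unfolding coords_weight_def[abs_def] by measurable
  have "sets (PiM {..<m} (column_law d')) = sets (PiM {..<m} coordM)" by (intro sets_PiM_cong) auto
  then show "coords_weight d k m \<in> borel_measurable (PiM {..<m} (column_law d'))"
    using m by (subst measurable_cong_sets[OF _ refl])
qed

lemma coords_law_shift:
  assumes "m + k \<le> d"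
  shows "PiM {..<m} (column_law (d - k)) = density (PiM {..<m} (column_law d)) (coords_weight d k m)"
proof -
  \<comment> \<open>\<open>density_PiM\<close> asks for well-behaved factors at all indices. Beyond
    m, where d - j - k may reach 0, the density is therefore set to 1.\<close>
  define h :: "nat \<Rightarrow> (nat \<Rightarrow> real) \<times> real \<Rightarrow> ennreal" where "h j z = (if j < m then ennreal (Gamma (real (d - j) / 2) / Gamma (real (d - j - k) / 2) * snd z powr - real k) else 1)" for j z
  have h: "density (column_law d j) (h j) = (if j < m then column_law (d - k) j else column_law d j)" for j
    using assms by (simp add: h_def[abs_def] column_law_shift density_1)
  have "PiM {..<m} (column_law (d - k)) = PiM {..<m} (\<lambda>j. density (column_law d j) (h j))"
    by (intro PiM_cong) (auto simp: h)
  also have "\<dots> = density (PiM {..<m} (column_law d)) (\<lambda>T. \<Prod>j<m. h j (T j))"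
  proof (rule density_PiM)
    show "sigma_finite_measure (column_law d j)" for j
      using prob_space_column_law[of d j] by (simp add: prob_space_def finite_measure_def)
    show "sigma_finite_measure (density (column_law d j) (h j))" for j
      unfolding h using prob_space_column_law by (simp add: prob_space_def finite_measure_def)
    show "h j \<in> borel_measurable (column_law d j)" for j
      unfolding h_def[abs_def] by measurable
  qed simp
  finally show ?thesis by (simp add: h_def coords_weight_def[abs_def])
qed

text \<open>The integral is the total mass of the law in dimension d - k. This normalisation is what
  later lets the weight for d = n disappear.\<close>

lemma nn_integral_coords_weight:
  assumes "m + k \<le> d"
  shows "(\<integral>\<^sup>+T. coords_weight d k m T \<partial>PiM {..<m} (column_law d)) = 1"
proof -
  have "(\<integral>\<^sup>+T. coords_weight d k m T \<partial>PiM {..<m} (column_law d))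
    = emeasure (density (PiM {..<m} (column_law d)) (coords_weight d k m)) (space (PiM {..<m} (column_law d)))"
    by (subst emeasure_density[OF measurable_coords_weight(2) sets.top]) (auto intro!: nn_integral_cong)
  also have "\<dots> = emeasure (PiM {..<m} (column_law (d - k))) (space (PiM {..<m} (column_law (d - k))))"
    using coords_law_shift[OF assms] by (simp add: space_PiM sets_eq_imp_space_eq[OF sets_column_law])
  also have "\<dots> = 1"
    by (intro prob_space.emeasure_space_1 prob_space_PiM prob_space_column_law)
  finally show ?thesis .
qed

lemma proj_off_orthogonal:
  fixes S :: "'v::euclidean_space set"
  assumes S: "orthonormal S" and s: "s \<in> S"
  shows "proj_off S x \<bullet> s = 0"
proof -
  have "(\<Sum>a\<in>S. (x \<bullet> a) *\<^sub>R a) \<bullet> s = (\<Sum>a\<in>S. if a = s then x \<bullet> s else 0)"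
    unfolding inner_sum_left using S s by (intro sum.cong) (auto simp: orthonormal_def)
  also have "\<dots> = x \<bullet> s" using s orthonormal_independent(2)[OF S] by simp
  finally show ?thesis by (simp add: proj_off_def inner_diff_left)
qed

lemma gs_inner_eq_0:
  assumes "\<And>i. i \<le> j \<Longrightarrow> X i \<bullet> s = 0"
  shows "gs X j \<bullet> s = 0"
  using assms
proof (induction j rule: less_induct)
  case (less j)
  then have "gs X i \<bullet> s = 0" if "i < j" for i using that by simp
  then show ?case using less.prems[of j] by (subst gs.simps) (simp add: inner_diff_left inner_sum_left)
qed

text \<open>The sets \<open>A j\<close> exclude vanishing norms, so that the preceding columns are orthonormal wherever the
  integrand does not vanish.\<close>

lemma nn_integral_gs_coords_box:
  fixes S :: "'v::euclidean_space set"
  assumes S: "orthonormal S" and le: "m + card S \<le> DIM('v)"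
    and A: "\<And>j. j < m \<Longrightarrow> A j \<in> sets (coordM j)" "\<And>j z. j < m \<Longrightarrow> z \<in> A j \<Longrightarrow> snd z > 0"
  shows "(\<integral>\<^sup>+X. (\<Prod>j<m. indicator (A j) (gs_coords (\<lambda>i. proj_off S (X i)) j)) \<partial>gauss_cols m)
     = (\<Prod>j<m. emeasure (column_law (DIM('v) - card S) j) (A j))"
  using le A
proof (induction m)
  case 0
  then show ?case using prob_space.emeasure_space_1[OF prob_space_gauss_cols[of 0]] by simp
next
  case (Suc m)
  interpret product_sigma_finite "\<lambda>_::nat. gauss :: 'v measure"
    by (intro product_sigma_finite.intro prob_space_imp_sigma_finite prob_space_gauss)
  let ?g = "\<lambda>X j. gs_coords (\<lambda>i. proj_off S (X i)) j"
  let ?D = "DIM('v) - card S"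
  have I: "{..<Suc m} = insert m {..<m}" by auto
  have [measurable]: "(\<lambda>X. ?g X j) \<in> PiM (insert m {..<m}) (\<lambda>_. gauss) \<rightarrow>\<^sub>M coordM j" if "j \<in> {..<Suc m}" for j
    using that by (intro measurable_gs_coords borel_measurable_proj_off)
      (auto intro!: measurable_component_singleton simp: measurable_cong_sets[OF refl sets_gauss, symmetric] simp del: sets_gauss)
  have [measurable]: "A j \<in> sets (coordM j)" if "j \<in> {..<Suc m}" for j using that Suc.prems by simp
  \<comment> \<open>The last column is integrated first, the earlier ones being frozen. Its
    conditional law does not depend on them, which is the source of the independence of the columns
    of T.\<close>
  have "(\<integral>\<^sup>+X. (\<Prod>j<Suc m. indicator (A j) (?g X j)) \<partial>gauss_cols (Suc m))
    = (\<integral>\<^sup>+X. \<integral>\<^sup>+x. (\<Prod>j<Suc m. indicator (A j) (?g (X(m := x)) j)) \<partial>gauss \<partial>gauss_cols m)"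
  proof -
    have m: "(\<lambda>X. \<Prod>j<Suc m. indicator (A j) (?g X j) :: ennreal) \<in> borel_measurable (PiM (insert m {..<m}) (\<lambda>_. gauss))"
      by measurable
    show ?thesis
      unfolding gauss_cols_def using product_nn_integral_insert[OF _ _ m] by (simp only: I finite_lessThan lessThan_iff less_irrefl simp_thms)
  qed
  also have "\<dots> = (\<integral>\<^sup>+X. (\<Prod>j<m. indicator (A j) (?g X j)) * emeasure (column_law ?D m) (A m) \<partial>gauss_cols m)"
  proof (rule nn_integral_cong)
    fix X :: "nat \<Rightarrow> 'v"
    let ?Y = "\<lambda>i. proj_off S (X i)"
    have lt: "?g (X(m := x)) j = ?g X j" if "j < m" for x j
      using that by (intro gs_coords_cong) auto
    have "(\<integral>\<^sup>+x. (\<Prod>j<Suc m. indicator (A j) (?g (X(m := x)) j)) \<partial>gauss)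
      = (\<integral>\<^sup>+x. (\<Prod>j<m. indicator (A j) (?g X j)) * indicator (A m) (?g (X(m := x)) m) \<partial>gauss)"
      by (simp add: lt mult.commute del: fun_upd_apply cong: prod.cong_simp)
    also have "\<dots> = (\<Prod>j<m. indicator (A j) (?g X j)) * emeasure (column_law ?D m) (A m)"
    proof (cases "\<forall>j<m. ?g X j \<in> A j")
      case True
      let ?F = "\<lambda>x. (\<lambda>i\<in>{..<m}. proj_off S x \<bullet> gs ?Y i, norm (proj_off S x - (\<Sum>i<m. (proj_off S x \<bullet> gs ?Y i) *\<^sub>R gs ?Y i)))"
      have pos: "gs_norm ?Y j > 0" if "j < m" for j
      proof -
        have "?g X j \<in> A j" using True that by simp
        then have "snd (?g X j) > 0" using Suc.prems(3)[of j] that by simp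
        then show ?thesis by (simp add: gs_coords_def)
      qed
      have eq: "?g (X(m := x)) m = ?F x" for x
      proof -
        have "gs (\<lambda>i. proj_off S ((X(m := x)) i)) i = gs ?Y i" if "i < m" for i
          using that by (intro gs_cong) auto
        then show ?thesis by (auto simp: gs_coords_def gs_norm_def)
      qed
      have "distr gauss (coordM m) ?F = column_law ?D m"
        unfolding column_law_def
      proof (rule distr_gauss_frame_coords[OF S])
        fix i i' assume i: "i < m" "i' < m"
        show "gs ?Y i \<bullet> gs ?Y i' = (if i = i' then 1 else 0)"
          using pos[OF i(1)] by (cases "i = i'") (simp_all add: gs_inner_self gs_orthogonal)
      next
        fix i s assume "i < m" "s \<in> S"
        then show "gs ?Y i \<bullet> s = 0" by (intro gs_inner_eq_0) (simp add: proj_off_orthogonal[OF S])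
      qed (use Suc.prems in auto)
      then have "emeasure (column_law ?D m) (A m) = emeasure (distr gauss (coordM m) ?F) (A m)" by simp
      also have "\<dots> = (\<integral>\<^sup>+z. indicator (A m) z \<partial>distr gauss (coordM m) ?F)"
        by (rule nn_integral_indicator[symmetric]) simp
      also have "\<dots> = (\<integral>\<^sup>+x. indicator (A m) (?F x) \<partial>gauss)"
        by (rule nn_integral_distr) measurable
      finally show ?thesis using True by (simp add: eq del: fun_upd_apply)
    next
      case False
      then obtain j where "j < m" "?g X j \<notin> A j" by auto
      then have "(\<Prod>j<m. indicator (A j) (?g X j)) = (0::ennreal)"
        by (intro prod_zero) (auto intro!: bexI[of _ j])
      then show ?thesis by (simp only: mult_zero_left nn_integral_const)
    qed
    finally show "(\<integral>\<^sup>+x. (\<Prod>j<Suc m. indicator (A j) (?g (X(m := x)) j)) \<partial>gauss)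
      = (\<Prod>j<m. indicator (A j) (?g X j)) * emeasure (column_law ?D m) (A m)" .
  qed
  also have "\<dots> = (\<integral>\<^sup>+X. (\<Prod>j<m. indicator (A j) (?g X j)) \<partial>gauss_cols m) * emeasure (column_law ?D m) (A m)"
  proof (rule nn_integral_multc)
    have g: "(\<lambda>X. ?g X j) \<in> gauss_cols m \<rightarrow>\<^sub>M coordM j" if "j < m" for j
      using that by (intro measurable_gs_coords borel_measurable_proj_off measurable_gauss_cols_component) auto
    have ind: "(\<lambda>X. indicator (A j) (?g X j) :: ennreal) \<in> borel_measurable (gauss_cols m)" if "j \<in> {..<m}" for j
      using that Suc.prems(2)[of j] by (intro measurable_compose[OF g] borel_measurable_indicator) auto
    show "(\<lambda>X. \<Prod>j<m. indicator (A j) (?g X j) :: ennreal) \<in> borel_measurable (gauss_cols m)"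
      by (rule borel_measurable_prod_ennreal) (rule ind)
  qed
  also have "(\<integral>\<^sup>+X. (\<Prod>j<m. indicator (A j) (?g X j)) \<partial>gauss_cols m) = (\<Prod>j<m. emeasure (column_law ?D j) (A j))"
  proof (rule Suc.IH)
    show "m + card S \<le> DIM('v)" using Suc.prems(1) by simp
    show "A j \<in> sets (coordM j)" if "j < m" for j using that by (intro Suc.prems(2)) simp
    show "snd z > 0" if "j < m" "z \<in> A j" for j z using that(1) by (intro Suc.prems(3)[OF _ that(2)]) simp
  qed
  finally show ?case by simp
qed

lemma measurable_gs_coords_proj:
  "j < m \<Longrightarrow> (\<lambda>X. gs_coords (\<lambda>i. proj_off S (X i :: 'v::euclidean_space)) j) \<in> gauss_cols m \<rightarrow>\<^sub>M coordM j"
  by (intro measurable_gs_coords borel_measurable_proj_off measurable_gauss_cols_component) auto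

text \<open>In the box formula take the sets of positive diagonal entries. The left side is the
  probability of full rank, and each factor on the right is 1 because \<open>radial\<close> in
  positive dimension does not charge 0.\<close>

lemma AE_gs_norm_pos:
  fixes S :: "'v::euclidean_space set"
  assumes S: "orthonormal S" and le: "m + card S \<le> DIM('v)"
  shows "AE X in gauss_cols m. \<forall>j<m. gs_norm (\<lambda>i. proj_off S (X i)) j > 0"
proof -
  let ?D = "DIM('v) - card S"
  let ?A = "\<lambda>j::nat. {z \<in> space (coordM j). snd z > 0}"
  let ?g = "\<lambda>X j. gs_coords (\<lambda>i. proj_off S (X i)) j"
  let ?E = "{X \<in> space (gauss_cols m). \<forall>j\<in>{..<m}. gs_norm (\<lambda>i. proj_off S (X i)) j > 0}"
  interpret prob_space "gauss_cols m :: (nat \<Rightarrow> 'v) measure" by (rule prob_space_gauss_cols)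
  have [measurable]: "(\<lambda>X. gs_norm (\<lambda>i. proj_off S (X i)) j) \<in> borel_measurable (gauss_cols m)" if "j \<in> {..<m}" for j
    using that by (intro measurable_gs_norm borel_measurable_proj_off measurable_gauss_cols_component) auto
  have E: "?E \<in> sets (gauss_cols m)" by measurable
  have column_law1: "emeasure (column_law ?D j) (?A j) = 1" if "j < m" for j
  proof -
    interpret t: prob_space "column_law ?D j" by (rule prob_space_column_law)
    have "{z \<in> space (column_law ?D j). snd z > 0} \<in> sets (column_law ?D j)" by measurable
    moreover have "AE z in column_law ?D j. snd z > 0" using that le by (intro AE_column_law_pos) simp
    ultimately have "emeasure (column_law ?D j) {z \<in> space (column_law ?D j). snd z > 0} = 1"
      by (subst t.emeasure_eq_1_AE) auto
    then show ?thesis by (simp add: sets_eq_imp_space_eq[OF sets_column_law])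
  qed
  have "emeasure (gauss_cols m) ?E = (\<integral>\<^sup>+X. indicator ?E X \<partial>gauss_cols m)"
    using E by simp
  also have "\<dots> = (\<integral>\<^sup>+X. (\<Prod>j<m. indicator (?A j) (?g X j)) \<partial>gauss_cols m)"
  proof (rule nn_integral_cong)
    fix X :: "nat \<Rightarrow> 'v" assume X: "X \<in> space (gauss_cols m)"
    have sp: "?g X j \<in> space (coordM j)" if "j < m" for j
      using measurable_space[OF measurable_gs_coords_proj[OF that] X] .
    show "indicator ?E X = (\<Prod>j<m. indicator (?A j) (?g X j) :: ennreal)"
    proof (cases "X \<in> ?E")
      case True
      then have "(\<Prod>j<m. indicator (?A j) (?g X j) :: ennreal) = 1"
        using sp by (intro prod.neutral) (auto simp: gs_coords_def)
      then show ?thesis using True by simp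
    next
      case False
      then obtain j where "j < m" "\<not> gs_norm (\<lambda>i. proj_off S (X i)) j > 0" using X by auto
      then have "(\<Prod>j<m. indicator (?A j) (?g X j) :: ennreal) = 0"
        by (auto simp: prod_zero_iff gs_coords_def intro!: bexI[of _ j])
      then show ?thesis using False by simp
    qed
  qed
  also have "\<dots> = (\<Prod>j<m. emeasure (column_law ?D j) (?A j))"
    by (rule nn_integral_gs_coords_box[OF S le]) auto
  also have "\<dots> = 1" by (simp add: column_law1)
  finally have "AE X in gauss_cols m. X \<in> ?E"
    using E by (intro AE_I_eq_1) (auto simp: Collect_conj_eq Int_absorb1 sets.sets_into_space)
  then show ?thesis by (rule eventually_mono) auto
qed

text \<open>This is the Bartlett decomposition, for columns projected off S. Product laws are
  determined by boxes, and restricting a box to positive diagonal entries removes a null set on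
  either side.\<close>

lemma distr_gs_coords:
  fixes S :: "'v::euclidean_space set"
  assumes S: "orthonormal S" and le: "m + card S \<le> DIM('v)"
  shows "distr (gauss_cols m) (PiM {..<m} coordM) (\<lambda>X. \<lambda>j\<in>{..<m}. gs_coords (\<lambda>i. proj_off S (X i)) j)
    = PiM {..<m} (column_law (DIM('v) - card S))" (is "?L = PiM _ (column_law ?D)")
proof -
  let ?g = "\<lambda>X j. gs_coords (\<lambda>i. proj_off S (X i)) j"
  interpret product_sigma_finite "column_law ?D"
    by (intro product_sigma_finite.intro prob_space_imp_sigma_finite prob_space_column_law)
  show ?thesis
  proof (rule PiM_eqI)
    show "sets ?L = sets (PiM {..<m} (column_law ?D))" by (simp cong: sets_PiM_cong)
    fix A assume A: "\<And>j. j \<in> {..<m} \<Longrightarrow> A j \<in> sets (column_law ?D j)"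
    have [measurable]: "(\<lambda>X. ?g X j) \<in> gauss_cols m \<rightarrow>\<^sub>M coordM j" if "j \<in> {..<m}" for j
      using that by (intro measurable_gs_coords_proj) auto
    let ?A = "\<lambda>j. A j \<inter> {z \<in> space (coordM j). snd z > 0}"
    have A'[measurable]: "A j \<in> sets (coordM j)" if "j \<in> {..<m}" for j
      using A[OF that] by simp
    have "emeasure ?L (Pi\<^sub>E {..<m} A) = (\<integral>\<^sup>+z. indicator (Pi\<^sub>E {..<m} A) z \<partial>?L)"
      using A' by (intro nn_integral_indicator[symmetric]) (auto intro!: sets_PiM_I_finite)
    also have "\<dots> = (\<integral>\<^sup>+X. indicator (Pi\<^sub>E {..<m} A) (\<lambda>j\<in>{..<m}. ?g X j) \<partial>gauss_cols m)"
      using A' by (intro nn_integral_distr) (auto intro!: borel_measurable_indicator sets_PiM_I_finite measurable_restrict)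
    also have "\<dots> = (\<integral>\<^sup>+X. (\<Prod>j<m. indicator (?A j) (?g X j)) \<partial>gauss_cols m)"
    proof (rule nn_integral_cong_AE)
      show "AE X in gauss_cols m. indicator (Pi\<^sub>E {..<m} A) (\<lambda>j\<in>{..<m}. ?g X j)
        = (\<Prod>j<m. indicator (?A j) (?g X j) :: ennreal)"
        using AE_gs_norm_pos[OF S le] AE_space
      proof eventually_elim
        case (elim X)
        have sp: "?g X j \<in> space (coordM j) \<and> snd (?g X j) > 0" if "j < m" for j
          using measurable_space[OF measurable_gs_coords_proj[OF that] elim(2)] elim(1) that
          by (simp add: gs_coords_def)
        show ?case
        proof (cases "\<forall>j<m. ?g X j \<in> A j")
          case True
          then have "(\<Prod>j<m. indicator (?A j) (?g X j) :: ennreal) = 1"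
            using sp by (intro prod.neutral) auto
          then show ?thesis using True by (simp add: indicator_def)
        next
          case False
          then obtain j where j: "j < m" "?g X j \<notin> A j" by auto
          then have "(\<Prod>j<m. indicator (?A j) (?g X j) :: ennreal) = 0"
            by (auto simp: prod_zero_iff intro!: bexI[of _ j])
          then show ?thesis using False by (auto simp: indicator_def)
        qed
      qed
    qed
    also have "\<dots> = (\<Prod>j<m. emeasure (column_law ?D j) (?A j))"
      using A' by (intro nn_integral_gs_coords_box[OF S le]) auto
    also have "\<dots> = (\<Prod>j<m. emeasure (column_law ?D j) (A j))"
    proof (intro prod.cong refl emeasure_eq_AE)
      fix j assume j: "j \<in> {..<m}"
      show "AE z in column_law ?D j. (z \<in> ?A j) = (z \<in> A j)"
      proof -
        have "AE z in column_law ?D j. snd z > 0" using j le by (intro AE_column_law_pos) auto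
        then show ?thesis using AE_space
          by eventually_elim (auto simp: sets_eq_imp_space_eq[OF sets_column_law])
      qed
      show "?A j \<in> sets (column_law ?D j)" "A j \<in> sets (column_law ?D j)" using A'[OF j] by auto
    qed
    finally show "emeasure ?L (Pi\<^sub>E {..<m} A) = (\<Prod>j\<in>{..<m}. emeasure (column_law ?D j) (A j))" .
  qed simp
qed

section \<open>Frames and the invariant measure on the Stiefel manifold\<close>

text \<open>Gram-Schmidt needs an order of the columns, but the column type of a matrix carries
  none. An arbitrary enumeration is fixed once and for all.\<close>

definition idx :: "'m::finite \<Rightarrow> nat" where
  "idx = (SOME f. bij_betw f UNIV {..<CARD('m)})"

lemma bij_idx: "bij_betw (idx :: 'm::finite \<Rightarrow> nat) UNIV {..<CARD('m)}"
proof -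
  have "\<exists>f. bij_betw f (UNIV :: 'm set) {..<CARD('m)}"
    by (rule finite_same_card_bij) auto
  then show ?thesis unfolding idx_def by (rule someI_ex)
qed

lemma idx_less[simp]: "idx (i :: 'm::finite) < CARD('m)"
  using bij_idx[where 'm='m] by (auto simp: bij_betw_def)

lemma idx_eq_iff[simp]: "idx (i :: 'm::finite) = idx j \<longleftrightarrow> i = j"
  using bij_idx[where 'm='m] by (auto simp: bij_betw_def inj_on_def)

lemma inv_idx_idx[simp]: "inv idx (idx (i :: 'm::finite)) = i"
  by (rule inv_f_f) (simp add: inj_def)

lemma idx_inv_idx: "l < CARD('m) \<Longrightarrow> idx (inv idx l :: 'm::finite) = l"
  using bij_idx[where 'm='m] by (intro f_inv_into_f) (auto simp: bij_betw_def)

definition mat_of :: "(nat \<Rightarrow> real^'n) \<Rightarrow> real^'m^'n" where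
  "mat_of Q = (\<chi> i j. Q (idx j) $ i)"

definition cols :: "real^'m^'n \<Rightarrow> nat \<Rightarrow> real^'n" where
  "cols w l = column (inv idx l) w"

lemma cols_idx[simp]: "cols w (idx j) = column j w" by (simp add: cols_def)

lemma column_mat_of[simp]: "column j (mat_of Q) = Q (idx j)"
  by (simp add: mat_of_def column_def)

lemma matrix_eq_columnI: "(\<And>j. column j A = column j B) \<Longrightarrow> A = B"
  by (simp add: column_def vec_eq_iff)

lemma mat_of_cong: "(\<And>l. l < CARD('m) \<Longrightarrow> P l = Q l) \<Longrightarrow> (mat_of P :: real^'m^'n) = mat_of Q"
  by (simp add: mat_of_def)

lemma mat_of_cols[simp]: "mat_of (cols w) = w"
  by (rule matrix_eq_columnI) simp

lemma cols_mat_of: "l < CARD('m) \<Longrightarrow> cols (mat_of Q :: real^'m^'n) l = Q l"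
  by (simp add: cols_def idx_inv_idx)

lemma column_matrix_mult: "column j (A ** B) = A *v column j (B :: real^'m^'n)"
  by (simp add: column_def matrix_matrix_mult_def matrix_vector_mult_def vec_eq_iff)

lemma matrix_mult_mat_of: "A ** (mat_of Q :: real^'m^'n) = mat_of (\<lambda>l. A *v Q l)"
  by (rule matrix_eq_columnI) (simp add: column_matrix_mult)

lemma stiefel_iff_column: "v \<in> stiefel \<longleftrightarrow> (\<forall>i j. column i v \<bullet> column j v = (if i = j then 1 else 0))"
  by (simp add: stiefel_def matrix_mult_transpose_dot_column mat_def vec_eq_iff)

lemma stiefel_cols:
  fixes v :: "real^'m^'n"
  assumes "v \<in> stiefel" "i < CARD('m)" "j < CARD('m)"
  shows "cols v i \<bullet> cols v j = (if i = j then 1 else 0)"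
proof -
  have "inv (idx :: 'm \<Rightarrow> nat) i = inv idx j \<longleftrightarrow> i = j"
    using assms(2,3) by (metis idx_inv_idx)
  then show ?thesis using assms(1) by (simp add: cols_def stiefel_iff_column)
qed

lemma isometry_matrix_inner:
  fixes A :: "real^'x^'y"
  assumes "transpose A ** A = mat 1"
  shows "(A *v x) \<bullet> (A *v y) = x \<bullet> y"
proof -
  have "(A *v x) \<bullet> (A *v y) = ((A *v x) v* A) \<bullet> y"
    by (rule dot_lmul_matrix[symmetric])
  also have "(A *v x) v* A = (transpose A ** A) *v x"
    by (simp only: transpose_matrix_vector[symmetric] matrix_vector_mul_assoc)
  finally show ?thesis by (simp add: assms)
qed

definition frame :: "(nat \<Rightarrow> real^'n) \<Rightarrow> real^'m^'n" where
  "frame X = mat_of (gs X)"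

lemma frame_cong: "(\<And>l. l < CARD('m) \<Longrightarrow> X l = Y l) \<Longrightarrow> (frame X :: real^'m^'n) = frame Y"
  unfolding frame_def by (intro mat_of_cong gs_cong) auto

lemma frame_isometry:
  fixes A :: "real^'x^'y"
  assumes "transpose A ** A = mat 1"
  shows "frame (\<lambda>l. A *v X l) = A ** (frame X :: real^'m^'x)"
  unfolding frame_def matrix_mult_mat_of
  by (intro arg_cong[where f=mat_of] ext gs_isometry(1) isometry_matrix_inner[OF assms]) simp

lemma frame_in_stiefel:
  assumes "\<And>j. j < CARD('m) \<Longrightarrow> gs_norm X j > 0"
  shows "(frame X :: real^'m^'n) \<in> stiefel"
proof -
  have "gs_norm X (idx (i::'m)) \<noteq> 0" for i
    using assms[of "idx i"] by simp
  then show ?thesis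
    by (simp add: stiefel_iff_column frame_def gs_orthogonal gs_inner_self)
qed

section \<open>Measurability of matrix operations\<close>

lemma borel_measurable_vec_lambda[measurable]:
  fixes f :: "'i::finite \<Rightarrow> 'w \<Rightarrow> 'v::euclidean_space"
  assumes [measurable]: "\<And>i. f i \<in> borel_measurable M"
  shows "(\<lambda>w. \<chi> i. f i w) \<in> borel_measurable M"
proof (subst borel_measurable_euclidean_space, intro ballI)
  fix b :: "'v^'i" assume "b \<in> Basis"
  then obtain i u where "b = axis i u" by (auto simp: Basis_vec_def)
  then show "(\<lambda>w. (\<chi> i. f i w) \<bullet> b) \<in> borel_measurable M" by (simp add: inner_axis)
qed

lemma borel_measurable_vec_nth[measurable]:
  fixes f :: "'w \<Rightarrow> 'v::euclidean_space^'i::finite"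
  assumes [measurable]: "f \<in> borel_measurable M"
  shows "(\<lambda>w. f w $ i) \<in> borel_measurable M"
  by (rule measurable_compose[OF assms]) (intro borel_measurable_continuous_onI continuous_intros)

lemma borel_measurable_matrix_mult[measurable]:
  fixes f :: "'w \<Rightarrow> real^'y^'x" and g :: "'w \<Rightarrow> real^'z^'y"
  assumes [measurable]: "f \<in> borel_measurable M" "g \<in> borel_measurable M"
  shows "(\<lambda>w. f w ** g w) \<in> borel_measurable M"
  unfolding matrix_matrix_mult_def by measurable

lemma borel_measurable_matrix_vector_mult[measurable]:
  fixes f :: "'w \<Rightarrow> real^'y^'x" and g :: "'w \<Rightarrow> real^'y"
  assumes [measurable]: "f \<in> borel_measurable M" "g \<in> borel_measurable M"
  shows "(\<lambda>w. f w *v g w) \<in> borel_measurable M"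
  unfolding matrix_vector_mult_def by measurable

lemma borel_measurable_transpose[measurable]:
  fixes f :: "'w \<Rightarrow> real^'y^'x"
  assumes [measurable]: "f \<in> borel_measurable M"
  shows "(\<lambda>w. transpose (f w)) \<in> borel_measurable M"
  unfolding transpose_def by measurable

lemma borel_measurable_cols[measurable]:
  fixes f :: "'w \<Rightarrow> real^'y^'x"
  assumes [measurable]: "f \<in> borel_measurable M"
  shows "(\<lambda>w. cols (f w) l) \<in> borel_measurable M"
  unfolding cols_def column_def by measurable

lemma borel_measurable_det[measurable]:
  fixes f :: "'w \<Rightarrow> real^'x^'x"
  assumes [measurable]: "f \<in> borel_measurable M"
  shows "(\<lambda>w. det (f w)) \<in> borel_measurable M"
  unfolding det_def by measurable

lemma measurable_frame:
  assumes "\<And>l. l < CARD('m) \<Longrightarrow> (\<lambda>w. Y w l) \<in> borel_measurable M"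
  shows "(\<lambda>w. frame (Y w) :: real^'m^'n) \<in> borel_measurable M"
proof -
  have [measurable]: "(\<lambda>w. gs (Y w) (idx (j :: 'm))) \<in> borel_measurable M" for j
    by (intro measurable_gs assms) (meson idx_less order.strict_trans1)
  show ?thesis unfolding frame_def mat_of_def by measurable
qed

lemma stiefel_closed: "closed (stiefel :: (real^'m^'n) set)"
proof -
  have "closed ((\<lambda>v :: real^'m^'n. transpose v ** v) -` {mat 1})"
    unfolding transpose_def matrix_matrix_mult_def
    by (intro closed_vimage continuous_intros)
  then show ?thesis by (simp add: stiefel_def vimage_def)
qed

lemma stiefel_borel[measurable]: "(stiefel :: (real^'m^'n) set) \<in> sets borel"
  by (rule borel_closed[OF stiefel_closed])

lemma distr_gauss_cols_compose:
  assumes [measurable]: "f \<in> borel_measurable borel" and f: "distr gauss borel f = gauss"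
  shows "distr (gauss_cols m) (PiM {..<m} (\<lambda>_. borel)) (\<lambda>X. \<lambda>l\<in>{..<m}. f (X l)) = gauss_cols m"
proof -
  have "distr (PiM {..<m} (\<lambda>_. gauss)) (PiM {..<m} (\<lambda>_. gauss)) (compose {..<m} f) = PiM {..<m} (\<lambda>_. distr gauss gauss f)"
    by (intro distr_PiM_finite_prob_space') (auto intro: prob_space_gauss)
  moreover have "distr gauss gauss f = distr gauss borel f" by (intro distr_cong) auto
  moreover have "distr (PiM {..<m} (\<lambda>_. gauss)) (PiM {..<m} (\<lambda>_. gauss)) (compose {..<m} f)
    = distr (gauss_cols m) (PiM {..<m} (\<lambda>_. borel)) (\<lambda>X. \<lambda>l\<in>{..<m}. f (X l))"
    unfolding gauss_cols_def by (intro distr_cong sets_PiM_cong) (auto simp: compose_def)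
  ultimately show ?thesis by (simp add: f gauss_cols_def)
qed

lemma distr_gauss_orthogonal_matrix:
  fixes g :: "real^'n^'n"
  assumes "orthogonal_matrix g"
  shows "distr gauss borel ((*v) g) = gauss"
  using assms by (intro distr_orthogonal_transformation_gauss)
    (simp add: orthogonal_transformation_matrix)

lemma nn_integral_gauss_cols_rotate_restrict:
  fixes g :: "real^'n^'n"
  assumes g: "orthogonal_matrix g" and F[measurable]: "F \<in> borel_measurable (gauss_cols m)"
  shows "(\<integral>\<^sup>+X. F (\<lambda>l\<in>{..<m}. g *v X l) \<partial>gauss_cols m) = (\<integral>\<^sup>+X. F X \<partial>gauss_cols m)"
proof -
  have "(\<integral>\<^sup>+X. F X \<partial>gauss_cols m) = (\<integral>\<^sup>+X. F X \<partial>distr (gauss_cols m) (PiM {..<m} (\<lambda>_. borel)) (\<lambda>X. \<lambda>l\<in>{..<m}. g *v X l))"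
    by (subst distr_gauss_cols_compose) (auto simp: distr_gauss_orthogonal_matrix[OF g])
  also have "\<dots> = (\<integral>\<^sup>+X. F (\<lambda>l\<in>{..<m}. g *v X l) \<partial>gauss_cols m)"
    using measurable_gauss_cols_component
    by (intro nn_integral_distr) (auto intro!: measurable_restrict borel_measurable_matrix_vector_mult)
  finally show ?thesis by simp
qed

text \<open>Rotating a family at all indices leaves the extensional functions on which the product
  measure lives. The congruence hypothesis brings the integrand back to them.\<close>

lemma nn_integral_gauss_cols_rotate:
  fixes g :: "real^'n^'n"
  assumes "orthogonal_matrix g" "F \<in> borel_measurable (gauss_cols m)"
    and cong: "\<And>X Y. (\<And>l. l < m \<Longrightarrow> X l = Y l) \<Longrightarrow> F X = F Y"
  shows "(\<integral>\<^sup>+X. F (\<lambda>l. g *v X l) \<partial>gauss_cols m) = (\<integral>\<^sup>+X. F X \<partial>gauss_cols m)"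
  unfolding nn_integral_gauss_cols_rotate_restrict[OF assms(1,2), symmetric]
  by (intro nn_integral_cong cong) auto

lemma measurable_frame_gauss_cols[measurable]:
  "(frame :: _ \<Rightarrow> real^'m^'n) \<in> borel_measurable (gauss_cols CARD('m))"
  by (rule measurable_frame) (rule measurable_gauss_cols_component)

lemma AE_frame_in_stiefel:
  assumes "CARD('m::finite) \<le> CARD('n::finite)"
  shows "AE X in gauss_cols CARD('m). (frame X :: real^'m^'n) \<in> stiefel"
  using AE_gs_norm_pos[of "{} :: (real^'n) set" "CARD('m)"] assms
  by (auto simp: orthonormal_def elim!: eventually_mono intro!: frame_in_stiefel)

text \<open>The invariant probability on the Stiefel manifold, regarded as a measure on all matrices.\<close>

definition stief :: "(real^'m^'n) measure" where
  "stief = distr (gauss_cols CARD('m)) borel frame"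

lemma sets_stief[simp, measurable_cong]: "sets stief = sets borel" by (simp add: stief_def)
lemma space_stief[simp]: "space stief = UNIV" by (simp add: stief_def)

lemma prob_space_stief: "prob_space stief"
  unfolding stief_def by (intro prob_space.prob_space_distr prob_space_gauss_cols measurable_frame_gauss_cols)

lemma AE_stief:
  assumes "CARD('m::finite) \<le> CARD('n::finite)"
  shows "AE w in (stief :: (real^'m^'n) measure). w \<in> stiefel"
  unfolding stief_def using AE_frame_in_stiefel[OF assms] by (subst AE_distr_iff) auto

text \<open>Gram-Schmidt commutes with rotations of the columns, and these preserve the Gaussian
  law.\<close>

lemma nn_integral_stief_rotate:
  fixes g :: "real^'n^'n" and f :: "real^'m^'n \<Rightarrow> ennreal"
  assumes g: "orthogonal_matrix g" and [measurable]: "f \<in> borel_measurable borel"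
  shows "(\<integral>\<^sup>+w. f (g ** w) \<partial>stief) = (\<integral>\<^sup>+w. f w \<partial>stief)"
proof -
  have e: "g ** frame X = (frame (\<lambda>l. g *v X l) :: real^'m^'n)" for X
    using g by (simp add: frame_isometry orthogonal_matrix)
  have "(\<integral>\<^sup>+w. f (g ** w) \<partial>stief) = (\<integral>\<^sup>+X. f (frame (\<lambda>l. g *v X l)) \<partial>gauss_cols CARD('m))"
    unfolding stief_def by (subst nn_integral_distr) (auto simp: e)
  also have "\<dots> = (\<integral>\<^sup>+X. f (frame X) \<partial>gauss_cols CARD('m))"
    by (rule nn_integral_gauss_cols_rotate[OF g, where F="\<lambda>X. f (frame X)"])
       (measurable, metis frame_cong)
  also have "\<dots> = (\<integral>\<^sup>+w. f w \<partial>stief)"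
    unfolding stief_def by (subst nn_integral_distr) auto
  finally show ?thesis .
qed

text \<open>Transposition turns the left equivariance of Gram-Schmidt into right invariance, which is the side
  that averages a function of \<open>h w\<close> over all frames \<open>w\<close>.\<close>

definition haar :: "(real^'n^'n) measure" where
  "haar = distr stief borel transpose"

lemma sets_haar[simp, measurable_cong]: "sets haar = sets borel" by (simp add: haar_def)
lemma space_haar[simp]: "space haar = UNIV" by (simp add: haar_def)

lemma prob_space_haar: "prob_space haar"
  unfolding haar_def by (intro prob_space.prob_space_distr prob_space_stief) measurable

lemma AE_haar_orthogonal: "AE h in (haar :: (real^'n^'n) measure). orthogonal_matrix h"
proof -
  have O: "{h :: real^'n^'n. orthogonal_matrix h} = stiefel"
    by (auto simp: stiefel_def orthogonal_matrix)
  then have [measurable]: "{h :: real^'n^'n. orthogonal_matrix h} \<in> sets borel" by simp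
  show ?thesis unfolding haar_def
  proof (subst AE_distr_iff)
    show "AE w in stief. orthogonal_matrix (transpose w :: real^'n^'n)"
      using AE_stief[OF order_refl] O by (auto elim!: eventually_mono)
  qed auto
qed

text \<open>The transpose of h g is g' h', so right translation of h is left translation of its
  transpose.\<close>

lemma nn_integral_haar_right:
  fixes g :: "real^'n^'n"
  assumes g: "orthogonal_matrix g" and [measurable]: "f \<in> borel_measurable borel"
  shows "(\<integral>\<^sup>+h. f (h ** g) \<partial>haar) = (\<integral>\<^sup>+h. f h \<partial>haar)"
proof -
  have "(\<integral>\<^sup>+h. f (h ** g) \<partial>haar) = (\<integral>\<^sup>+w. f (transpose (transpose g ** w)) \<partial>stief)"
    unfolding haar_def by (subst nn_integral_distr) (auto simp: matrix_transpose_mul)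
  also have "\<dots> = (\<integral>\<^sup>+w. f (transpose w) \<partial>stief)"
    using g by (intro nn_integral_stief_rotate[where f="\<lambda>w. f (transpose w)"]) auto
  also have "\<dots> = (\<integral>\<^sup>+h. f h \<partial>haar)"
    unfolding haar_def by (subst nn_integral_distr) auto
  finally show ?thesis .
qed

section \<open>Existence and uniqueness of the invariant probability\<close>

lemma stiefel_transitive:
  fixes v w :: "real^'m^'n"
  assumes "v \<in> stiefel" "w \<in> stiefel" and le: "CARD('m) \<le> CARD('n)"
  obtains g where "orthogonal_matrix g" "w = g ** v"
proof -
  obtain A where A: "\<And>i. i < CARD('m) \<Longrightarrow> A i = cols v i"
    "\<And>i i'. i < CARD('n) \<Longrightarrow> i' < CARD('n) \<Longrightarrow> A i \<bullet> A i' = (if i = i' then 1 else (0::real))"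
    using orthonormal_family_extend[of "CARD('m)" "cols v"] stiefel_cols[OF assms(1)] le by auto
  obtain B where B: "\<And>i. i < CARD('m) \<Longrightarrow> B i = cols w i"
    "\<And>i i'. i < CARD('n) \<Longrightarrow> i' < CARD('n) \<Longrightarrow> B i \<bullet> B i' = (if i = i' then 1 else (0::real))"
    using orthonormal_family_extend[of "CARD('m)" "cols w"] stiefel_cols[OF assms(2)] le by auto
  \<comment> \<open>Both frames are completed to orthonormal bases, the columns of a and b. The
    product of b with the transpose of a carries the first basis to the second, hence v to
    w.\<close>
  define a where "a = (mat_of A :: real^'n^'n)"
  define b where "b = (mat_of B :: real^'n^'n)"
  have oa: "orthogonal_matrix a" and ob: "orthogonal_matrix b"
    using A(2) B(2) by (auto simp: a_def b_def orthogonal_matrix_orthonormal_columns norm_eq_1 orthogonal_def)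
  have "a *v axis (inv idx l) 1 = A l" "b *v axis (inv idx l) 1 = B l" if "l < CARD('n)" for l
    using that by (simp_all add: matrix_vector_mul_component column_def[symmetric] matrix_vector_mult_basis a_def b_def idx_inv_idx)
  then have ab: "(b ** transpose a) *v A l = B l" if "l < CARD('n)" for l
    using oa that by (metis matrix_vector_mul_assoc matrix_vector_mul_lid orthogonal_matrix_def)
  have "w = (b ** transpose a) ** v"
  proof (rule matrix_eq_columnI)
    fix j :: 'm
    have "(b ** transpose a) *v A (idx j) = B (idx j)"
      using le by (intro ab) (meson idx_less order.strict_trans2)
    then show "column j w = column j ((b ** transpose a) ** v)"
      by (simp add: A(1) B(1) column_matrix_mult)
  qed
  moreover have "orthogonal_matrix (b ** transpose a)" using oa ob by (intro orthogonal_matrix_mul) auto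
  ultimately show thesis by (rule that[rotated])
qed

lemma isometry_mult_stiefel_iff:
  fixes J :: "real^'x^'y"
  assumes J: "transpose J ** J = mat 1"
  shows "J ** w \<in> stiefel \<longleftrightarrow> w \<in> stiefel"
proof -
  have "transpose (J ** w) ** (J ** w) = transpose w ** (transpose J ** J) ** w"
    by (simp only: matrix_transpose_mul matrix_mul_assoc)
  then show ?thesis by (simp add: stiefel_def J)
qed

lemma stiefel_nonempty:
  assumes "CARD('m::finite) \<le> CARD('n::finite)"
  obtains w :: "real^'m^'n" where "w \<in> stiefel"
proof -
  have "\<exists>B :: nat \<Rightarrow> real^'n. \<forall>i<CARD('n). \<forall>i'<CARD('n). B i \<bullet> B i' = (if i = i' then 1 else 0)"
  proof (rule orthonormal_family_extend[of 0 "\<lambda>_. 0 :: real^'n"])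
    fix B :: "nat \<Rightarrow> real^'n"
    assume "\<And>i i'. i < DIM(real^'n) \<Longrightarrow> i' < DIM(real^'n) \<Longrightarrow> B i \<bullet> B i' = (if i = i' then 1 else 0)"
    then show ?thesis by (intro exI[of _ B]) simp
  qed auto
  then obtain B :: "nat \<Rightarrow> real^'n"
    where B: "\<And>i i'. i < CARD('n) \<Longrightarrow> i' < CARD('n) \<Longrightarrow> B i \<bullet> B i' = (if i = i' then 1 else 0)" by auto
  have "(mat_of B :: real^'m^'n) \<in> stiefel"
    using assms B order.strict_trans2[OF idx_less assms] by (auto simp: stiefel_iff_column)
  then show thesis by (rule that)
qed

text \<open>Averaging the invariance of \<open>\<mu>\<close> over h and exchanging the integrals
  leaves, for each w, the distribution of h w. Its right side does not mention \<open>\<mu>\<close>,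
  so all invariant probabilities coincide.\<close>

lemma stiefel_invariant_measure_eq_haar:
  fixes \<mu> :: "(real^'m^'n) measure"
  assumes le: "CARD('m) \<le> CARD('n)" and w0: "w0 \<in> stiefel"
    and sets: "sets \<mu> = sets (restrict_space borel stiefel)"
    and one: "emeasure \<mu> (space \<mu>) = 1"
    and inv: "\<And>g. orthogonal_matrix g \<Longrightarrow> distr \<mu> \<mu> (\<lambda>v. g ** v) = \<mu>"
  shows "distr \<mu> borel (\<lambda>w. w) = distr haar borel (\<lambda>h. h ** w0)"
proof (rule measure_eqI)
  interpret \<mu>: prob_space \<mu> by standard (rule one)
  interpret H: prob_space "haar :: (real^'n^'n) measure" by (rule prob_space_haar)
  interpret P: pair_prob_space \<mu> "haar :: (real^'n^'n) measure" ..
  have space: "space \<mu> = stiefel"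
    using sets_eq_imp_space_eq[OF sets] by (simp add: space_restrict_space)
  have id[measurable]: "(\<lambda>w. w) \<in> \<mu> \<rightarrow>\<^sub>M borel"
    unfolding measurable_cong_sets[OF sets refl] by (rule measurable_restrict_space1) simp
  fix B assume "B \<in> sets (distr \<mu> borel (\<lambda>w. w))"
  then have B[measurable]: "B \<in> sets borel" by simp
  have m1: "(\<lambda>v. g ** v) \<in> \<mu> \<rightarrow>\<^sub>M \<mu>" if g: "orthogonal_matrix g" for g :: "real^'n^'n"
  proof -
    have "(\<lambda>v. g ** v) \<in> \<mu> \<rightarrow>\<^sub>M restrict_space borel stiefel"
    proof (rule measurable_restrict_space2)
      show "(\<lambda>v. g ** v) \<in> space \<mu> \<rightarrow> stiefel"
        using isometry_mult_stiefel_iff[of g] g[unfolded orthogonal_matrix] by (auto simp: space)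
      show "(\<lambda>v. g ** v) \<in> \<mu> \<rightarrow>\<^sub>M borel" by measurable
    qed
    then show ?thesis by (simp add: measurable_cong_sets[OF refl sets])
  qed
  have inv': "(\<integral>\<^sup>+w. indicator B (h ** w) \<partial>\<mu>) = (\<integral>\<^sup>+w. indicator B w \<partial>\<mu>)"
    if h: "orthogonal_matrix h" for h
  proof -
    have "(\<integral>\<^sup>+w. indicator B w \<partial>\<mu>) = (\<integral>\<^sup>+w. indicator B w \<partial>distr \<mu> \<mu> (\<lambda>v. h ** v))"
      by (simp add: inv[OF h])
    also have "\<dots> = (\<integral>\<^sup>+w. indicator B (h ** w) \<partial>\<mu>)"
      by (rule nn_integral_distr[OF m1[OF h]]) measurable
    finally show ?thesis by simp
  qed
  have "emeasure (distr \<mu> borel (\<lambda>w. w)) B = (\<integral>\<^sup>+w. indicator B w \<partial>\<mu>)"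
    by (subst nn_integral_indicator[symmetric], simp, subst nn_integral_distr) auto
  also have "\<dots> = (\<integral>\<^sup>+h. (\<integral>\<^sup>+w. indicator B w \<partial>\<mu>) \<partial>(haar :: (real^'n^'n) measure))"
    by (simp add: H.emeasure_space_1[simplified])
  also have "\<dots> = (\<integral>\<^sup>+h. (\<integral>\<^sup>+w. indicator B (h ** w) \<partial>\<mu>) \<partial>(haar :: (real^'n^'n) measure))"
    using AE_haar_orthogonal by (intro nn_integral_cong_AE) (auto simp: inv' elim!: eventually_mono)
  also have "\<dots> = (\<integral>\<^sup>+w. (\<integral>\<^sup>+h. indicator B (h ** w) \<partial>(haar :: (real^'n^'n) measure)) \<partial>\<mu>)"
    by (rule P.Fubini') measurable
  also have "\<dots> = (\<integral>\<^sup>+w. (\<integral>\<^sup>+h. indicator B (h ** w0) \<partial>(haar :: (real^'n^'n) measure)) \<partial>\<mu>)"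
  \<comment> \<open>By transitivity w = g w0, and right invariance absorbs g into h; the inner
    integral is the same for all w.\<close>
  proof (rule nn_integral_cong)
    fix w assume "w \<in> space \<mu>"
    then obtain g :: "real^'n^'n" where g: "orthogonal_matrix g" "w = g ** w0"
      using stiefel_transitive[OF w0 _ le] by (auto simp: space)
    have "(\<integral>\<^sup>+h. indicator B ((h ** g) ** w0) \<partial>(haar :: (real^'n^'n) measure)) = (\<integral>\<^sup>+h. indicator B (h ** w0) \<partial>haar)"
      by (rule nn_integral_haar_right[OF g(1), of "\<lambda>h. indicator B (h ** w0)"]) measurable
    then show "(\<integral>\<^sup>+h. indicator B (h ** w) \<partial>(haar :: (real^'n^'n) measure)) = (\<integral>\<^sup>+h. indicator B (h ** w0) \<partial>haar)"
      by (simp add: g(2) matrix_mul_assoc)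
  qed
  also have "\<dots> = (\<integral>\<^sup>+h. indicator B (h ** w0) \<partial>(haar :: (real^'n^'n) measure))"
    by (simp add: \<mu>.emeasure_space_1)
  also have "\<dots> = emeasure (distr haar borel (\<lambda>h. h ** w0)) B"
  proof -
    have "(\<integral>\<^sup>+h. indicator B h \<partial>distr haar borel (\<lambda>h. h ** w0)) = (\<integral>\<^sup>+h. indicator B (h ** w0) \<partial>(haar :: (real^'n^'n) measure))"
      by (rule nn_integral_distr) (auto intro!: borel_measurable_matrix_mult measurable_ident_sets)
    then show ?thesis by simp
  qed
  finally show "emeasure (distr \<mu> borel (\<lambda>w. w)) B = emeasure (distr haar borel (\<lambda>h. h ** w0)) B" .
qed simp

text \<open>The defining properties of the invariant measure, verified for the law of a Gaussian
  frame. Frames outside the manifold have probability 0, so the restriction loses no mass, and the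
  last claim recovers \<open>stief\<close> from it.\<close>

lemma restrict_stief:
  assumes le: "CARD('m::finite) \<le> CARD('n::finite)"
  defines "\<mu> \<equiv> restrict_space (stief :: (real^'m^'n) measure) stiefel"
  shows "sets \<mu> = sets (restrict_space borel stiefel)"
    and "emeasure \<mu> (space \<mu>) = 1"
    and "orthogonal_matrix g \<Longrightarrow> distr \<mu> \<mu> (\<lambda>v. g ** v) = \<mu>"
    and "distr \<mu> borel (\<lambda>w. w) = stief"
proof -
  interpret prob_space "stief :: (real^'m^'n) measure" by (rule prob_space_stief)
  show sets: "sets \<mu> = sets (restrict_space borel stiefel)"
    unfolding \<mu>_def by (rule sets_restrict_space_cong) simp
  have space: "space \<mu> = stiefel" by (simp add: \<mu>_def space_restrict_space)
  have em: "emeasure \<mu> A = emeasure stief A" if "A \<subseteq> stiefel" for A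
    unfolding \<mu>_def using that by (intro emeasure_restrict_space) auto
  show "emeasure \<mu> (space \<mu>) = 1"
    using AE_stief[OF le] by (simp add: space em emeasure_eq_1_AE)
  have setsD: "A \<in> sets borel \<and> A \<subseteq> stiefel" if "A \<in> sets \<mu>" for A
    using that unfolding sets by (auto simp: sets_restrict_space)
  have id[measurable]: "(\<lambda>w. w) \<in> \<mu> \<rightarrow>\<^sub>M borel"
    unfolding measurable_cong_sets[OF sets refl] by (rule measurable_restrict_space1) simp
  show "distr \<mu> \<mu> (\<lambda>v. g ** v) = \<mu>" if g: "orthogonal_matrix g"
  proof (rule measure_eqI)
    fix A assume "A \<in> sets (distr \<mu> \<mu> (\<lambda>v. g ** v))"
    then have A: "A \<in> sets \<mu>" and A'[measurable]: "A \<in> sets borel" and Asub: "A \<subseteq> stiefel" using setsD by auto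
    have gm: "(\<lambda>v. g ** v) \<in> \<mu> \<rightarrow>\<^sub>M \<mu>"
    proof -
      have "(\<lambda>v. g ** v) \<in> \<mu> \<rightarrow>\<^sub>M restrict_space borel stiefel"
        using isometry_mult_stiefel_iff[of g] g[unfolded orthogonal_matrix] by (intro measurable_restrict_space2) (auto simp: space)
      then show ?thesis by (simp add: measurable_cong_sets[OF refl sets])
    qed
    have pre: "(\<lambda>v. g ** v) -` A \<inter> stiefel = (\<lambda>v. g ** v) -` A"
      using Asub isometry_mult_stiefel_iff[of g] g[unfolded orthogonal_matrix] by auto
    have pm: "(\<lambda>v::real^'m^'n. g ** v) -` A \<in> sets borel"
      using measurable_sets[of "\<lambda>v::real^'m^'n. g ** v" borel borel A] by simp
    have "emeasure (distr \<mu> \<mu> (\<lambda>v. g ** v)) A = emeasure stief ((\<lambda>v. g ** v) -` A)"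
      using A gm pre by (subst emeasure_distr) (auto simp only: space intro!: em)
    also have "\<dots> = (\<integral>\<^sup>+w. indicator A (g ** w) \<partial>stief)"
      using nn_integral_indicator[of "(\<lambda>v. g ** v) -` A" stief] pm by (simp add: indicator_def)
    also have "\<dots> = (\<integral>\<^sup>+w. indicator A w \<partial>stief)"
      by (rule nn_integral_stief_rotate[OF g]) measurable
    also have "\<dots> = emeasure \<mu> A" using Asub by (simp add: em)
    finally show "emeasure (distr \<mu> \<mu> (\<lambda>v. g ** v)) A = emeasure \<mu> A" .
  qed simp
  show "distr \<mu> borel (\<lambda>w. w) = stief"
  proof (rule measure_eqI)
    fix A assume "A \<in> sets (distr \<mu> borel (\<lambda>w. w))"
    then have [measurable]: "A \<in> sets borel" by simp
    have "emeasure (distr \<mu> borel (\<lambda>w. w)) A = emeasure stief (A \<inter> stiefel)"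
      by (subst emeasure_distr) (auto simp: space em)
    also have "\<dots> = emeasure stief A"
      using AE_stief[OF le] by (intro emeasure_eq_AE) auto
    finally show "emeasure (distr \<mu> borel (\<lambda>w. w)) A = emeasure stief A" .
  qed simp
qed

text \<open>This resolves the definite description: \<open>restrict_stief\<close> provides a
  solution, and \<open>stiefel_invariant_measure_eq_haar\<close> forces any other one to agree with
  it.\<close>

lemma stiefel_measure_eq:
  assumes le: "CARD('m::finite) \<le> CARD('n::finite)"
  shows "(stiefel_measure :: (real^'m^'n) measure) = restrict_space stief stiefel"
  unfolding stiefel_measure_def
proof (rule the_equality)
  let ?P = "\<lambda>\<mu> :: (real^'m^'n) measure. sets \<mu> = sets (restrict_space borel stiefel) \<and>
     emeasure \<mu> (space \<mu>) = 1 \<and> (\<forall>g::real^'n^'n. orthogonal_matrix g \<longrightarrow> distr \<mu> \<mu> (\<lambda>v. g ** v) = \<mu>)"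
  show P: "?P (restrict_space stief stiefel)" using restrict_stief[OF le] by blast
  fix \<mu> assume \<mu>: "?P \<mu>"
  obtain w0 :: "real^'m^'n" where w0: "w0 \<in> stiefel" by (rule stiefel_nonempty[OF le])
  let ?\<nu> = "restrict_space stief stiefel :: (real^'m^'n) measure"
  have eq: "distr \<mu> borel (\<lambda>w. w) = distr ?\<nu> borel (\<lambda>w. w)"
    using stiefel_invariant_measure_eq_haar[OF le w0, of \<mu>] stiefel_invariant_measure_eq_haar[OF le w0, of ?\<nu>] \<mu> P
    by metis
  show "\<mu> = ?\<nu>"
  proof (rule measure_eqI)
    show "sets \<mu> = sets ?\<nu>" using \<mu> P by simp
    fix A assume A: "A \<in> sets \<mu>"
    then have A': "A \<in> sets borel" "A \<subseteq> stiefel" using \<mu> by (auto simp: sets_restrict_space)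
    have *: "emeasure (distr M borel (\<lambda>w. w)) A = emeasure M A" if M: "?P M" for M
    proof -
      have "(\<lambda>w. w) \<in> M \<rightarrow>\<^sub>M borel"
        unfolding measurable_cong_sets[OF conjunct1[OF M] refl] by (rule measurable_restrict_space1) simp
      moreover have "space M = stiefel"
        using sets_eq_imp_space_eq[OF conjunct1[OF M]] by (simp add: space_restrict_space)
      ultimately show ?thesis using A' by (subst emeasure_distr) (auto simp: Int_absorb2 intro!: arg_cong[where f="emeasure _"])
    qed
    show "emeasure \<mu> A = emeasure ?\<nu> A" using *[OF \<mu>] *[OF P] by (simp add: eq)
  qed
qed

lemma nn_integral_haar_stief:
  fixes w0 :: "real^'m^'n"
  assumes le: "CARD('m) \<le> CARD('n)" and w0: "w0 \<in> stiefel" and [measurable]: "f \<in> borel_measurable borel"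
  shows "(\<integral>\<^sup>+h. f (h ** w0) \<partial>haar) = (\<integral>\<^sup>+w. f w \<partial>stief)"
proof -
  have "stief = distr haar borel (\<lambda>h. h ** w0)"
    using stiefel_invariant_measure_eq_haar[OF le w0 restrict_stief(1-3)[OF le]] restrict_stief(4)[OF le] by simp
  then have "(\<integral>\<^sup>+w. f w \<partial>stief) = (\<integral>\<^sup>+w. f w \<partial>distr haar borel (\<lambda>h. h ** w0))" by simp
  also have "\<dots> = (\<integral>\<^sup>+h. f (h ** w0) \<partial>haar)" by (rule nn_integral_distr) measurable
  finally show ?thesis by simp
qed

section \<open>Projected Gaussian matrices\<close>

text \<open>The columns of the product w T, inverse to Gram-Schmidt. The restriction makes the
  result an element of the product space of columns.\<close>

definition from_coords :: "real^'m^'n \<Rightarrow> (nat \<Rightarrow> (nat \<Rightarrow> real) \<times> real) \<Rightarrow> nat \<Rightarrow> real^'n" where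
  "from_coords w T = (\<lambda>l\<in>{..<CARD('m)}. (\<Sum>i<l. fst (T l) i *\<^sub>R cols w i) + snd (T l) *\<^sub>R cols w l)"

lemma from_coords_gs:
  assumes "l < CARD('m)"
  shows "from_coords (frame X :: real^'m^'n) (\<lambda>j\<in>{..<CARD('m)}. gs_coords X j) l = X l"
  using assms gs_decompose[of X l]
  by (simp add: from_coords_def frame_def cols_mat_of gs_coords_def)

lemma cols_matrix_mult: "cols (A ** w) l = A *v cols (w :: real^'m^'n) l"
  by (simp add: cols_def column_matrix_mult)

lemma from_coords_matrix_mult:
  assumes "l < CARD('m)"
  shows "from_coords (A ** w :: real^'m^'y) T l = A *v from_coords (w :: real^'m^'n) T l"
  using assms
  by (simp add: from_coords_def cols_matrix_mult matrix_vector_right_distrib linear_sum[OF matrix_vector_mul_linear]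
      matrix_vector_mult_scaleR)

lemma measurable_from_coords:
  assumes [measurable]: "f \<in> borel_measurable M" and g: "g \<in> M \<rightarrow>\<^sub>M PiM {..<CARD('m)} coordM"
  shows "(\<lambda>x. from_coords (f x :: real^'m^'n) (g x)) \<in> M \<rightarrow>\<^sub>M PiM {..<CARD('m)} (\<lambda>_. borel)"
  unfolding from_coords_def
proof (rule measurable_restrict)
  fix l assume l: "l \<in> {..<CARD('m)}"
  have gl: "(\<lambda>x. g x l) \<in> M \<rightarrow>\<^sub>M coordM l"
    using measurable_compose[OF g measurable_component_singleton[OF l]] .
  have [measurable]: "(\<lambda>x. fst (g x l) i) \<in> borel_measurable M" if "i \<in> {..<l}" for i
    by (rule measurable_compose[OF measurable_compose[OF gl measurable_fst] measurable_component_singleton[OF that]])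
  have [measurable]: "(\<lambda>x. snd (g x l)) \<in> borel_measurable M"
    by (rule measurable_compose[OF gl measurable_snd])
  show "(\<lambda>x. (\<Sum>i<l. fst (g x l) i *\<^sub>R cols (f x) i) + snd (g x l) *\<^sub>R cols (f x) l) \<in> borel_measurable M"
    by measurable
qed

text \<open>If the projected columns have frame w and triangular factor T, their rotation by h has
  frame h w and the same T. Integrating over h first makes the frame uniform for every fixed T: this
  is the independence of frame and triangular factor. The function \<open>\<xi>\<close> leaves room
  for a weight depending on T.\<close>

lemma nn_integral_haar_proj_off:
  fixes S :: "(real^'n) set"
    and \<Phi> :: "(nat \<Rightarrow> real^'n) \<Rightarrow> ennreal"
  assumes S: "orthonormal S" and le: "CARD('m::finite) + card S \<le> CARD('n)"
    and \<Phi>[measurable]: "\<Phi> \<in> borel_measurable (PiM {..<CARD('m)} (\<lambda>_. borel))"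
    and \<xi>[measurable]: "\<xi> \<in> borel_measurable (PiM {..<CARD('m)} coordM)"
  shows "(\<integral>\<^sup>+h. \<integral>\<^sup>+A. \<xi> (\<lambda>j\<in>{..<CARD('m)}. gs_coords (\<lambda>i. proj_off S (A i)) j) *
            \<Phi> (\<lambda>l\<in>{..<CARD('m)}. h *v proj_off S (A l)) \<partial>gauss_cols CARD('m) \<partial>haar)
    = (\<integral>\<^sup>+T. \<xi> T * (\<integral>\<^sup>+w. \<Phi> (from_coords (w :: real^'m^'n) T) \<partial>stief) \<partial>PiM {..<CARD('m)} (column_law (CARD('n) - card S)))"
proof -
  let ?m = "CARD('m)"
  let ?T = "\<lambda>A. \<lambda>j\<in>{..<?m}. gs_coords (\<lambda>i. proj_off S (A i)) j"
  let ?F = "\<lambda>A. frame (\<lambda>i. proj_off S (A i)) :: real^'m^'n"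
  interpret H: prob_space "haar :: (real^'n^'n) measure" by (rule prob_space_haar)
  interpret G: prob_space "gauss_cols ?m :: (nat \<Rightarrow> real^'n) measure" by (rule prob_space_gauss_cols)
  interpret st: prob_space "stief :: (real^'m^'n) measure" by (rule prob_space_stief)
  interpret P: pair_prob_space "gauss_cols ?m :: (nat \<Rightarrow> real^'n) measure" "haar :: (real^'n^'n) measure" ..
  have le': "?m + card S \<le> DIM(real^'n)" using le by simp
  have T[measurable]: "?T \<in> gauss_cols ?m \<rightarrow>\<^sub>M PiM {..<?m} coordM"
    by (intro measurable_restrict measurable_gs_coords_proj) auto
  have comp: "(\<lambda>A. A l) \<in> borel_measurable (gauss_cols ?m)" if "l \<in> {..<?m}" for l
    using that by (intro measurable_gauss_cols_component) auto
  have rot: "(\<lambda>(A, h). \<lambda>l\<in>{..<?m}. h *v proj_off S (A l)) \<in> gauss_cols ?m \<Otimes>\<^sub>M (haar :: (real^'n^'n) measure) \<rightarrow>\<^sub>M PiM {..<?m} (\<lambda>_. borel)"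
    unfolding case_prod_beta
    by (intro measurable_restrict borel_measurable_matrix_vector_mult borel_measurable_proj_off
          measurable_compose[OF measurable_fst comp]) auto
  have m1: "(\<lambda>(A, h). \<xi> (?T A) * \<Phi> (\<lambda>l\<in>{..<?m}. h *v proj_off S (A l)))
      \<in> borel_measurable (gauss_cols ?m \<Otimes>\<^sub>M (haar :: (real^'n^'n) measure))"
    unfolding case_prod_beta
  proof (rule borel_measurable_times_ennreal)
    show "(\<lambda>x. \<xi> (?T (fst x))) \<in> borel_measurable (gauss_cols ?m \<Otimes>\<^sub>M (haar :: (real^'n^'n) measure))"
      by (rule measurable_compose[OF measurable_compose[OF measurable_fst T] \<xi>])
    show "(\<lambda>x. \<Phi> (\<lambda>l\<in>{..<?m}. snd x *v proj_off S (fst x l))) \<in> borel_measurable (gauss_cols ?m \<Otimes>\<^sub>M (haar :: (real^'n^'n) measure))"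
      using measurable_compose[OF rot \<Phi>] by (simp add: case_prod_beta)
  qed
  have \<Phi>rot: "(\<lambda>h. \<Phi> (\<lambda>l\<in>{..<?m}. h *v proj_off S (A l))) \<in> borel_measurable (haar :: (real^'n^'n) measure)" for A
    by (rule measurable_compose[OF _ \<Phi>], intro measurable_restrict) measurable
  have mr: "(\<lambda>(T, w). \<Phi> (from_coords (w :: real^'m^'n) T)) \<in> borel_measurable (PiM {..<?m} coordM \<Otimes>\<^sub>M stief)"
    unfolding case_prod_beta by (rule measurable_compose[OF measurable_from_coords \<Phi>]) auto
  have inner: "(\<lambda>T. \<integral>\<^sup>+w. \<Phi> (from_coords (w :: real^'m^'n) T) \<partial>stief) \<in> borel_measurable (PiM {..<?m} coordM)"
    using st.borel_measurable_nn_integral_fst[OF mr] by simp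
  have "(\<integral>\<^sup>+h. \<integral>\<^sup>+A. \<xi> (?T A) * \<Phi> (\<lambda>l\<in>{..<?m}. h *v proj_off S (A l)) \<partial>gauss_cols ?m \<partial>haar)
    = (\<integral>\<^sup>+A. \<integral>\<^sup>+h. \<xi> (?T A) * \<Phi> (\<lambda>l\<in>{..<?m}. h *v proj_off S (A l)) \<partial>haar \<partial>gauss_cols ?m)"
    by (rule P.Fubini'[OF m1])
  also have "\<dots> = (\<integral>\<^sup>+A. \<xi> (?T A) * (\<integral>\<^sup>+w. \<Phi> (from_coords (w :: real^'m^'n) (?T A)) \<partial>stief) \<partial>gauss_cols ?m)"
  proof (rule nn_integral_cong_AE)
    show "AE A in gauss_cols ?m. (\<integral>\<^sup>+h. \<xi> (?T A) * \<Phi> (\<lambda>l\<in>{..<?m}. h *v proj_off S (A l)) \<partial>haar)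
      = \<xi> (?T A) * (\<integral>\<^sup>+w. \<Phi> (from_coords (w :: real^'m^'n) (?T A)) \<partial>stief)"
      using AE_gs_norm_pos[OF S le'] AE_space
    proof eventually_elim
      case (elim A)
      then have F: "?F A \<in> stiefel" by (intro frame_in_stiefel) auto
      have TA: "?T A \<in> space (PiM {..<?m} coordM)"
        using measurable_space[OF T] elim by simp
      \<comment> \<open>The rotated columns are reassembled from the rotated frame and the unchanged
        coordinates.\<close>
      have rc: "(\<lambda>l\<in>{..<?m}. h *v proj_off S (A l)) = from_coords (h ** ?F A) (?T A)" for h
      proof
        fix l
        show "(\<lambda>l\<in>{..<?m}. h *v proj_off S (A l)) l = from_coords (h ** ?F A) (?T A) l"
        proof (cases "l < ?m")
          case True
          then show ?thesis
            using from_coords_gs[OF True, of "\<lambda>i. proj_off S (A i)"] by (simp only: from_coords_matrix_mult restrict_apply lessThan_iff if_True)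
        qed (simp add: from_coords_def)
      qed
      have "(\<integral>\<^sup>+h. \<xi> (?T A) * \<Phi> (\<lambda>l\<in>{..<?m}. h *v proj_off S (A l)) \<partial>haar)
        = \<xi> (?T A) * (\<integral>\<^sup>+h. \<Phi> (\<lambda>l\<in>{..<?m}. h *v proj_off S (A l)) \<partial>haar)"
        by (rule nn_integral_cmult[OF \<Phi>rot])
      also have "(\<integral>\<^sup>+h. \<Phi> (\<lambda>l\<in>{..<?m}. h *v proj_off S (A l)) \<partial>haar) = (\<integral>\<^sup>+h. \<Phi> (from_coords (h ** ?F A) (?T A)) \<partial>haar)"
        by (simp only: rc)
      also have "\<dots> = (\<integral>\<^sup>+w. \<Phi> (from_coords (w :: real^'m^'n) (?T A)) \<partial>stief)"
      proof (rule nn_integral_haar_stief[where f="\<lambda>w. \<Phi> (from_coords w (?T A))", OF _ F])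
        show "(\<lambda>w::real^'m^'n. \<Phi> (from_coords w (?T A))) \<in> borel_measurable borel"
          using TA by (intro measurable_compose[OF measurable_from_coords \<Phi>]) auto
      qed (use le in simp)
      finally show ?case .
    qed
  qed
  also have "\<dots> = (\<integral>\<^sup>+T. \<xi> T * (\<integral>\<^sup>+w. \<Phi> (from_coords (w :: real^'m^'n) T) \<partial>stief) \<partial>distr (gauss_cols ?m) (PiM {..<?m} coordM) ?T)"
    by (rule nn_integral_distr[OF T, symmetric]) (use inner in \<open>simp add: borel_measurable_times_ennreal\<close>)
  also have "\<dots> = (\<integral>\<^sup>+T. \<xi> T * (\<integral>\<^sup>+w. \<Phi> (from_coords (w :: real^'m^'n) T) \<partial>stief) \<partial>PiM {..<?m} (column_law (CARD('n) - card S)))"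
    using le by (subst distr_gs_coords[OF S]) auto
  finally show ?thesis .
qed

section \<open>Orthogonal splittings of a Gaussian matrix\<close>

lemma distr_isometry_gauss:
  fixes L :: "'a::euclidean_space \<Rightarrow> 'b::euclidean_space"
  assumes L: "linear L" "\<And>x y. L x \<bullet> L y = x \<bullet> y" and dim: "DIM('a) = DIM('b)"
  shows "distr gauss borel L = gauss"
proof -
  have Lm: "L \<in> borel_measurable borel"
    using L(1) by (intro borel_measurable_continuous_onI linear_continuous_on) (simp add: linear_linear)
  have "gauss = distr (PiM (Basis::'a set) (\<lambda>_. gauss1)) borel (\<lambda>t. \<Sum>b\<in>Basis. t b *\<^sub>R L b)"
    by (rule gauss_eq_distr_orthonormal) (auto simp: L dim inner_Basis)
  also have "\<dots> = distr (PiM (Basis::'a set) (\<lambda>_. gauss1)) borel (L \<circ> (\<lambda>t. \<Sum>b\<in>Basis. t b *\<^sub>R b))"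
    by (simp add: comp_def linear_sum[OF L(1)] linear_cmul[OF L(1)])
  also have "\<dots> = distr gauss borel L"
    by (subst gauss_eq_distr_Basis, subst distr_distr[OF Lm]) auto
  finally show ?thesis by simp
qed

lemma gauss_prod:
  "(gauss :: ('a::euclidean_space \<times> 'b::euclidean_space) measure) = gauss \<Otimes>\<^sub>M gauss"
proof -
  let ?c = "\<lambda>x::'a. ennreal (exp (- (x \<bullet> x)) / sqrt pi ^ DIM('a))"
  let ?d = "\<lambda>x::'b. ennreal (exp (- (x \<bullet> x)) / sqrt pi ^ DIM('b))"
  have e: "?c x * ?d y = ennreal (exp (- ((x, y) \<bullet> (x, y))) / sqrt pi ^ DIM('a \<times> 'b))" for x y
    by (simp add: ennreal_mult''[symmetric] exp_diff exp_add exp_minus power_add field_simps)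
  have "(gauss :: 'a measure) \<Otimes>\<^sub>M (gauss :: 'b measure) = density (lborel \<Otimes>\<^sub>M lborel) (\<lambda>(x, y). ?c x * ?d y)"
    unfolding gauss_def
  proof (rule pair_measure_density)
    show "sigma_finite_measure (density lborel ?d)"
      using prob_space_imp_sigma_finite[OF prob_space_gauss] by (simp add: gauss_def)
  qed (auto intro: sigma_finite_lborel)
  also have "\<dots> = density lborel (\<lambda>p. ennreal (exp (- (p \<bullet> p)) / sqrt pi ^ DIM('a \<times> 'b)))"
    unfolding lborel_prod by (rule arg_cong[where f="density lborel"]) (simp add: e fun_eq_iff)
  finally show ?thesis by (simp add: gauss_def)
qed

text \<open>The matrix with blocks J and v is orthogonal. The condition is spelled out in blocks
  because the columns are indexed by two different types.\<close>

definition splitting :: "real^'b^'n \<Rightarrow> real^'m^'n \<Rightarrow> bool" where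
  "splitting J v \<longleftrightarrow> transpose J ** J = mat 1 \<and> transpose v ** v = mat 1 \<and> transpose J ** v = 0 \<and>
     J ** transpose J + v ** transpose v = mat 1 \<and> CARD('b) + CARD('m) = CARD('n)"

lemma matrix_inner_transpose: "(A *v x) \<bullet> y = x \<bullet> (transpose A *v (y :: real^'n))"
  for A :: "real^'m^'n"
  by (simp add: dot_lmul_matrix[symmetric] inner_commute)

lemma splitting_transpose:
  assumes "splitting J v" shows "transpose v ** J = 0"
proof -
  have "transpose (transpose J ** v) = 0" using assms by (simp add: splitting_def transpose_def vec_eq_iff)
  then show ?thesis by (simp add: matrix_transpose_mul)
qed

lemma splitting_apply:
  assumes "splitting J v"
  shows "transpose J *v (J *v a + v *v b) = a" "transpose v *v (J *v a + v *v b) = b"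
  using assms splitting_transpose[OF assms]
  by (simp_all add: matrix_vector_right_distrib matrix_vector_mul_assoc splitting_def del: transpose_matrix_vector)

text \<open>The map (a, b) -> J a + v b is a linear isometry between spaces of equal dimension, and
  the Gaussian law of the product space is the product of the Gaussian laws.\<close>

lemma nn_integral_gauss_split:
  fixes J :: "real^'b^'n" and v :: "real^'m^'n"
  assumes s: "splitting J v" and f[measurable]: "f \<in> borel_measurable borel"
  shows "(\<integral>\<^sup>+x. f x \<partial>gauss) = (\<integral>\<^sup>+a. \<integral>\<^sup>+b. f (J *v a + v *v b) \<partial>gauss \<partial>gauss)"
proof -
  let ?L = "\<lambda>p. J *v fst p + v *v snd p"
  interpret B: prob_space "gauss :: (real^'m) measure" by (rule prob_space_gauss)
  have lin: "linear ?L"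
    by (intro linearI) (simp_all add: matrix_vector_right_distrib matrix_vector_mult_scaleR scaleR_add_right)
  have inn: "?L p \<bullet> ?L q = p \<bullet> q" for p q
  proof -
    have "?L p \<bullet> ?L q = fst p \<bullet> (transpose J *v ?L q) + snd p \<bullet> (transpose v *v ?L q)"
      by (simp only: inner_add_left matrix_inner_transpose)
    then show ?thesis by (simp only: splitting_apply[OF s] inner_prod_def)
  qed
  have [measurable]: "?L \<in> borel_measurable borel"
    using lin by (intro borel_measurable_continuous_onI linear_continuous_on) (simp add: linear_linear)
  have "distr gauss borel ?L = (gauss :: (real^'n) measure)"
    using s by (intro distr_isometry_gauss lin inn) (simp add: splitting_def)
  then have "(\<integral>\<^sup>+x. f x \<partial>gauss) = (\<integral>\<^sup>+x. f x \<partial>distr gauss borel ?L)" by simp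
  also have "\<dots> = (\<integral>\<^sup>+p. f (?L p) \<partial>gauss)" by (rule nn_integral_distr) auto
  also have "\<dots> = (\<integral>\<^sup>+p. f (?L p) \<partial>(gauss \<Otimes>\<^sub>M gauss))" by (simp add: gauss_prod)
  also have "\<dots> = (\<integral>\<^sup>+a. \<integral>\<^sup>+b. f (?L (a, b)) \<partial>gauss \<partial>gauss)"
    by (rule B.nn_integral_fst[symmetric]) measurable
  finally show ?thesis by simp
qed

text \<open>On boxes both sides factor over the columns, which reduces the claim to
  \<open>nn_integral_gauss_split\<close>.\<close>

lemma nn_integral_gauss_cols_split:
  fixes J :: "real^'b^'n" and v :: "real^'m^'n"
  assumes s: "splitting J v" and F: "F \<in> borel_measurable (PiM {..<m} (\<lambda>_. borel))"
  shows "(\<integral>\<^sup>+X. F X \<partial>gauss_cols m) = (\<integral>\<^sup>+A. \<integral>\<^sup>+B. F (\<lambda>l\<in>{..<m}. J *v A l + v *v B l) \<partial>gauss_cols m \<partial>gauss_cols m)"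
proof -
  let ?GA = "gauss_cols m :: (nat \<Rightarrow> real^'b) measure" and ?GB = "gauss_cols m :: (nat \<Rightarrow> real^'m) measure"
  let ?G = "gauss_cols m :: (nat \<Rightarrow> real^'n) measure"
  let ?L = "\<lambda>p. \<lambda>l\<in>{..<m}. J *v (fst p) l + v *v (snd p) l"
  interpret A: product_sigma_finite "\<lambda>_::nat. gauss :: (real^'b) measure"
    by (intro product_sigma_finite.intro prob_space_imp_sigma_finite prob_space_gauss)
  interpret B: product_sigma_finite "\<lambda>_::nat. gauss :: (real^'m) measure"
    by (intro product_sigma_finite.intro prob_space_imp_sigma_finite prob_space_gauss)
  interpret N: product_sigma_finite "\<lambda>_::nat. gauss :: (real^'n) measure"
    by (intro product_sigma_finite.intro prob_space_imp_sigma_finite prob_space_gauss)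
  interpret GB: prob_space ?GB by (rule prob_space_gauss_cols)
  interpret gB: prob_space "gauss :: (real^'m) measure" by (rule prob_space_gauss)
  have cA: "(\<lambda>p. fst p l) \<in> borel_measurable (?GA \<Otimes>\<^sub>M ?GB)" if "l < m" for l
    using that by (intro measurable_compose[OF measurable_fst measurable_gauss_cols_component])
  have cB: "(\<lambda>p. snd p l) \<in> borel_measurable (?GA \<Otimes>\<^sub>M ?GB)" if "l < m" for l
    using that by (intro measurable_compose[OF measurable_snd measurable_gauss_cols_component])
  have Lm: "?L \<in> ?GA \<Otimes>\<^sub>M ?GB \<rightarrow>\<^sub>M PiM {..<m} (\<lambda>_. borel)"
    using cA cB by (intro measurable_restrict borel_measurable_add borel_measurable_matrix_vector_mult) auto
  have "distr (?GA \<Otimes>\<^sub>M ?GB) (PiM {..<m} (\<lambda>_. borel)) ?L = PiM {..<m} (\<lambda>_. gauss)"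
  proof (rule N.PiM_eqI)
    show "sets (distr (?GA \<Otimes>\<^sub>M ?GB) (PiM {..<m} (\<lambda>_. borel)) ?L) = sets (PiM {..<m} (\<lambda>_. gauss :: (real^'n) measure))"
      by (simp cong: sets_PiM_cong)
    fix S :: "nat \<Rightarrow> (real^'n) set" assume "\<And>i. i \<in> {..<m} \<Longrightarrow> S i \<in> sets gauss"
    then have S[measurable]: "S i \<in> sets borel" if "i \<in> {..<m}" for i using that by simp
    have PS: "Pi\<^sub>E {..<m} S \<in> sets (PiM {..<m} (\<lambda>_. borel))"
      using S by (intro sets_PiM_I_finite) auto
    have "emeasure (distr (?GA \<Otimes>\<^sub>M ?GB) (PiM {..<m} (\<lambda>_. borel)) ?L) (Pi\<^sub>E {..<m} S)
      = (\<integral>\<^sup>+z. indicator (Pi\<^sub>E {..<m} S) z \<partial>distr (?GA \<Otimes>\<^sub>M ?GB) (PiM {..<m} (\<lambda>_. borel)) ?L)"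
      using PS by (intro nn_integral_indicator[symmetric]) simp
    also have "\<dots> = (\<integral>\<^sup>+p. indicator (Pi\<^sub>E {..<m} S) (?L p) \<partial>(?GA \<Otimes>\<^sub>M ?GB))"
      using PS by (intro nn_integral_distr Lm) simp
    also have "\<dots> = (\<integral>\<^sup>+A. \<integral>\<^sup>+B. indicator (Pi\<^sub>E {..<m} S) (?L (A, B)) \<partial>?GB \<partial>?GA)"
      using PS by (intro GB.nn_integral_fst[symmetric] measurable_compose[OF Lm]) simp
    also have "\<dots> = (\<integral>\<^sup>+A. \<integral>\<^sup>+B. (\<Prod>l<m. indicator (S l) (J *v A l + v *v B l)) \<partial>?GB \<partial>?GA)"
      by (intro nn_integral_cong) (auto simp: indicator_def PiE_iff prod_zero_iff)
    also have "\<dots> = (\<integral>\<^sup>+A. (\<Prod>l<m. \<integral>\<^sup>+b. indicator (S l) (J *v A l + v *v b) \<partial>gauss) \<partial>?GA)"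
      unfolding gauss_cols_def by (intro nn_integral_cong B.product_nn_integral_prod) (auto intro!: borel_measurable_indicator')
    also have "\<dots> = (\<Prod>l<m. \<integral>\<^sup>+a. \<integral>\<^sup>+b. indicator (S l) (J *v a + v *v b) \<partial>gauss \<partial>gauss)"
      unfolding gauss_cols_def by (intro A.product_nn_integral_prod) (auto, measurable)
    also have "\<dots> = (\<Prod>l<m. emeasure gauss (S l))"
      by (intro prod.cong refl, subst nn_integral_gauss_split[OF s, symmetric]) auto
    finally show "emeasure (distr (?GA \<Otimes>\<^sub>M ?GB) (PiM {..<m} (\<lambda>_. borel)) ?L) (Pi\<^sub>E {..<m} S) = (\<Prod>l\<in>{..<m}. emeasure gauss (S l))" .
  qed simp
  then have "(\<integral>\<^sup>+X. F X \<partial>gauss_cols m) = (\<integral>\<^sup>+X. F X \<partial>distr (?GA \<Otimes>\<^sub>M ?GB) (PiM {..<m} (\<lambda>_. borel)) ?L)"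
    by (simp add: gauss_cols_def)
  also have "\<dots> = (\<integral>\<^sup>+p. F (?L p) \<partial>(?GA \<Otimes>\<^sub>M ?GB))"
    by (rule nn_integral_distr[OF Lm]) (use F in simp)
  also have "\<dots> = (\<integral>\<^sup>+A. \<integral>\<^sup>+B. F (?L (A, B)) \<partial>?GB \<partial>?GA)"
    by (rule GB.nn_integral_fst[symmetric]) (rule measurable_compose[OF Lm F])
  finally show ?thesis by simp
qed

text \<open>For a frame u this agrees with \<open>proj_off\<close> for the set of its columns. The
  matrix form is measurable in u and x jointly, as is required once u itself is integrated.\<close>

definition proj_frame :: "real^'k^'n \<Rightarrow> real^'n \<Rightarrow> real^'n" where
  "proj_frame u x = x - u *v (transpose u *v x)"

lemma borel_measurable_proj_frame[measurable]:
  assumes [measurable]: "f \<in> borel_measurable M" "g \<in> borel_measurable M"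
  shows "(\<lambda>x. proj_frame (f x) (g x)) \<in> borel_measurable M"
  unfolding proj_frame_def by (intro borel_measurable_diff borel_measurable_matrix_vector_mult borel_measurable_transpose assms)

lemma proj_frame_orthogonal_mult:
  assumes g: "orthogonal_matrix g"
  shows "proj_frame (g ** u) (g *v x) = g *v proj_frame u x"
proof -
  have "transpose (g ** u) *v (g *v x) = (transpose u ** (transpose g ** g)) *v x"
    by (simp only: matrix_transpose_mul matrix_vector_mul_assoc matrix_mul_assoc)
  also have "\<dots> = transpose u *v x" using g by (simp add: orthogonal_matrix_def)
  finally show ?thesis
    unfolding proj_frame_def by (simp only: matrix_vector_mult_diff_distrib matrix_vector_mul_assoc[symmetric])
qed

lemma proj_frame_eq_proj_off:
  fixes u :: "real^'k^'n"
  assumes "u \<in> stiefel"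
  shows "orthonormal (range (\<lambda>j. column j u))" "card (range (\<lambda>j. column j u)) = CARD('k)"
    "proj_frame u x = proj_off (range (\<lambda>j. column j u)) x"
proof -
  have c: "column i u \<bullet> column j u = (if i = j then 1 else 0)" for i j
    using assms by (simp add: stiefel_iff_column)
  then have inj: "inj (\<lambda>j. column j u)" by (intro injI) (metis zero_neq_one)
  then show "card (range (\<lambda>j. column j u)) = CARD('k)" by (simp add: card_image)
  show "orthonormal (range (\<lambda>j. column j u))"
    using c inj by (auto simp: orthonormal_def inj_def)
  have "u *v (transpose u *v x) = (\<Sum>j\<in>UNIV. (transpose u *v x) $ j *\<^sub>R column j u)"
    by (simp add: matrix_mult_sum scalar_mult_eq_scaleR del: transpose_matrix_vector)
  also have "\<dots> = (\<Sum>j\<in>UNIV. (x \<bullet> column j u) *\<^sub>R column j u)"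
    by (intro sum.cong refl)
       (simp add: matrix_vector_mult_def transpose_def column_def inner_vec_def mult.commute)
  also have "\<dots> = (\<Sum>s\<in>range (\<lambda>j. column j u). (x \<bullet> s) *\<^sub>R s)"
    using inj by (simp add: sum.reindex)
  finally show "proj_frame u x = proj_off (range (\<lambda>j. column j u)) x"
    by (simp add: proj_frame_def proj_off_def)
qed

text \<open>The weight \<open>coords_weight\<close> as a function of the columns: for columns of
  full rank a constant times |X'X|^(-k/2).\<close>

definition gs_weight :: "nat \<Rightarrow> nat \<Rightarrow> nat \<Rightarrow> (nat \<Rightarrow> 'v::euclidean_space) \<Rightarrow> ennreal" where
  "gs_weight d k m X = (\<Prod>j<m. ennreal (Gamma (real (d - j) / 2) / Gamma (real (d - j - k) / 2) * gs_norm X j powr - real k))"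

lemma measurable_gs_weight:
  assumes "\<And>l. l < m \<Longrightarrow> (\<lambda>w. Y w l) \<in> borel_measurable M"
  shows "(\<lambda>w. gs_weight d k m (Y w)) \<in> borel_measurable M"
proof -
  have [measurable]: "(\<lambda>w. gs_norm (Y w) j) \<in> borel_measurable M" if "j \<in> {..<m}" for j
    using that by (intro measurable_gs_norm assms) auto
  show ?thesis unfolding gs_weight_def by measurable
qed

lemma gs_weight_isometry:
  assumes "linear J" and "\<And>x y. J x \<bullet> J y = x \<bullet> y"
  shows "gs_weight d k m (\<lambda>i. J (X i)) = gs_weight d k m X"
  by (simp add: gs_weight_def gs_isometry(2)[OF assms])

lemma gs_weight_cong: "(\<And>l. l < m \<Longrightarrow> X l = Y l) \<Longrightarrow> gs_weight d k m X = gs_weight d k m Y"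
  unfolding gs_weight_def by (intro prod.cong refl arg_cong[where f=ennreal] arg_cong2[where f="(*)"] arg_cong2[where f="(powr)"] gs_norm_cong) auto

lemma gs_weight_coords:
  "gs_weight d k m X = coords_weight d k m (\<lambda>j\<in>{..<m}. gs_coords X j)"
  by (simp add: gs_weight_def coords_weight_def gs_coords_def)

lemma nn_integral_gs_weight:
  assumes "m + k \<le> DIM('v::euclidean_space)"
  shows "(\<integral>\<^sup>+X. gs_weight DIM('v) k m X \<partial>(gauss_cols m :: (nat \<Rightarrow> 'v) measure)) = 1"
proof -
  let ?T = "\<lambda>X :: nat \<Rightarrow> 'v. \<lambda>j\<in>{..<m}. gs_coords X j"
  have Tm: "?T \<in> gauss_cols m \<rightarrow>\<^sub>M PiM {..<m} coordM"
    using measurable_gs_coords_proj[where S="{}"] by (intro measurable_restrict) auto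
  have law: "distr (gauss_cols m) (PiM {..<m} coordM) ?T = PiM {..<m} (column_law DIM('v))"
    using distr_gs_coords[of "{} :: 'v set" m] assms by (simp add: orthonormal_def)
  have "(\<integral>\<^sup>+X. gs_weight DIM('v) k m X \<partial>(gauss_cols m :: (nat \<Rightarrow> 'v) measure))
      = (\<integral>\<^sup>+T. coords_weight DIM('v) k m T \<partial>distr (gauss_cols m) (PiM {..<m} coordM) ?T)"
    unfolding gs_weight_coords
    by (rule nn_integral_distr[OF Tm, symmetric]) (simp add: measurable_coords_weight)
  then show ?thesis by (simp add: law nn_integral_coords_weight[OF assms])
qed

text \<open>Rotating \<open>\<theta>\<close> and \<open>A\<close> together makes the frame of the projected matrix uniform; only the law of the
  triangular factor depends on the projection.\<close>

lemma nn_integral_proj_frame: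
  fixes \<Phi> :: "(nat \<Rightarrow> real^'b) \<Rightarrow> ennreal"
  assumes le: "CARD('m::finite) + CARD('k::finite) \<le> CARD('b)"
    and \<Phi>: "\<Phi> \<in> borel_measurable (PiM {..<CARD('m)} (\<lambda>_. borel))"
  shows "(\<integral>\<^sup>+\<theta>. \<integral>\<^sup>+A. \<Phi> (\<lambda>l\<in>{..<CARD('m)}. proj_frame \<theta> (A l)) \<partial>gauss_cols CARD('m) \<partial>(stief :: (real^'k^'b) measure))
    = (\<integral>\<^sup>+A. gs_weight CARD('b) CARD('k) CARD('m) A * \<Phi> A \<partial>gauss_cols CARD('m))"
proof -
  let ?m = "CARD('m)" and ?k = "CARD('k)" and ?b = "CARD('b)"
  let ?G = "gauss_cols ?m :: (nat \<Rightarrow> real^'b) measure"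
  interpret G: prob_space ?G by (rule prob_space_gauss_cols)
  interpret st: prob_space "stief :: (real^'m^'b) measure" by (rule prob_space_stief)
  have kb: "?k \<le> ?b" using le by simp
  obtain \<theta>0 :: "real^'k^'b" where \<theta>0: "\<theta>0 \<in> stiefel" by (rule stiefel_nonempty[OF kb])
  define S where "S = range (\<lambda>j. column j \<theta>0)"
  have S: "orthonormal S" "card S = ?k" and PS: "\<And>x. proj_frame \<theta>0 x = proj_off S x"
    using proj_frame_eq_proj_off[OF \<theta>0] by (simp_all add: S_def)
  have cm: "(\<lambda>p. snd p l) \<in> borel_measurable (M \<Otimes>\<^sub>M ?G)" if "l \<in> {..<?m}" for l and M :: "(real^'k^'b) measure"
    using that by (intro measurable_compose[OF measurable_snd measurable_gauss_cols_component]) auto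
  have "(\<lambda>p. \<Phi> (\<lambda>l\<in>{..<?m}. proj_frame (fst p) (snd p l))) \<in> borel_measurable ((borel :: (real^'k^'b) measure) \<Otimes>\<^sub>M ?G)"
    by (intro measurable_compose[OF measurable_restrict \<Phi>] borel_measurable_proj_frame cm) auto
  then have Fm: "(\<lambda>\<theta>. \<integral>\<^sup>+A. \<Phi> (\<lambda>l\<in>{..<?m}. proj_frame \<theta> (A l)) \<partial>?G) \<in> borel_measurable (borel :: (real^'k^'b) measure)"
    using G.borel_measurable_nn_integral_fst by fastforce
  have setsPi: "sets (PiM {..<?m} (column_law d)) = sets (PiM {..<?m} coordM)" for d by (intro sets_PiM_cong) auto
  have "(\<lambda>p. \<Phi> (from_coords (snd p :: real^'m^'b) (fst p))) \<in> borel_measurable (PiM {..<?m} coordM \<Otimes>\<^sub>M stief)"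
    by (rule measurable_compose[OF measurable_from_coords \<Phi>]) auto
  then have inner: "(\<lambda>T. \<integral>\<^sup>+w. \<Phi> (from_coords (w :: real^'m^'b) T) \<partial>stief) \<in> borel_measurable (PiM {..<?m} coordM)"
    using st.borel_measurable_nn_integral_fst by fastforce
  have "(\<integral>\<^sup>+\<theta>. \<integral>\<^sup>+A. \<Phi> (\<lambda>l\<in>{..<?m}. proj_frame \<theta> (A l)) \<partial>?G \<partial>(stief :: (real^'k^'b) measure))
    = (\<integral>\<^sup>+h. \<integral>\<^sup>+A. \<Phi> (\<lambda>l\<in>{..<?m}. proj_frame (h ** \<theta>0) (A l)) \<partial>?G \<partial>haar)"
    by (rule nn_integral_haar_stief[OF kb \<theta>0 Fm, symmetric])
  also have "\<dots> = (\<integral>\<^sup>+h. \<integral>\<^sup>+A. \<Phi> (\<lambda>l\<in>{..<?m}. h *v proj_off S (A l)) \<partial>?G \<partial>haar)"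
  proof (rule nn_integral_cong_AE)
    show "AE h in haar. (\<integral>\<^sup>+A. \<Phi> (\<lambda>l\<in>{..<?m}. proj_frame (h ** \<theta>0) (A l)) \<partial>?G)
       = (\<integral>\<^sup>+A. \<Phi> (\<lambda>l\<in>{..<?m}. h *v proj_off S (A l)) \<partial>?G)"
      using AE_haar_orthogonal
    proof eventually_elim
      case (elim h)
      have "(\<lambda>X. \<Phi> (\<lambda>l\<in>{..<?m}. proj_frame (h ** \<theta>0) (X l))) \<in> borel_measurable ?G"
        using measurable_gauss_cols_component by (intro measurable_compose[OF measurable_restrict \<Phi>] borel_measurable_proj_frame) auto
      then have "(\<integral>\<^sup>+A. \<Phi> (\<lambda>l\<in>{..<?m}. proj_frame (h ** \<theta>0) (h *v A l)) \<partial>?G)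
          = (\<integral>\<^sup>+A. \<Phi> (\<lambda>l\<in>{..<?m}. proj_frame (h ** \<theta>0) (A l)) \<partial>?G)"
        by (rule nn_integral_gauss_cols_rotate[OF elim]) (auto intro!: arg_cong[where f=\<Phi>])
      then show ?case by (simp add: proj_frame_orthogonal_mult[OF elim] PS)
    qed
  qed
  also have "\<dots> = (\<integral>\<^sup>+T. 1 * (\<integral>\<^sup>+w. \<Phi> (from_coords (w :: real^'m^'b) T) \<partial>stief) \<partial>PiM {..<?m} (column_law (?b - ?k)))"
    using nn_integral_haar_proj_off[where 'm='m, OF S(1) _ \<Phi>, of "\<lambda>_. 1"] le S(2) by simp
  \<comment> \<open>The triangular factor of the projected matrix has the law of dimension b - k; it
    is rewritten by its density with respect to dimension b.\<close>
  also have "\<dots> = (\<integral>\<^sup>+T. coords_weight ?b ?k ?m T * (\<integral>\<^sup>+w. \<Phi> (from_coords (w :: real^'m^'b) T) \<partial>stief) \<partial>PiM {..<?m} (column_law ?b))"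
    using inner unfolding coords_law_shift[OF le]
    by (subst nn_integral_density) (auto simp: measurable_coords_weight measurable_cong_sets[OF setsPi refl])
  \<comment> \<open>The same averaging formula with S empty, read from right to left, returns to an
    unprojected Gaussian matrix.\<close>
  also have "\<dots> = (\<integral>\<^sup>+h. \<integral>\<^sup>+A. coords_weight ?b ?k ?m (\<lambda>j\<in>{..<?m}. gs_coords (\<lambda>i. proj_off {} (A i)) j) *
            \<Phi> (\<lambda>l\<in>{..<?m}. h *v proj_off {} (A l)) \<partial>?G \<partial>haar)"
    using nn_integral_haar_proj_off[where 'm='m, OF _ _ \<Phi> measurable_coords_weight(1), of "{}"] le by (simp add: orthonormal_def)
  also have "\<dots> = (\<integral>\<^sup>+h. \<integral>\<^sup>+A. gs_weight ?b ?k ?m A * \<Phi> (\<lambda>l\<in>{..<?m}. h *v A l) \<partial>?G \<partial>haar)"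
    by (simp only: proj_off_empty gs_weight_coords)
  also have "\<dots> = (\<integral>\<^sup>+h. \<integral>\<^sup>+A. gs_weight ?b ?k ?m A * \<Phi> A \<partial>?G \<partial>(haar :: (real^'b^'b) measure))"
  proof (rule nn_integral_cong_AE)
    show "AE h in haar. (\<integral>\<^sup>+A. gs_weight ?b ?k ?m A * \<Phi> (\<lambda>l\<in>{..<?m}. h *v A l) \<partial>?G)
      = (\<integral>\<^sup>+A. gs_weight ?b ?k ?m A * \<Phi> A \<partial>?G)"
      using AE_haar_orthogonal
    proof eventually_elim
      case (elim h)
      have wt: "gs_weight ?b ?k ?m (\<lambda>l\<in>{..<?m}. h *v A l) = gs_weight ?b ?k ?m A" for A :: "nat \<Rightarrow> real^'b"
      proof -
        have "gs_weight ?b ?k ?m (\<lambda>l\<in>{..<?m}. h *v A l) = gs_weight ?b ?k ?m (\<lambda>l. h *v A l)"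
          by (rule gs_weight_cong) simp
        also have "\<dots> = gs_weight ?b ?k ?m A"
          using elim by (intro gs_weight_isometry isometry_matrix_inner) (auto simp: orthogonal_matrix)
        finally show ?thesis .
      qed
      have "(\<lambda>X. gs_weight ?b ?k ?m X * \<Phi> X) \<in> borel_measurable ?G"
        using measurable_gauss_cols_component \<Phi> by (intro borel_measurable_times_ennreal measurable_gs_weight) auto
      from nn_integral_gauss_cols_rotate_restrict[OF elim this] show ?case by (simp only: wt)
    qed
  qed
  also have "\<dots> = (\<integral>\<^sup>+A. gs_weight ?b ?k ?m A * \<Phi> A \<partial>?G)"
    using prob_space.emeasure_space_1[of "haar :: (real^'b^'b) measure"] by (simp add: prob_space_haar)
  finally show ?thesis .
qed

text \<open>Rotation changes the frame but not the weight. Averaging over rotations thus replaces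
  \<open>\<phi>\<close> by its mean, and the weight integrates to 1.\<close>

lemma nn_integral_gs_weight_frame:
  fixes \<phi> :: "real^'m^'n \<Rightarrow> ennreal"
  assumes le: "CARD('m) + k \<le> CARD('n)" and \<phi>: "\<phi> \<in> borel_measurable borel"
  shows "(\<integral>\<^sup>+X. gs_weight CARD('n) k CARD('m) X * \<phi> (frame X) \<partial>gauss_cols CARD('m)) = (\<integral>\<^sup>+w. \<phi> w \<partial>stief)"
proof -
  let ?m = "CARD('m)" and ?n = "CARD('n)"
  let ?G = "gauss_cols ?m :: (nat \<Rightarrow> real^'n) measure"
  interpret H: prob_space "haar :: (real^'n^'n) measure" by (rule prob_space_haar)
  interpret G: prob_space ?G by (rule prob_space_gauss_cols)
  interpret P: pair_prob_space ?G "haar :: (real^'n^'n) measure" ..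
  note \<phi>[measurable]
  have wm: "gs_weight ?n k ?m \<in> borel_measurable ?G"
    using measurable_gauss_cols_component by (intro measurable_gs_weight)
  have fm: "(\<lambda>X. \<phi> (frame X)) \<in> borel_measurable ?G" by measurable
  have "(\<integral>\<^sup>+X. gs_weight ?n k ?m X * \<phi> (frame X) \<partial>?G)
     = (\<integral>\<^sup>+h. \<integral>\<^sup>+X. gs_weight ?n k ?m X * \<phi> (frame X) \<partial>?G \<partial>(haar :: (real^'n^'n) measure))"
    using H.emeasure_space_1 by simp
  also have "\<dots> = (\<integral>\<^sup>+h. \<integral>\<^sup>+X. gs_weight ?n k ?m X * \<phi> (h ** frame X) \<partial>?G \<partial>haar)"
  proof (rule nn_integral_cong_AE)
    show "AE h in haar. (\<integral>\<^sup>+X. gs_weight ?n k ?m X * \<phi> (frame X) \<partial>?G) = (\<integral>\<^sup>+X. gs_weight ?n k ?m X * \<phi> (h ** frame X) \<partial>?G)"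
      using AE_haar_orthogonal
    proof eventually_elim
      case (elim h)
      let ?F = "\<lambda>X. gs_weight ?n k ?m X * \<phi> (frame X)"
      have hh: "transpose h ** h = mat 1" using elim by (simp only: orthogonal_matrix)
      have wt: "gs_weight ?n k ?m (\<lambda>l. h *v X l) = gs_weight ?n k ?m X" for X :: "nat \<Rightarrow> real^'n"
        by (intro gs_weight_isometry isometry_matrix_inner[OF hh]) simp
      have "?F \<in> borel_measurable ?G" using wm fm by (rule borel_measurable_times_ennreal)
      then have "(\<integral>\<^sup>+X. ?F (\<lambda>l. h *v X l) \<partial>?G) = (\<integral>\<^sup>+X. ?F X \<partial>?G)"
        by (rule nn_integral_gauss_cols_rotate[OF elim]) (metis gs_weight_cong frame_cong)
      then show ?case by (simp add: wt frame_isometry[OF hh])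
    qed
  qed
  also have "\<dots> = (\<integral>\<^sup>+X. \<integral>\<^sup>+h. gs_weight ?n k ?m X * \<phi> (h ** frame X) \<partial>haar \<partial>?G)"
  proof (rule P.Fubini')
    have "(\<lambda>p. gs_weight ?n k ?m (fst p)) \<in> borel_measurable (?G \<Otimes>\<^sub>M (haar :: (real^'n^'n) measure))"
      by (rule measurable_compose[OF measurable_fst wm])
    moreover have "(\<lambda>p. \<phi> (snd p ** frame (fst p))) \<in> borel_measurable (?G \<Otimes>\<^sub>M (haar :: (real^'n^'n) measure))"
      by (intro measurable_compose[OF borel_measurable_matrix_mult \<phi>] measurable_compose[OF measurable_fst measurable_frame_gauss_cols]) simp
    ultimately show "(\<lambda>(X, h). gs_weight ?n k ?m X * \<phi> (h ** frame X)) \<in> borel_measurable (?G \<Otimes>\<^sub>M (haar :: (real^'n^'n) measure))"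
      by (simp add: case_prod_beta borel_measurable_times_ennreal)
  qed
  also have "\<dots> = (\<integral>\<^sup>+X. gs_weight ?n k ?m X * (\<integral>\<^sup>+w. \<phi> w \<partial>stief) \<partial>?G)"
  proof (rule nn_integral_cong_AE)
    have mn: "?m \<le> ?n" using le by simp
    show "AE X in ?G. (\<integral>\<^sup>+h. gs_weight ?n k ?m X * \<phi> (h ** frame X) \<partial>haar) = gs_weight ?n k ?m X * (\<integral>\<^sup>+w. \<phi> w \<partial>stief)"
      using AE_frame_in_stiefel[OF mn]
      by eventually_elim (simp add: nn_integral_cmult nn_integral_haar_stief[OF mn _ \<phi>])
  qed
  also have "\<dots> = (\<integral>\<^sup>+w. \<phi> w \<partial>stief)"
    using nn_integral_gs_weight[of ?m k, where 'v="real^'n"] le wm by (simp add: nn_integral_multc)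
  finally show ?thesis .
qed

text \<open>A permutation that never lowers an index and differs from the identity would increase
  the sum of all indices. So every other term of the determinant contains an entry from the
  vanishing triangle.\<close>

lemma det_idx_triangular:
  fixes A :: "real^'m^'m"
  assumes "\<And>i j. idx j < idx i \<Longrightarrow> A $ i $ j = 0"
  shows "det A = (\<Prod>i\<in>UNIV. A $ i $ i)"
proof -
  let ?t = "\<lambda>p. of_int (sign p) * (\<Prod>i\<in>UNIV. A $ i $ p i)"
  have "?t p = 0" if p: "p permutes UNIV" "p \<noteq> id" for p
  proof -
    have "\<exists>i. idx (p i) < idx i"
    proof (rule ccontr)
      assume "\<not> ?thesis"
      then have ge: "idx i \<le> idx (p i)" for i by (meson not_le)
      obtain i where "p i \<noteq> i" using p(2) by (auto simp: fun_eq_iff)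
      then have "idx i < idx (p i)" using ge[of i] by (simp add: le_less)
      then have "(\<Sum>i\<in>UNIV. idx (i::'m)) < (\<Sum>i\<in>UNIV. idx (p i))"
        using ge by (intro sum_strict_mono_ex1) auto
      moreover have "(\<Sum>i\<in>UNIV. idx (p i)) = (\<Sum>i\<in>UNIV. idx (i::'m))"
        using sum.permute[OF p(1), of idx] by (simp add: comp_def)
      ultimately show False by simp
    qed
    then obtain i where "A $ i $ p i = 0" using assms by blast
    then have "(\<Prod>i\<in>UNIV. A $ i $ p i) = 0" by (intro prod_zero) auto
    then show ?thesis by simp
  qed
  then have "det A = sum ?t {id}"
    unfolding det_def by (intro sum.mono_neutral_right) (auto simp: permutes_id finite_permutations)
  then show ?thesis by (simp add: sign_id)
qed

text \<open>The QR factorisation, with R assembled from the Gram-Schmidt coefficients; the column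
  sums stop at the diagonal.\<close>

lemma mat_of_eq_frame_mult:
  fixes X :: "nat \<Rightarrow> real^'n"
  obtains R :: "real^'m^'m" where "mat_of X = frame X ** R" "det R = (\<Prod>j<CARD('m). gs_norm X j)"
proof -
  define r where "r l j = (if l < j then X j \<bullet> gs X l else if l = j then gs_norm X j else 0)" for l j
  define R :: "real^'m^'m" where "R = (\<chi> i j. r (idx i) (idx j))"
  have "mat_of X = frame X ** R"
  proof (rule matrix_eq_columnI)
    fix j :: 'm
    have "column j (frame X ** R) = (\<Sum>i\<in>UNIV. r (idx i) (idx j) *\<^sub>R gs X (idx (i::'m)))"
      unfolding column_matrix_mult
      by (simp add: matrix_mult_sum scalar_mult_eq_scaleR R_def frame_def) (simp add: column_def)
    also have "\<dots> = (\<Sum>l<CARD('m). r l (idx j) *\<^sub>R gs X l)"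
      by (rule sum.reindex_bij_betw[OF bij_idx])
    also have "\<dots> = (\<Sum>l<Suc (idx j). r l (idx j) *\<^sub>R gs X l)"
      using Suc_leI[OF idx_less[of j]] by (intro sum.mono_neutral_right) (auto simp: r_def)
    also have "\<dots> = X (idx j)"
      using gs_decompose[of X "idx j"] by (simp add: r_def)
    finally show "column j (mat_of X) = column j (frame X ** R)" by simp
  qed
  moreover have "det R = (\<Prod>i\<in>UNIV. R $ i $ i)"
    by (rule det_idx_triangular) (auto simp: R_def r_def)
  moreover have "(\<Prod>i\<in>UNIV. R $ i $ i) = (\<Prod>j<CARD('m). gs_norm X j)"
    using prod.reindex_bij_betw[OF bij_idx[where 'm='m], of "gs_norm X"] by (simp add: R_def r_def)
  ultimately show thesis by (intro that) auto
qed

lemma matrix_diff_ldistrib: "A ** (B - C) = A ** B - A ** (C :: real^'z^'y)"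
  for A :: "real^'y^'x"
  by (simp add: matrix_matrix_mult_def vec_eq_iff right_diff_distrib sum_subtractf)

lemma matrix_diff_rdistrib: "(A - B) ** C = A ** C - B ** (C :: real^'z^'y)"
  for A :: "real^'y^'x"
  by (simp add: matrix_matrix_mult_def vec_eq_iff left_diff_distrib sum_subtractf)

text \<open>The Gram determinant of A = J'X is computed twice. The factorisation of A gives the left
  side; X = w R together with JJ' = I - vv' gives the right side.\<close>

lemma prod_gs_norm_split:
  fixes J :: "real^'b^'n" and v :: "real^'m^'n"
  assumes s: "splitting J v"
    and X: "(frame X :: real^'m^'n) \<in> stiefel"
    and A: "(frame (\<lambda>l. transpose J *v X l) :: real^'m^'b) \<in> stiefel"
  shows "(\<Prod>j<CARD('m). gs_norm (\<lambda>l. transpose J *v X l) j)\<^sup>2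
    = det (mat 1 - transpose (frame X :: real^'m^'n) ** v ** transpose v ** (frame X :: real^'m^'n)) * (\<Prod>j<CARD('m). gs_norm X j)\<^sup>2"
proof -
  let ?A = "\<lambda>l. transpose J *v X l"
  let ?w = "frame X :: real^'m^'n" and ?a = "frame ?A :: real^'m^'b"
  obtain R :: "real^'m^'m" where R: "mat_of X = ?w ** R" "det R = (\<Prod>j<CARD('m). gs_norm X j)"
    by (rule mat_of_eq_frame_mult)
  obtain R' :: "real^'m^'m" where R': "mat_of ?A = ?a ** R'" "det R' = (\<Prod>j<CARD('m). gs_norm ?A j)"
    by (rule mat_of_eq_frame_mult)
  have "transpose (mat_of ?A :: real^'m^'b) ** mat_of ?A = transpose R' ** (transpose ?a ** ?a) ** R'"
    unfolding R'(1) by (simp only: matrix_transpose_mul matrix_mul_assoc)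
  also have "\<dots> = transpose R' ** R'" using A by (simp add: stiefel_def)
  finally have 1: "det (transpose (mat_of ?A :: real^'m^'b) ** mat_of ?A) = (det R')\<^sup>2"
    by (simp add: det_mul power2_eq_square)
  have "(mat_of ?A :: real^'m^'b) = transpose J ** (?w ** R)"
    unfolding R(1)[symmetric] matrix_mult_mat_of ..
  then have "transpose (mat_of ?A :: real^'m^'b) ** mat_of ?A = transpose R ** (transpose ?w ** (J ** transpose J) ** ?w) ** R"
    by (simp only: matrix_transpose_mul matrix_mul_assoc transpose_transpose)
  moreover have "J ** transpose J = mat 1 - v ** transpose v"
    using s by (auto simp: splitting_def algebra_simps)
  moreover have "transpose ?w ** (mat 1 - v ** transpose v) ** ?w = mat 1 - transpose ?w ** v ** transpose v ** ?w"
    using X by (simp add: stiefel_def matrix_diff_ldistrib matrix_diff_rdistrib matrix_mul_assoc)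
  ultimately have "det (transpose (mat_of ?A :: real^'m^'b) ** mat_of ?A)
    = det (mat 1 - transpose ?w ** v ** transpose v ** ?w) * (det R)\<^sup>2"
    by (simp add: det_mul power2_eq_square)
  then show ?thesis unfolding 1 R(2) R'(2) .
qed

section \<open>The composition of the Funk transforms\<close>

text \<open>The exponent (\<alpha> + m - n)/2 of the sine transform is -k/2 at \<alpha> = n - k -
  m.\<close>

definition sine_kernel :: "nat \<Rightarrow> real^'m^'n \<Rightarrow> real^'m^'n \<Rightarrow> real" where
  "sine_kernel k v w = \<bar>det (mat 1 - transpose w ** v ** transpose v ** w)\<bar> powr (- real k / 2)"

definition gamma_ratio :: "nat \<Rightarrow> nat \<Rightarrow> nat \<Rightarrow> real" where
  "gamma_ratio d k m = (\<Prod>j<m. Gamma (real (d - j) / 2) / Gamma (real (d - j - k) / 2))"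

lemma gamma_ratio_pos: "m + k \<le> d \<Longrightarrow> gamma_ratio d k m > 0"
  unfolding gamma_ratio_def by (intro prod_pos) (auto intro!: divide_pos_pos Gamma_real_pos)

lemma gs_weight_eq:
  assumes "m + k \<le> d"
  shows "gs_weight d k m X = ennreal (gamma_ratio d k m * (\<Prod>j<m. gs_norm X j) powr - real k)"
proof -
  have "gs_weight d k m X = ennreal (\<Prod>j<m. Gamma (real (d - j) / 2) / Gamma (real (d - j - k) / 2) * gs_norm X j powr - real k)"
    unfolding gs_weight_def using assms
    by (intro prod_ennreal) (auto intro!: mult_nonneg_nonneg divide_nonneg_nonneg less_imp_le[OF Gamma_real_pos])
  moreover have "(\<Prod>j<m. gs_norm X j) powr - real k = (\<Prod>j<m. gs_norm X j powr - real k)"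
    by (rule prod_powr_distrib)
  ultimately show ?thesis by (simp only: gamma_ratio_def prod.distrib)
qed

lemma borel_measurable_sine_kernel[measurable]:
  assumes [measurable]: "f \<in> borel_measurable M" "g \<in> borel_measurable M"
  shows "(\<lambda>x. sine_kernel k (f x) (g x :: real^'m^'n)) \<in> borel_measurable M"
proof -
  have [measurable]: "(\<lambda>x. det (mat 1 - transpose (g x) ** f x ** transpose (f x) ** g x)) \<in> borel_measurable M"
    by (intro borel_measurable_det borel_measurable_diff borel_measurable_const borel_measurable_matrix_mult
          borel_measurable_transpose assms)
  show ?thesis unfolding sine_kernel_def by measurable
qed

lemma sine_kernel_nonneg[simp]: "sine_kernel k v w \<ge> 0" by (simp add: sine_kernel_def)

text \<open>By \<open>prod_gs_norm_split\<close> the products of the diagonal entries of A and X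
  differ by the square root of the determinant in the kernel. Raising to the power -k splits the
  weight of A; the positivity assumptions justify the division of powers.\<close>

lemma gs_weight_split:
  fixes J :: "real^'b^'n" and v :: "real^'m^'n"
  assumes s: "splitting J v" and le: "CARD('m) + k \<le> CARD('b)"
    and X: "\<And>j. j < CARD('m) \<Longrightarrow> gs_norm X j > 0"
    and A: "\<And>j. j < CARD('m) \<Longrightarrow> gs_norm (\<lambda>l. transpose J *v X l) j > 0"
  shows "gs_weight CARD('b) k CARD('m) (\<lambda>l. transpose J *v X l)
    = ennreal (gamma_ratio CARD('b) k CARD('m) / gamma_ratio CARD('n) k CARD('m) * sine_kernel k v (frame X))
      * gs_weight CARD('n) k CARD('m) X"
proof -
  let ?p = "\<Prod>j<CARD('m). gs_norm (\<lambda>l. transpose J *v X l) j" and ?q = "\<Prod>j<CARD('m). gs_norm X j"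
  let ?D = "det (mat 1 - transpose (frame X :: real^'m^'n) ** v ** transpose v ** (frame X :: real^'m^'n))"
  have p: "?p > 0" using A by (intro prod_pos) auto
  have q: "?q > 0" using X by (intro prod_pos) auto
  have e: "?p\<^sup>2 = ?D * ?q\<^sup>2"
    by (intro prod_gs_norm_split[OF s] frame_in_stiefel X A)
  have "d = (p / q) powr 2" if "p\<^sup>2 = d * q\<^sup>2" "p > 0" "q > 0" for p q d :: real
    using that by (simp add: power_divide powr_numeral)
  from this[OF e p q] have D: "?D = (?p / ?q) powr 2" .
  have K: "sine_kernel k v (frame X) = (?p / ?q) powr - real k"
    unfolding sine_kernel_def D by (simp add: powr_powr del: powr_numeral)
  have pq: "?p powr - real k = (?p / ?q) powr - real k * ?q powr - real k"
  proof -
    have "p powr - real k = (p / q) powr - real k * q powr - real k" if "p > 0" "q > 0" for p q :: real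
      using that by (simp add: powr_mult[symmetric])
    from this[OF p q] show ?thesis .
  qed
  have le': "CARD('m) + k \<le> CARD('n)" using le s by (simp add: splitting_def)
  have "gamma_ratio CARD('b) k CARD('m) * ?p powr - real k
    = (gamma_ratio CARD('b) k CARD('m) / gamma_ratio CARD('n) k CARD('m) * sine_kernel k v (frame X))
      * (gamma_ratio CARD('n) k CARD('m) * ?q powr - real k)"
    using gamma_ratio_pos[OF le'] by (simp add: K pq del: transpose_matrix_vector)
  then show ?thesis
    using gamma_ratio_pos[OF le'] gamma_ratio_pos[OF le] 
    by (simp add: gs_weight_eq[OF le] gs_weight_eq[OF le'] ennreal_mult[symmetric] del: transpose_matrix_vector)
qed

text \<open>The columns of v are orthogonal to those of J \<theta>, so projection affects only the
  J-component.\<close>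

lemma proj_frame_split:
  fixes J :: "real^'b^'n" and v :: "real^'m^'n" and \<theta> :: "real^'k^'b"
  assumes s: "splitting J v"
  shows "proj_frame (J ** \<theta>) (J *v a + v *v b) = J *v proj_frame \<theta> a + v *v b"
proof -
  have "transpose (J ** \<theta>) *v (J *v a + v *v b) = transpose \<theta> *v (transpose J *v (J *v a + v *v b))"
    by (simp only: matrix_transpose_mul matrix_vector_mul_assoc)
  then show ?thesis
    unfolding proj_frame_def splitting_apply(1)[OF s]
    by (simp add: matrix_vector_mult_diff_distrib matrix_vector_mul_assoc[symmetric] del: transpose_matrix_vector)
qed

text \<open>In the splitting of X the matrix J'X is the component A, itself Gaussian in dimension b
  and thus almost surely of full rank.\<close>

lemma AE_gs_norm_split_pos:
  fixes J :: "real^'b^'n" and v :: "real^'m^'n"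
  assumes s: "splitting J v" and le: "m \<le> CARD('b)"
  shows "AE X in gauss_cols m. \<forall>j<m. gs_norm (\<lambda>l. transpose J *v X l) j > 0"
proof -
  let ?E = "{X \<in> space (PiM {..<m} (\<lambda>_. borel)). \<forall>j\<in>{..<m}. gs_norm (\<lambda>l. transpose J *v (X l :: real^'n)) j > 0}"
  have [measurable]: "(\<lambda>X. gs_norm (\<lambda>l. transpose J *v (X l :: real^'n)) j) \<in> borel_measurable (PiM {..<m} (\<lambda>_. borel))"
    if "j \<in> {..<m}" for j
    using that by (intro measurable_gs_norm borel_measurable_matrix_vector_mult) (auto intro!: measurable_component_singleton)
  have E: "?E \<in> sets (PiM {..<m} (\<lambda>_. borel))" by measurable
  have "emeasure (gauss_cols m) ?E = (\<integral>\<^sup>+X. indicator ?E X \<partial>gauss_cols m)" using E by simp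
  also have "\<dots> = (\<integral>\<^sup>+A. \<integral>\<^sup>+B. indicator ?E (\<lambda>l\<in>{..<m}. J *v A l + v *v B l) \<partial>gauss_cols m \<partial>gauss_cols m)"
    by (rule nn_integral_gauss_cols_split[OF s]) (use E in simp)
  also have "\<dots> = (\<integral>\<^sup>+A. \<integral>\<^sup>+B. 1 \<partial>(gauss_cols m :: (nat \<Rightarrow> real^'m) measure) \<partial>(gauss_cols m :: (nat \<Rightarrow> real^'b) measure))"
  proof (rule nn_integral_cong_AE)
    have "AE A in (gauss_cols m :: (nat \<Rightarrow> real^'b) measure). \<forall>j<m. gs_norm A j > 0"
      using AE_gs_norm_pos[of "{} :: (real^'b) set" m] le by (simp add: orthonormal_def)
    then show "AE A in gauss_cols m. (\<integral>\<^sup>+B. indicator ?E (\<lambda>l\<in>{..<m}. J *v A l + v *v B l) \<partial>(gauss_cols m :: (nat \<Rightarrow> real^'m) measure))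
       = (\<integral>\<^sup>+B. 1 \<partial>(gauss_cols m :: (nat \<Rightarrow> real^'m) measure))"
    proof eventually_elim
      case (elim A)
      have "gs_norm (\<lambda>l. transpose J *v (\<lambda>l\<in>{..<m}. J *v A l + v *v B l) l) j = gs_norm A j" if "j < m" for j B
        using that by (intro gs_norm_cong) (simp add: splitting_apply(1)[OF s] del: transpose_matrix_vector)
      then have "(\<lambda>l\<in>{..<m}. J *v A l + v *v B l) \<in> ?E" for B
        using elim by (auto simp: space_PiM)
      then show ?case by (intro nn_integral_cong) (simp del: mem_Collect_eq)
    qed
  qed
  also have "\<dots> = 1"
    by (simp add: prob_space.emeasure_space_1 prob_space_gauss_cols)
  finally have "AE X in gauss_cols m. X \<in> ?E"
    using E by (intro prob_space.AE_prob_1[OF prob_space_gauss_cols]) (simp add: measure_def)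
  then show ?thesis by (rule eventually_mono) auto
qed

text \<open>The composition of the two transforms for nonnegative f, with both frames replaced by
  Gaussian data. The splitting isolates the component A, the only one that sees \<theta>.\<close>

lemma nn_integral_composed_funk:
  fixes J :: "real^'b^'n" and v :: "real^'m^'n"
  assumes s: "splitting J v" and le: "CARD('m) + CARD('k::finite) \<le> CARD('b)"
    and f: "f \<in> borel_measurable borel"
  shows "(\<integral>\<^sup>+\<theta>. \<integral>\<^sup>+X. f (frame (\<lambda>l. proj_frame (J ** \<theta>) (X l)) :: real^'m^'n) \<partial>gauss_cols CARD('m) \<partial>(stief :: (real^'k^'b) measure))
    = (\<integral>\<^sup>+w. f w * ennreal (gamma_ratio CARD('b) CARD('k) CARD('m) / gamma_ratio CARD('n) CARD('k) CARD('m)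
         * sine_kernel CARD('k) v w) \<partial>stief)"
proof -
  let ?m = "CARD('m)" and ?k = "CARD('k)"
  let ?Gn = "gauss_cols ?m :: (nat \<Rightarrow> real^'n) measure" and ?Gb = "gauss_cols ?m :: (nat \<Rightarrow> real^'b) measure"
  let ?Gm = "gauss_cols ?m :: (nat \<Rightarrow> real^'m) measure"
  let ?C = "gamma_ratio CARD('b) ?k ?m / gamma_ratio CARD('n) ?k ?m"
  let ?fr = "frame :: (nat \<Rightarrow> real^'n) \<Rightarrow> real^'m^'n"
  \<comment> \<open>Projection leaves B alone, so B is integrated out in advance; what remains
    depends on A only, as \<open>nn_integral_proj_frame\<close> demands.\<close>
  define \<Psi> where "\<Psi> A = (\<integral>\<^sup>+B. f (?fr (\<lambda>l. J *v A l + v *v B l)) \<partial>?Gm)" for A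
  interpret Gm: prob_space ?Gm by (rule prob_space_gauss_cols)
  note f[measurable]
  have bn: "CARD('b) + ?m = CARD('n)" using s by (simp add: splitting_def)
  have comp: "(\<lambda>X. X l) \<in> borel_measurable (PiM {..<?m} (\<lambda>_. borel))" if "l < ?m" for l
    using that by (intro measurable_component_singleton) simp
  have "(\<lambda>p. f (?fr (\<lambda>l. J *v fst p l + v *v snd p l))) \<in> borel_measurable (PiM {..<?m} (\<lambda>_. borel) \<Otimes>\<^sub>M ?Gm)"
    by (intro measurable_compose[OF measurable_frame f] borel_measurable_add borel_measurable_matrix_vector_mult
        measurable_compose[OF measurable_fst comp] measurable_compose[OF measurable_snd measurable_gauss_cols_component]) auto
  then have \<Psi>m: "\<Psi> \<in> borel_measurable (PiM {..<?m} (\<lambda>_. borel))"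
    unfolding \<Psi>_def[abs_def] using Gm.borel_measurable_nn_integral_fst by fastforce
  have "(\<integral>\<^sup>+X. f (?fr (\<lambda>l. proj_frame (J ** \<theta>) (X l))) \<partial>?Gn) = (\<integral>\<^sup>+A. \<Psi> (\<lambda>l\<in>{..<?m}. proj_frame \<theta> (A l)) \<partial>?Gb)"
    for \<theta> :: "real^'k^'b"
  proof -
    have "(\<integral>\<^sup>+X. f (?fr (\<lambda>l. proj_frame (J ** \<theta>) (X l))) \<partial>?Gn)
      = (\<integral>\<^sup>+A. \<integral>\<^sup>+B. f (?fr (\<lambda>l. proj_frame (J ** \<theta>) ((\<lambda>l\<in>{..<?m}. J *v A l + v *v B l) l))) \<partial>?Gm \<partial>?Gb)"
      by (rule nn_integral_gauss_cols_split[OF s])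
         (intro measurable_compose[OF measurable_frame f] borel_measurable_proj_frame comp, auto)
    moreover have "?fr (\<lambda>l. proj_frame (J ** \<theta>) ((\<lambda>l\<in>{..<?m}. J *v A l + v *v B l) l))
       = ?fr (\<lambda>l. J *v (\<lambda>l\<in>{..<?m}. proj_frame \<theta> (A l)) l + v *v B l)" for A B
      by (rule frame_cong) (simp add: proj_frame_split[OF s])
    ultimately show ?thesis by (simp only: \<Psi>_def)
  qed
  then have "(\<integral>\<^sup>+\<theta>. \<integral>\<^sup>+X. f (?fr (\<lambda>l. proj_frame (J ** \<theta>) (X l))) \<partial>?Gn \<partial>(stief :: (real^'k^'b) measure))
    = (\<integral>\<^sup>+\<theta>. \<integral>\<^sup>+A. \<Psi> (\<lambda>l\<in>{..<?m}. proj_frame \<theta> (A l)) \<partial>?Gb \<partial>(stief :: (real^'k^'b) measure))" by simp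
  also have "\<dots> = (\<integral>\<^sup>+A. gs_weight CARD('b) ?k ?m A * \<Psi> A \<partial>?Gb)"
    by (rule nn_integral_proj_frame[OF le \<Psi>m])
  also have "\<dots> = (\<integral>\<^sup>+A. \<integral>\<^sup>+B. gs_weight CARD('b) ?k ?m A * f (?fr (\<lambda>l. J *v A l + v *v B l)) \<partial>?Gm \<partial>?Gb)"
  proof (rule nn_integral_cong)
    fix A :: "nat \<Rightarrow> real^'b"
    have "(\<lambda>B. f (?fr (\<lambda>l. J *v A l + v *v B l))) \<in> borel_measurable ?Gm"
      by (intro measurable_compose[OF measurable_frame f] borel_measurable_add borel_measurable_matrix_vector_mult
        measurable_gauss_cols_component) auto
    then show "gs_weight CARD('b) ?k ?m A * \<Psi> A = (\<integral>\<^sup>+B. gs_weight CARD('b) ?k ?m A * f (?fr (\<lambda>l. J *v A l + v *v B l)) \<partial>?Gm)"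
      by (simp add: nn_integral_cmult \<Psi>_def)
  qed
  \<comment> \<open>A is recovered from X = J A + v B as J'X. This makes the integrand a function of
    X, and the splitting can be undone.\<close>
  also have "\<dots> = (\<integral>\<^sup>+A. \<integral>\<^sup>+B. gs_weight CARD('b) ?k ?m (\<lambda>l. transpose J *v (\<lambda>l\<in>{..<?m}. J *v A l + v *v B l) l)
       * f (?fr (\<lambda>l\<in>{..<?m}. J *v A l + v *v B l)) \<partial>?Gm \<partial>?Gb)"
    by (intro nn_integral_cong arg_cong2[where f="(*)"] gs_weight_cong arg_cong[where f=f] frame_cong)
       (simp_all add: splitting_apply(1)[OF s] del: transpose_matrix_vector)
  also have "\<dots> = (\<integral>\<^sup>+X. gs_weight CARD('b) ?k ?m (\<lambda>l. transpose J *v X l) * f (?fr X) \<partial>?Gn)"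
    by (rule nn_integral_gauss_cols_split[OF s, symmetric])
       (intro borel_measurable_times_ennreal measurable_compose[OF measurable_frame f] measurable_gs_weight
          borel_measurable_matrix_vector_mult comp, auto)
  \<comment> \<open>The weight of dimension b becomes kernel times weight of dimension n. The latter
    depends on T alone and then integrates out.\<close>
  also have "\<dots> = (\<integral>\<^sup>+X. gs_weight CARD('n) ?k ?m X * (f (?fr X) * ennreal (?C * sine_kernel ?k v (?fr X))) \<partial>?Gn)"
  proof (rule nn_integral_cong_AE)
    have 1: "AE X in ?Gn. \<forall>j<?m. gs_norm (\<lambda>l. transpose J *v X l) j > 0"
      using le by (intro AE_gs_norm_split_pos[OF s]) simp
    have 2: "AE X in ?Gn. \<forall>j<?m. gs_norm X j > 0"
      using AE_gs_norm_pos[of "{} :: (real^'n) set" ?m] bn by (simp add: orthonormal_def)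
    show "AE X in ?Gn. gs_weight CARD('b) ?k ?m (\<lambda>l. transpose J *v X l) * f (?fr X)
      = gs_weight CARD('n) ?k ?m X * (f (?fr X) * ennreal (?C * sine_kernel ?k v (?fr X)))"
      using 1 2 by eventually_elim (simp add: gs_weight_split[OF s le] mult_ac del: transpose_matrix_vector)
  qed
  also have "\<dots> = (\<integral>\<^sup>+w. f w * ennreal (?C * sine_kernel ?k v w) \<partial>stief)"
    using le bn by (intro nn_integral_gs_weight_frame) auto
  finally show ?thesis .
qed

section \<open>Block matrices and the completion of a frame\<close>

lemma sum_UNIV_sum_type:
  "(\<Sum>c\<in>UNIV. h (c :: 'a::finite + 'b::finite)) = (\<Sum>a\<in>UNIV. h (Inl a)) + (\<Sum>b\<in>UNIV. h (Inr b))"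
  by (simp add: UNIV_Plus_UNIV[symmetric] sum.Plus del: UNIV_Plus_UNIV)

lemma upper_block_eq_mult:
  "(upper_block w :: real^'m^('a::finite + 'b::finite)) = upper_block (mat 1) ** w"
proof -
  have "upper_block A ** w = (upper_block (A ** w) :: real^'m^('a + 'b))" for A :: "real^'a^'a"
    by (auto simp: vec_eq_iff upper_block_def matrix_matrix_mult_def split: sum.split)
  from this[of "mat 1"] show ?thesis by simp
qed

lemma sum_mat_1_mult:
  "(\<Sum>c\<in>UNIV. (mat 1 :: real^'c^'c) $ a $ c * h c) = h a"
  "(\<Sum>c\<in>UNIV. (mat 1 :: real^'c^'c) $ c $ a * h c) = h a"
proof -
  have "(\<Sum>c\<in>UNIV. (mat 1 :: real^'c^'c) $ a $ c * h c) = (\<Sum>c\<in>UNIV. if c = a then h c else 0)"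
    by (intro sum.cong) (auto simp: mat_def)
  then show "(\<Sum>c\<in>UNIV. (mat 1 :: real^'c^'c) $ a $ c * h c) = h a" by simp
  have "(\<Sum>c\<in>UNIV. (mat 1 :: real^'c^'c) $ c $ a * h c) = (\<Sum>c\<in>UNIV. if c = a then h c else 0)"
    by (intro sum.cong) (auto simp: mat_def)
  then show "(\<Sum>c\<in>UNIV. (mat 1 :: real^'c^'c) $ c $ a * h c) = h a" by simp
qed

lemma block_orthogonality:
  fixes U :: "real^'a^('a + 'k::finite)" and L :: "real^'k^('a + 'k)"
  assumes U: "U = upper_block (mat 1)" and L: "L = lower_block (mat 1)"
  shows "transpose U ** U = mat 1" "transpose U ** L = 0" "U ** transpose U + L ** transpose L = mat 1"
proof -
  have UL: "U $ Inl a = mat 1 $ a" "U $ Inr b = 0" "L $ Inl a = 0" "L $ Inr b = mat 1 $ b" for a b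
    by (simp_all add: U L upper_block_def lower_block_def)
  show "transpose U ** U = mat 1" "transpose U ** L = 0"
    by (simp_all add: vec_eq_iff matrix_matrix_mult_def transpose_def sum_UNIV_sum_type UL sum_mat_1_mult)
  have "(U ** transpose U + L ** transpose L) $ i $ j = mat 1 $ i $ j" for i j
    by (cases i; cases j)
       (simp_all add: matrix_matrix_mult_def transpose_def UL sum_mat_1_mult, simp_all add: mat_def)
  then show "U ** transpose U + L ** transpose L = mat 1" by (simp add: vec_eq_iff)
qed

lemma frame_completion_ex:
  fixes u :: "real^'k^'n"
  assumes u: "u \<in> stiefel" and card: "CARD('a::finite) + CARD('k) = CARD('n)"
  shows "\<exists>g :: real^('a + 'k)^'n. transpose g ** g = mat 1 \<and> g ** transpose g = mat 1 \<and> g ** lower_block (mat 1) = u"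
proof -
  obtain B where B: "\<And>i. i < CARD('k) \<Longrightarrow> B i = cols u i"
    "\<And>i i'. i < CARD('n) \<Longrightarrow> i' < CARD('n) \<Longrightarrow> B i \<bullet> B i' = (if i = i' then 1 else (0::real))"
    using orthonormal_family_extend[of "CARD('k)" "cols u"] stiefel_cols[OF u] card by auto
  \<comment> \<open>The given columns occupy the first numbers of the extended basis but belong to
    the lower block, hence the \<open>Inr\<close> indices come first.\<close>
  define \<tau> :: "'a + 'k \<Rightarrow> nat" where "\<tau> c = (case c of Inl a \<Rightarrow> CARD('k) + idx a | Inr j \<Rightarrow> idx j)" for c
  have \<tau>_less: "\<tau> c < CARD('n)" for c
  proof (cases c)
    case (Inl a)
    then have "\<tau> c = CARD('k) + idx a" by (simp add: \<tau>_def)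
    then show ?thesis using card idx_less[of a] by linarith
  next
    case (Inr j)
    then have "\<tau> c = idx j" by (simp add: \<tau>_def)
    then show ?thesis using card idx_less[of j] by linarith
  qed
  have "CARD('k) + i \<noteq> idx (j::'k)" for i j using idx_less[of j] by linarith
  then have "inj \<tau>"
    by (auto simp: inj_def \<tau>_def split: sum.splits) metis
  have "card (range \<tau>) = card {..<CARD('n)}"
    using card by (simp add: card_image[OF \<open>inj \<tau>\<close>])
  moreover have "range \<tau> \<subseteq> {..<CARD('n)}" using \<tau>_less by blast
  ultimately have "range \<tau> = {..<CARD('n)}" by (intro card_subset_eq) auto
  then have bij: "bij_betw \<tau> UNIV {..<CARD('n)}"
    using \<open>inj \<tau>\<close> by (simp add: bij_betw_def)
  define g :: "real^('a + 'k)^'n" where "g = (\<chi> p c. B (\<tau> c) $ p)"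
  have col: "column c g = B (\<tau> c)" for c by (simp add: g_def column_def)
  have "transpose g ** g = mat 1"
    using \<tau>_less inj_eq[OF \<open>inj \<tau>\<close>] by (simp add: matrix_mult_transpose_dot_column col B(2) mat_def vec_eq_iff)
  \<comment> \<open>Rows and columns of g have different index types. The product is a sum over
    columns, insensitive to their labels, so it is compared with that of a square matrix having the
    same columns.\<close>
  moreover have "g ** transpose g = mat 1"
  proof -
    let ?S = "mat_of B :: real^'n^'n"
    have "orthogonal_matrix ?S"
      using B(2) by (auto simp: orthogonal_matrix_orthonormal_columns norm_eq_1 orthogonal_def)
    then have "?S ** transpose ?S = mat 1" by (simp add: orthogonal_matrix_def)
    moreover have "g ** transpose g = ?S ** transpose ?S"
    proof -
      have "(\<Sum>c\<in>UNIV. B (\<tau> c) $ p * B (\<tau> c) $ q) = (\<Sum>j\<in>UNIV. B (idx (j::'n)) $ p * B (idx j) $ q)" for p q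
        using sum.reindex_bij_betw[OF bij, of "\<lambda>i. B i $ p * B i $ q"]
          sum.reindex_bij_betw[OF bij_idx[where 'm='n], of "\<lambda>i. B i $ p * B i $ q"] by simp
      then show ?thesis by (simp add: vec_eq_iff matrix_matrix_mult_def transpose_def g_def mat_of_def)
    qed
    ultimately show ?thesis by simp
  qed
  moreover have "g ** lower_block (mat 1) = u"
  proof -
    have "B (idx j) $ p = u $ p $ j" for p j
      using B(1)[OF idx_less[of j]] by (simp add: column_def)
    moreover have "(\<Sum>b\<in>UNIV. B (idx b) $ p * (mat 1 :: real^'k^'k) $ b $ j) = B (idx j) $ p" for p j
      by (subst mult.commute) (rule sum_mat_1_mult(2))
    moreover have "(g ** lower_block (mat 1)) $ p $ j = (\<Sum>b\<in>UNIV. B (idx b) $ p * (mat 1 :: real^'k^'k) $ b $ j)" for p j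
      by (simp add: matrix_matrix_mult_def sum_UNIV_sum_type g_def \<tau>_def lower_block_def)
    ultimately show ?thesis by (simp add: vec_eq_iff)
  qed
  ultimately show ?thesis by blast
qed

lemma matrix_add_rdistrib: "(A + B) ** C = A ** C + B ** (C :: real^'z^'y)"
  for A :: "real^'y^'x"
  by (simp add: matrix_matrix_mult_def vec_eq_iff distrib_right sum.distrib)

text \<open>J consists of the columns of the chosen orthogonal matrix that meet the upper block. Of
  the arbitrary choice, only the splitting property is used from here on.\<close>

lemma frame_completion_splitting:
  fixes u :: "real^'k^'n"
  assumes u: "u \<in> stiefel" and card: "CARD('a::finite) + CARD('k) = CARD('n)"
  obtains J :: "real^'a^'n" where "splitting J u"
    "\<forall>w :: real^'m^'a. frame_completion u ** upper_block w = J ** w"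
proof -
  define g where "g = (frame_completion u :: real^('a + 'k)^'n)"
  let ?U = "upper_block (mat 1) :: real^'a^('a + 'k)" and ?L = "lower_block (mat 1) :: real^'k^('a + 'k)"
  have g: "transpose g ** g = mat 1" "g ** transpose g = mat 1" "g ** ?L = u"
    using someI_ex[OF frame_completion_ex[OF u card]] unfolding g_def frame_completion_def by auto
  note UL = block_orthogonality[where 'a='a and 'k='k, OF refl refl]
  let ?J = "g ** ?U"
  have "transpose ?J ** ?J = transpose ?U ** (transpose g ** g) ** ?U"
    by (simp only: matrix_transpose_mul matrix_mul_assoc)
  then have 1: "transpose ?J ** ?J = mat 1" by (simp add: g UL)
  have "transpose ?J ** u = transpose ?U ** (transpose g ** g) ** ?L"
    by (simp only: matrix_transpose_mul matrix_mul_assoc g(3)[symmetric])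
  then have 2: "transpose ?J ** u = 0" by (simp add: g UL)
  have "?J ** transpose ?J + u ** transpose u = g ** (?U ** transpose ?U + ?L ** transpose ?L) ** transpose g"
    by (simp only: g(3)[symmetric] matrix_transpose_mul matrix_mul_assoc matrix_add_ldistrib matrix_add_rdistrib)
  then have 3: "?J ** transpose ?J + u ** transpose u = mat 1" by (simp add: g UL)
  have "splitting ?J u" using 1 2 3 u card by (simp add: splitting_def stiefel_def)
  moreover have "\<forall>w :: real^'m^'a. g ** upper_block w = ?J ** w"
    by (subst upper_block_eq_mult) (simp only: matrix_mul_assoc simp_thms)
  ultimately show thesis unfolding g_def by (rule that)
qed

text \<open>In the splitting X = J A + u B, projection off u leaves J A, whose frame is J times the
  uniform frame of A. The right side no longer contains J: the Funk integral does not depend on the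
  completion, and its integrand depends measurably on u.\<close>

lemma distr_isometry_stief:
  fixes J :: "real^'a^'n" and u :: "real^'k^'n"
  assumes s: "splitting J u"
  shows "distr stief borel (\<lambda>w :: real^'m^'a. J ** w)
    = distr (gauss_cols CARD('m)) borel (\<lambda>X. frame (\<lambda>l. proj_frame u (X l)))"
proof (rule measure_eqI)
  let ?m = "CARD('m)"
  let ?h = "\<lambda>X. frame (\<lambda>l. proj_frame u (X l)) :: real^'m^'n"
  have JJ: "transpose J ** J = mat 1" using s by (simp add: splitting_def)
  have comp: "(\<lambda>X. X l) \<in> borel_measurable (PiM {..<?m} (\<lambda>_. borel))" if "l < ?m" for l
    using that by (intro measurable_component_singleton) simp
  have hm': "?h \<in> borel_measurable (PiM {..<?m} (\<lambda>_. borel))"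
    by (intro measurable_frame borel_measurable_proj_frame comp) auto
  then have hm: "?h \<in> borel_measurable (gauss_cols ?m)" by simp
  have proj: "proj_frame u (J *v a + u *v b) = J *v a" for a b
    using splitting_apply(2)[OF s, of a b] by (simp add: proj_frame_def del: transpose_matrix_vector)
  fix S assume "S \<in> sets (distr stief borel (\<lambda>w :: real^'m^'a. J ** w))"
  then have S[measurable]: "S \<in> sets borel" by simp
  have "emeasure (distr (gauss_cols ?m) borel ?h) S = (\<integral>\<^sup>+z. indicator S z \<partial>distr (gauss_cols ?m) borel ?h)" by simp
  also have "\<dots> = (\<integral>\<^sup>+X. indicator S (?h X) \<partial>gauss_cols ?m)"
    by (rule nn_integral_distr[OF hm]) simp
  also have "\<dots> = (\<integral>\<^sup>+A. \<integral>\<^sup>+B. indicator S (?h (\<lambda>l\<in>{..<?m}. J *v A l + u *v B l)) \<partial>gauss_cols ?m \<partial>gauss_cols ?m)"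
    by (rule nn_integral_gauss_cols_split[OF s]) (intro measurable_compose[OF hm'] borel_measurable_indicator S)
  also have "\<dots> = (\<integral>\<^sup>+A. \<integral>\<^sup>+B. indicator S (J ** (frame A :: real^'m^'a)) \<partial>(gauss_cols ?m :: (nat \<Rightarrow> real^'k) measure) \<partial>gauss_cols ?m)"
  proof (intro nn_integral_cong arg_cong[where f="indicator S"])
    fix A :: "nat \<Rightarrow> real^'a" and B :: "nat \<Rightarrow> real^'k"
    have "?h (\<lambda>l\<in>{..<?m}. J *v A l + u *v B l) = frame (\<lambda>l. J *v A l)"
      by (rule frame_cong) (simp add: proj)
    then show "?h (\<lambda>l\<in>{..<?m}. J *v A l + u *v B l) = J ** (frame A :: real^'m^'a)"
      by (simp add: frame_isometry[OF JJ])
  qed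
  also have "\<dots> = (\<integral>\<^sup>+A. indicator S (J ** (frame A :: real^'m^'a)) \<partial>gauss_cols ?m)"
    by (simp add: prob_space.emeasure_space_1 prob_space_gauss_cols)
  also have "\<dots> = (\<integral>\<^sup>+w. indicator S (J ** w) \<partial>(stief :: (real^'m^'a) measure))"
  proof -
    have "(\<lambda>w :: real^'m^'a. indicator S (J ** w) :: ennreal) \<in> borel_measurable borel" by measurable
    then show ?thesis unfolding stief_def by (intro nn_integral_distr[symmetric]) auto
  qed
  also have "\<dots> = (\<integral>\<^sup>+z. indicator S z \<partial>distr stief borel (\<lambda>w :: real^'m^'a. J ** w))"
    by (intro nn_integral_distr[symmetric]) auto
  finally show "emeasure (distr stief borel (\<lambda>w :: real^'m^'a. J ** w)) S = emeasure (distr (gauss_cols ?m) borel ?h) S"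
    by simp
qed simp

text \<open>\<open>nn_integral_composed_funk\<close> for indicators. As an equality of measures it
  transfers integrability and the values of complex integrals.\<close>

lemma distr_composed_funk:
  fixes J :: "real^'b^'n" and v :: "real^'m^'n"
  assumes s: "splitting J v" and le: "CARD('m) + CARD('k::finite) \<le> CARD('b)"
  shows "distr ((stief :: (real^'k^'b) measure) \<Otimes>\<^sub>M gauss_cols CARD('m)) borel
      (\<lambda>p. frame (\<lambda>l. proj_frame (J ** fst p) (snd p l)) :: real^'m^'n)
    = density stief (\<lambda>w. ennreal (gamma_ratio CARD('b) CARD('k) CARD('m) / gamma_ratio CARD('n) CARD('k) CARD('m)
         * sine_kernel CARD('k) v w))"
    and "(\<lambda>p. frame (\<lambda>l. proj_frame (J ** fst p) (snd p l)) :: real^'m^'n)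
      \<in> borel_measurable ((stief :: (real^'k^'b) measure) \<Otimes>\<^sub>M gauss_cols CARD('m))"
proof -
  let ?m = "CARD('m)"
  let ?Q = "(stief :: (real^'k^'b) measure) \<Otimes>\<^sub>M (gauss_cols ?m :: (nat \<Rightarrow> real^'n) measure)"
  let ?H = "\<lambda>p. frame (\<lambda>l. proj_frame (J ** fst p) (snd p l)) :: real^'m^'n"
  let ?d = "\<lambda>w. ennreal (gamma_ratio CARD('b) CARD('k) ?m / gamma_ratio CARD('n) CARD('k) ?m * sine_kernel CARD('k) v w)"
  interpret G: prob_space "gauss_cols ?m :: (nat \<Rightarrow> real^'n) measure" by (rule prob_space_gauss_cols)
  have comp: "(\<lambda>p. snd p l) \<in> borel_measurable ?Q" if "l < ?m" for l
    by (rule measurable_compose[OF measurable_snd measurable_gauss_cols_component[OF that]])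
  have "(\<lambda>p. J ** fst p) \<in> borel_measurable ?Q" by measurable
  then show Hm: "?H \<in> borel_measurable ?Q"
    by (intro measurable_frame borel_measurable_proj_frame comp)
  have dm: "?d \<in> borel_measurable stief" by measurable
  show "distr ?Q borel ?H = density stief ?d"
  proof (rule measure_eqI)
    fix S assume "S \<in> sets (distr ?Q borel ?H)"
    then have S: "S \<in> sets borel" by simp
    have "emeasure (distr ?Q borel ?H) S = (\<integral>\<^sup>+z. indicator S z \<partial>distr ?Q borel ?H)" using S by simp
    also have "\<dots> = (\<integral>\<^sup>+p. indicator S (?H p) \<partial>?Q)"
      by (rule nn_integral_distr[OF Hm]) (use S in simp)
    also have "\<dots> = (\<integral>\<^sup>+\<theta>. \<integral>\<^sup>+X. indicator S (?H (\<theta>, X)) \<partial>gauss_cols ?m \<partial>(stief :: (real^'k^'b) measure))"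
      using G.nn_integral_fst[OF measurable_compose[OF Hm borel_measurable_indicator[OF S]]] by simp
    also have "\<dots> = (\<integral>\<^sup>+w. indicator S w * ?d w \<partial>stief)"
      using nn_integral_composed_funk[OF s le borel_measurable_indicator[OF S]] by simp
    also have "\<dots> = emeasure (density stief ?d) S"
      using S dm by (subst emeasure_density) (auto simp: mult.commute)
    finally show "emeasure (distr ?Q borel ?H) S = emeasure (density stief ?d) S" .
  qed simp
qed

section \<open>Identification of the constant\<close>

lemma gamma_ratio_siegel:
  assumes "m + k \<le> d"
  shows "gamma_ratio d k m = siegel_gamma m (real d / 2) / siegel_gamma m ((real d - real k) / 2)"
proof -
  have "gamma_ratio d k m = (\<Prod>j<m. Gamma (real d / 2 - real j / 2) / Gamma ((real d - real k) / 2 - real j / 2))"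
    unfolding gamma_ratio_def using assms
    by (intro prod.cong refl arg_cong2[where f="(/)"] arg_cong[where f=Gamma]) (auto simp: of_nat_diff field_simps)
  then show ?thesis by (simp add: siegel_gamma_def prod_dividef)
qed

lemma siegel_gamma_pos: "real m - 1 < 2 * \<alpha> \<Longrightarrow> siegel_gamma m \<alpha> > 0"
  unfolding siegel_gamma_def by (intro mult_pos_pos prod_pos) (auto intro!: Gamma_real_pos)

text \<open>The powers of 2 and of pi cancel against those in the volume. Both sides become the
  product of the Siegel gamma values at (n-k)/2 and (n-m)/2, divided by that at n/2 and
  (n-k-m)/2.\<close>

lemma funk_sine_const_eq:
  assumes "2 * m + k \<le> n" "1 \<le> k"
  shows "funk_sine_const n k m / stiefel_volume (n - m) m = gamma_ratio (n - m) k m / gamma_ratio n k m"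
proof -
  have "siegel_gamma m (real n / 2) > 0" "siegel_gamma m ((real n - real k) / 2) > 0"
    "siegel_gamma m ((real n - real m) / 2) > 0" "siegel_gamma m ((real n - real k - real m) / 2) > 0"
    using assms by (auto intro!: siegel_gamma_pos)
  moreover have "real (n - m) = real n - real m" "m + k \<le> n - m" "m + k \<le> n" using assms by auto
  moreover have eq: "real n - real m - real k = real n - real k - real m" by simp
  ultimately show ?thesis
    by (simp add: gamma_ratio_siegel funk_sine_const_def stiefel_volume_def eq mult_ac)
qed

text \<open>The case f = 1 of \<open>nn_integral_composed_funk\<close>: the composition of the
  averages maps 1 to 1.\<close>

lemma nn_integral_sine_kernel:
  fixes v :: "real^'m^'n"
  assumes v: "v \<in> stiefel" and b: "CARD('b::finite) + CARD('m) = CARD('n)"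
    and le: "CARD('m) + CARD('k::finite) \<le> CARD('b)"
  shows "(\<integral>\<^sup>+w. ennreal (gamma_ratio CARD('b) CARD('k) CARD('m) / gamma_ratio CARD('n) CARD('k) CARD('m)
     * sine_kernel CARD('k) v w) \<partial>stief) = 1"
proof -
  obtain J :: "real^'b^'n" where s: "splitting J v"
    by (rule frame_completion_splitting[OF v b])
  have "(\<integral>\<^sup>+\<theta>. \<integral>\<^sup>+X. 1 \<partial>(gauss_cols CARD('m) :: (nat \<Rightarrow> real^'n) measure) \<partial>(stief :: (real^'k^'b) measure)) = 1"
    using prob_space.emeasure_space_1[of "stief :: (real^'k^'b) measure"]
    by (simp add: prob_space.emeasure_space_1 prob_space_gauss_cols prob_space_stief)
  then show ?thesis
    using nn_integral_composed_funk[OF s le, of "\<lambda>_. 1"] by simp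
qed

lemma sine_kernel_orthogonal_mult:
  assumes g: "orthogonal_matrix g"
  shows "sine_kernel k (g ** v) (g ** w) = sine_kernel k v w"
proof -
  have "transpose (g ** w) ** (g ** v) ** transpose (g ** v) ** (g ** w)
    = transpose w ** (transpose g ** g) ** v ** transpose v ** (transpose g ** g) ** w"
    by (simp only: matrix_transpose_mul matrix_mul_assoc)
  then show ?thesis using g by (simp add: sine_kernel_def orthogonal_matrix)
qed

text \<open>By invariance the integral of the kernel over its first argument is constant, hence equal to the
  integral over the second one.\<close>

lemma AE_sine_integral_finite:
  fixes h :: "real^'m^'n \<Rightarrow> ennreal"
  assumes b: "CARD('b::finite) + CARD('m) = CARD('n)"
    and le: "CARD('m) + CARD('k::finite) \<le> CARD('b)"
    and h[measurable]: "h \<in> borel_measurable borel" and fin: "(\<integral>\<^sup>+w. h w \<partial>stief) < \<infinity>"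
  shows "AE v in stief. (\<integral>\<^sup>+w. h w * ennreal (sine_kernel CARD('k) v w) \<partial>stief) < \<infinity>"
proof -
  let ?K = "sine_kernel CARD('k) :: real^'m^'n \<Rightarrow> real^'m^'n \<Rightarrow> real"
  let ?st = "stief :: (real^'m^'n) measure"
  define C where "C = gamma_ratio CARD('b) CARD('k) CARD('m) / gamma_ratio CARD('n) CARD('k) CARD('m)"
  have C: "C > 0" using b le by (auto simp: C_def intro!: divide_pos_pos gamma_ratio_pos)
  have mn: "CARD('m) \<le> CARD('n)" using b by simp
  interpret st: prob_space ?st by (rule prob_space_stief)
  interpret P: pair_prob_space ?st ?st ..
  define \<kappa> where "\<kappa> w = (\<integral>\<^sup>+v. ennreal (?K v w) \<partial>?st)" for w
  have inner: "(\<integral>\<^sup>+w. ennreal (?K v w) \<partial>?st) = ennreal (1 / C)" if "v \<in> stiefel" for v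
  proof -
    have "ennreal C * (\<integral>\<^sup>+w. ennreal (?K v w) \<partial>?st) = (\<integral>\<^sup>+w. ennreal (C * ?K v w) \<partial>?st)"
      using C by (subst nn_integral_cmult[symmetric]) (auto simp: ennreal_mult'')
    also have "\<dots> = 1" unfolding C_def by (rule nn_integral_sine_kernel[OF that b le])
    finally have 1: "ennreal C * (\<integral>\<^sup>+w. ennreal (?K v w) \<partial>?st) = 1" .
    have "(\<integral>\<^sup>+w. ennreal (?K v w) \<partial>?st) = ennreal (1 / C) * (ennreal C * (\<integral>\<^sup>+w. ennreal (?K v w) \<partial>?st))"
      using C by (simp add: mult.assoc[symmetric] ennreal_mult[symmetric])
    then show ?thesis unfolding 1 by simp
  qed
  obtain w0 :: "real^'m^'n" where w0: "w0 \<in> stiefel" by (rule stiefel_nonempty[OF mn])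
  have const: "\<kappa> w = \<kappa> w0" if w: "w \<in> stiefel" for w
  proof -
    obtain g where g: "orthogonal_matrix g" "w = g ** w0" by (rule stiefel_transitive[OF w0 w mn])
    have "\<kappa> w = (\<integral>\<^sup>+v. ennreal (?K (g ** v) (g ** w0)) \<partial>?st)"
      unfolding \<kappa>_def g(2) by (rule nn_integral_stief_rotate[OF g(1), symmetric]) measurable
    then show ?thesis by (simp add: \<kappa>_def sine_kernel_orthogonal_mult[OF g(1)])
  qed
  have "\<kappa> w0 = (\<integral>\<^sup>+w. \<kappa> w0 \<partial>?st)" using st.emeasure_space_1 by simp
  also have "\<dots> = (\<integral>\<^sup>+w. \<kappa> w \<partial>?st)"
    using AE_stief[OF mn] by (intro nn_integral_cong_AE) (auto simp: const elim!: eventually_mono)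
  also have "\<dots> = (\<integral>\<^sup>+v. \<integral>\<^sup>+w. ennreal (?K v w) \<partial>?st \<partial>?st)"
    unfolding \<kappa>_def by (rule P.Fubini') measurable
  also have "\<dots> = (\<integral>\<^sup>+v. ennreal (1 / C) \<partial>?st)"
    using AE_stief[OF mn] by (intro nn_integral_cong_AE) (auto simp: inner elim!: eventually_mono)
  finally have \<kappa>0: "\<kappa> w0 = ennreal (1 / C)" using st.emeasure_space_1 by simp
  \<comment> \<open>By Tonelli the double integral is the integral of h divided by C. It is finite,
    so the inner integral is finite for almost every v.\<close>
  have "(\<integral>\<^sup>+v. \<integral>\<^sup>+w. h w * ennreal (?K v w) \<partial>?st \<partial>?st) = (\<integral>\<^sup>+w. \<integral>\<^sup>+v. h w * ennreal (?K v w) \<partial>?st \<partial>?st)"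
    by (rule P.Fubini'[symmetric]) measurable
  also have "\<dots> = (\<integral>\<^sup>+w. h w * \<kappa> w \<partial>?st)"
    unfolding \<kappa>_def by (intro nn_integral_cong nn_integral_cmult) measurable
  also have "\<dots> = (\<integral>\<^sup>+w. h w * ennreal (1 / C) \<partial>?st)"
    using AE_stief[OF mn] by (intro nn_integral_cong_AE) (auto simp: const \<kappa>0 elim!: eventually_mono)
  also have "\<dots> = (\<integral>\<^sup>+w. h w \<partial>?st) * ennreal (1 / C)" by (rule nn_integral_multc) simp
  also have "\<dots> < \<infinity>" using fin by (simp add: ennreal_mult_less_top)
  finally have "(\<integral>\<^sup>+v. \<integral>\<^sup>+w. h w * ennreal (?K v w) \<partial>?st \<partial>?st) \<noteq> \<infinity>" by simp
  then have "AE v in ?st. (\<integral>\<^sup>+w. h w * ennreal (?K v w) \<partial>?st) \<noteq> \<infinity>"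
    by (intro nn_integral_PInf_AE) measurable
  then show ?thesis by (simp add: less_top)
qed

text \<open>The restriction to the manifold is traded for an indicator, so that all further work
  takes place under \<open>stief\<close> on the full matrix space, where the matrix operations are
  Borel.\<close>

lemma integral_stiefel_measure:
  fixes f :: "real^'m^'n \<Rightarrow> complex"
  assumes le: "CARD('m) \<le> CARD('n)"
  shows "integrable stiefel_measure f \<longleftrightarrow> integrable stief (\<lambda>w. indicator stiefel w *\<^sub>R f w)"
    and "integral\<^sup>L stiefel_measure f = (LINT w|stief. indicator stiefel w *\<^sub>R f w)"
  unfolding stiefel_measure_eq[OF le]
  by (simp_all add: integrable_restrict_space integral_restrict_space)

lemma AE_stiefel_measure_iff:
  assumes le: "CARD('m::finite) \<le> CARD('n::finite)"
  shows "(AE w in (stiefel_measure :: (real^'m^'n) measure). P w) \<longleftrightarrow> (AE w in stief. w \<in> stiefel \<longrightarrow> P w)"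
  unfolding stiefel_measure_eq[OF le] by (rule AE_restrict_space_iff) simp

text \<open>J w lies on the manifold exactly when w does, so cutting off f and cutting off the Funk
  integrand agree; then \<open>distr_isometry_stief\<close> applies. As a Gaussian integral the
  transform has a domain of integration that no longer varies with u.\<close>

lemma funk_frame:
  fixes f :: "real^'m^'n \<Rightarrow> complex" and u :: "real^'k^'n"
  assumes u: "u \<in> stiefel" and a: "CARD('a::finite) + CARD('k) = CARD('n)" and ma: "CARD('m) \<le> CARD('a)"
    and f: "(\<lambda>w. indicator stiefel w *\<^sub>R f w) \<in> borel_measurable borel"
  defines "F \<equiv> \<lambda>X. indicator stiefel (frame (\<lambda>l. proj_frame u (X l)) :: real^'m^'n) *\<^sub>R f (frame (\<lambda>l. proj_frame u (X l)))"
  shows "funk_exists TYPE('a) f u \<longleftrightarrow> integrable (gauss_cols CARD('m)) F"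
    and "funk TYPE('a) f u = (LINT X|gauss_cols CARD('m). F X)"
proof -
  let ?f0 = "\<lambda>w. indicator stiefel w *\<^sub>R f w"
  let ?h = "\<lambda>X. frame (\<lambda>l. proj_frame u (X l)) :: real^'m^'n"
  obtain J :: "real^'a^'n" where s: "splitting J u"
    and J: "\<forall>w :: real^'m^'a. frame_completion u ** upper_block w = J ** w"
    by (rule frame_completion_splitting[where 'm='m, OF u a])
  have JJ: "transpose J ** J = mat 1" using s by (simp add: splitting_def)
  have e: "indicator stiefel w *\<^sub>R funk_integrand f u w = ?f0 (J ** w)" for w :: "real^'m^'a"
    by (simp add: funk_integrand_def J indicator_def isometry_mult_stiefel_iff[OF JJ])
  have hm: "?h \<in> borel_measurable (gauss_cols CARD('m))"
    using measurable_gauss_cols_component by (intro measurable_frame borel_measurable_proj_frame) auto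
  have Jm: "(\<lambda>w :: real^'m^'a. J ** w) \<in> borel_measurable stief" by measurable
  have "funk_exists TYPE('a) f u \<longleftrightarrow> integrable stief (\<lambda>w :: real^'m^'a. ?f0 (J ** w))"
    unfolding funk_exists_def integral_stiefel_measure(1)[OF ma] e ..
  also have "\<dots> \<longleftrightarrow> integrable (distr stief borel (\<lambda>w :: real^'m^'a. J ** w)) ?f0"
    by (rule integrable_distr_eq[OF Jm f, symmetric])
  also have "\<dots> \<longleftrightarrow> integrable (gauss_cols CARD('m)) (\<lambda>X. ?f0 (?h X))"
    unfolding distr_isometry_stief[OF s] by (rule integrable_distr_eq[OF hm f])
  finally show "funk_exists TYPE('a) f u \<longleftrightarrow> integrable (gauss_cols CARD('m)) F" by (simp only: F_def)
  have "funk TYPE('a) f u = (LINT w|stief. ?f0 (J ** (w :: real^'m^'a)))"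
    unfolding funk_def integral_stiefel_measure(2)[OF ma] e ..
  also have "\<dots> = integral\<^sup>L (distr stief borel (\<lambda>w :: real^'m^'a. J ** w)) ?f0"
    by (rule integral_distr[OF Jm f, symmetric])
  also have "\<dots> = (LINT X|gauss_cols CARD('m). ?f0 (?h X))"
    unfolding distr_isometry_stief[OF s] by (rule integral_distr[OF hm f])
  finally show "funk TYPE('a) f u = (LINT X|gauss_cols CARD('m). F X)" by (simp only: F_def)
qed

theorem theorem4p6:
  fixes f :: "real^'m^'n \<Rightarrow> complex"
    and k m n :: nat
  assumes "CARD('n) = n" and "CARD('m) = m" and "CARD('k) = k"
    and "CARD('a) = n - k" and "CARD('b) = n - m"
    and "1 \<le> k" and "k \<le> n - 1" and "1 \<le> m" and "m \<le> n - 1"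
    and "2 * m \<le> n - k"
    and "integrable stiefel_measure f"
  shows "AE v in stiefel_measure.
           (AE \<theta> in stiefel_measure.
              funk_exists TYPE('a::finite) f
                (frame_completion v ** (upper_block (\<theta> :: real^'k^'b) :: real^'k^('b + 'm)))) \<and>
           dual_funk_exists TYPE('b::finite)
             (funk TYPE('a) f :: real^'k^'n \<Rightarrow> complex) v \<and>
           sine_exists (real n - real k - real m) f v \<and>
           dual_funk TYPE('b) (funk TYPE('a) f :: real^'k^'n \<Rightarrow> complex) v =
             of_real (funk_sine_const n k m / stiefel_volume (n - m) m) *
             sine_transform (real n - real k - real m) f v"
proof -
  note cards = assms(1-5)
  have k1: "1 \<le> k" and mk: "2 * m + k \<le> n" and m1: "1 \<le> m" using assms(6-10) by auto
  have mn: "CARD('m) \<le> CARD('n)" and kb: "CARD('k) \<le> CARD('b)" and ma: "CARD('m) \<le> CARD('a)"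
    and an: "CARD('a) + CARD('k) = CARD('n)" and bn: "CARD('b) + CARD('m) = CARD('n)"
    and le: "CARD('m) + CARD('k) \<le> CARD('b)"
    using mk unfolding cards by auto
  let ?st = "stief :: (real^'m^'n) measure" and ?sk = "stief :: (real^'k^'b) measure"
  let ?G = "gauss_cols CARD('m) :: (nat \<Rightarrow> real^'n) measure"
  define C where "C = gamma_ratio CARD('b) CARD('k) CARD('m) / gamma_ratio CARD('n) CARD('k) CARD('m)"
  have C: "C > 0" using bn le by (auto simp: C_def intro!: divide_pos_pos gamma_ratio_pos)
  have Cc: "funk_sine_const n k m / stiefel_volume (n - m) m = C"
    unfolding C_def cards by (rule funk_sine_const_eq[OF mk k1])
  define f0 where "f0 = (\<lambda>w. indicator stiefel w *\<^sub>R f w)"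
  have f0int: "integrable ?st f0"
    using assms(11) unfolding f0_def integral_stiefel_measure(1)[OF mn] .
  then have f0m[measurable]: "f0 \<in> borel_measurable borel" by (auto dest: borel_measurable_integrable)
  have sine_e: "indicator stiefel w *\<^sub>R sine_integrand (real n - real k - real m) f v w
      = f0 w * of_real (sine_kernel CARD('k) v w)" for v w
    by (simp add: sine_integrand_def sine_kernel_def f0_def cards)
  let ?claim = "\<lambda>v. (AE \<theta> in stiefel_measure.
              funk_exists TYPE('a) f
                (frame_completion v ** (upper_block (\<theta> :: real^'k^'b) :: real^'k^('b + 'm)))) \<and>
           dual_funk_exists TYPE('b)
             (funk TYPE('a) f :: real^'k^'n \<Rightarrow> complex) v \<and>
           sine_exists (real n - real k - real m) f v \<and>
           dual_funk TYPE('b) (funk TYPE('a) f :: real^'k^'n \<Rightarrow> complex) v =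
             of_real C * sine_transform (real n - real k - real m) f v"
  \<comment> \<open>The exceptional set of the theorem: the frames v at which the sine integral of
    |f| diverges. For all other v on the manifold the four claims hold.\<close>
  have "AE v in ?st. (\<integral>\<^sup>+w. ennreal (norm (f0 w)) * ennreal (sine_kernel CARD('k) v w) \<partial>?st) < \<infinity>"
    using f0int by (intro AE_sine_integral_finite[OF bn le]) (auto simp: integrable_iff_bounded)
  then have "AE v in ?st. v \<in> stiefel \<longrightarrow> ?claim v"
  proof (rule eventually_mono, intro impI)
    fix v :: "real^'m^'n"
    assume fin: "(\<integral>\<^sup>+w. ennreal (norm (f0 w)) * ennreal (sine_kernel CARD('k) v w) \<partial>?st) < \<infinity>"
      and v: "v \<in> stiefel"
    obtain J :: "real^'b^'n" where s: "splitting J v"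
      and J: "\<forall>w :: real^'k^'b. frame_completion v ** upper_block w = J ** w"
      by (rule frame_completion_splitting[where 'm='k, OF v bn])
    have JJ: "transpose J ** J = mat 1" using s by (simp add: splitting_def)
    let ?H = "\<lambda>p. frame (\<lambda>l. proj_frame (J ** fst p) (snd p l)) :: real^'m^'n"
    let ?Q = "?sk \<Otimes>\<^sub>M ?G"
    interpret sk: prob_space ?sk by (rule prob_space_stief)
    interpret G: prob_space ?G by (rule prob_space_gauss_cols)
    interpret Q: pair_prob_space ?sk ?G ..
    note dH = distr_composed_funk[OF s le, folded C_def]
    have Hm: "?H \<in> borel_measurable ?Q" by (rule dH(2))
    have Km: "(\<lambda>w. C * sine_kernel CARD('k) v w) \<in> borel_measurable ?st" by measurable
    have sine_int: "integrable ?st (\<lambda>w. f0 w * of_real (sine_kernel CARD('k) v w))"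
    proof (rule integrableI_bounded)
      show "(\<lambda>w. f0 w * complex_of_real (sine_kernel CARD('k) v w)) \<in> borel_measurable ?st" by measurable
      show "(\<integral>\<^sup>+w. ennreal (norm (f0 w * complex_of_real (sine_kernel CARD('k) v w))) \<partial>?st) < \<infinity>"
        using fin by (simp add: norm_mult ennreal_mult'')
    qed
    have scaled: "(\<lambda>w. (C * sine_kernel CARD('k) v w) *\<^sub>R f0 w) = (\<lambda>w. of_real C * (f0 w * of_real (sine_kernel CARD('k) v w)))"
      by (simp add: scaleR_conv_of_real mult_ac)
    have nonneg: "AE w in ?st. 0 \<le> C * sine_kernel CARD('k) v w" using C by simp
    have f0st: "f0 \<in> borel_measurable ?st" by simp
    \<comment> \<open>Integrability of f against the kernel becomes, through the image measure,
      integrability on the product of \<theta> and X. From there Fubini yields both the existence of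
      the inner transform for almost all \<theta> and its integrability.\<close>
    have "integrable (density ?st (\<lambda>w. ennreal (C * sine_kernel CARD('k) v w))) f0"
      unfolding integrable_density[OF f0st Km nonneg] scaled using sine_int by (rule integrable_mult_right)
    then have Hint: "integrable ?Q (\<lambda>p. f0 (?H p))"
      unfolding dH(1)[symmetric] by (subst (asm) integrable_distr_eq[OF Hm f0m])
    have "integral\<^sup>L ?Q (\<lambda>p. f0 (?H p)) = integral\<^sup>L (distr ?Q borel ?H) f0"
      by (rule integral_distr[OF Hm f0m, symmetric])
    also have "\<dots> = (LINT w|?st. (C * sine_kernel CARD('k) v w) *\<^sub>R f0 w)"
      unfolding dH(1) by (rule integral_density[OF f0st Km nonneg])
    also have "\<dots> = of_real C * sine_transform (real n - real k - real m) f v"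
      unfolding scaled sine_transform_def integral_stiefel_measure(2)[OF mn] sine_e by simp
    finally have HC: "integral\<^sup>L ?Q (\<lambda>p. f0 (?H p)) = of_real C * sine_transform (real n - real k - real m) f v" .
    have Jst: "J ** \<theta> \<in> stiefel" if "\<theta> \<in> stiefel" for \<theta> :: "real^'k^'b"
      using that by (simp add: isometry_mult_stiefel_iff[OF JJ])
    have funk_e: "funk_exists TYPE('a) f (J ** \<theta>) \<longleftrightarrow> integrable ?G (\<lambda>X. f0 (?H (\<theta>, X)))"
        "funk TYPE('a) f (J ** \<theta>) = (LINT X|?G. f0 (?H (\<theta>, X)))"
      if "\<theta> \<in> stiefel" for \<theta> :: "real^'k^'b"
      using funk_frame[OF Jst[OF that] an ma f0m[unfolded f0_def]] by (simp_all add: f0_def)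
    have "AE \<theta> in ?sk. integrable ?G (\<lambda>X. f0 (?H (\<theta>, X)))"
      by (rule Q.AE_integrable_fst'[OF Hint])
    then have 1: "AE \<theta> in stiefel_measure. funk_exists TYPE('a) f
                (frame_completion v ** (upper_block (\<theta> :: real^'k^'b) :: real^'k^('b + 'm)))"
      unfolding AE_stiefel_measure_iff[OF kb] J[rule_format] by eventually_elim (simp add: funk_e)
    have 2: "sine_exists (real n - real k - real m) f v"
      unfolding sine_exists_def integral_stiefel_measure(1)[OF mn] sine_e by (rule sine_int)
    \<comment> \<open>\<open>funk_e\<close> holds for \<theta> on the manifold only; elsewhere the
      indicator makes both sides 0.\<close>
    have dual_e: "indicator stiefel \<theta> *\<^sub>R dual_funk_integrand (funk TYPE('a) f :: real^'k^'n \<Rightarrow> complex) v \<theta>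
      = indicator stiefel \<theta> *\<^sub>R (LINT X|?G. f0 (?H (\<theta>, X)))" for \<theta> :: "real^'k^'b"
      by (cases "\<theta> \<in> stiefel") (simp_all add: dual_funk_integrand_def J funk_e)
    have Fi: "integrable ?sk (\<lambda>\<theta>. LINT X|?G. f0 (?H (\<theta>, X)))"
      by (rule Q.integrable_fst'[OF Hint])
    \<comment> \<open>Under \<open>stief\<close> almost every \<theta> is a frame, so the indicator
      may be dropped.\<close>
    have AEi: "AE \<theta> in ?sk. indicator stiefel \<theta> *\<^sub>R (LINT X|?G. f0 (?H (\<theta>, X))) = (LINT X|?G. f0 (?H (\<theta>, X)))"
      using AE_stief[OF kb] by eventually_elim simp
    have Fim: "(\<lambda>\<theta>. indicator stiefel \<theta> *\<^sub>R (LINT X|?G. f0 (?H (\<theta>, X)))) \<in> borel_measurable ?sk"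
      using borel_measurable_integrable[OF Fi] by (intro borel_measurable_scaleR borel_measurable_indicator) auto
    have 3: "dual_funk_exists TYPE('b) (funk TYPE('a) f :: real^'k^'n \<Rightarrow> complex) v"
      unfolding dual_funk_exists_def integral_stiefel_measure(1)[OF kb] dual_e
      using integrable_cong_AE[OF Fim borel_measurable_integrable[OF Fi] AEi] Fi by simp
    have "dual_funk TYPE('b) (funk TYPE('a) f :: real^'k^'n \<Rightarrow> complex) v = (LINT \<theta>|?sk. LINT X|?G. f0 (?H (\<theta>, X)))"
      unfolding dual_funk_def integral_stiefel_measure(2)[OF kb] dual_e
      by (rule integral_cong_AE[OF Fim borel_measurable_integrable[OF Fi] AEi])
    also have "\<dots> = integral\<^sup>L ?Q (\<lambda>p. f0 (?H p))"
      by (rule Q.integral_fst'[OF Hint])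
    finally have 4: "dual_funk TYPE('b) (funk TYPE('a) f :: real^'k^'n \<Rightarrow> complex) v
        = of_real C * sine_transform (real n - real k - real m) f v" unfolding HC .
    show "?claim v"
      using 1 2 3 4 by blast
  qed
  then show ?thesis
    unfolding AE_stiefel_measure_iff[OF mn] Cc .
qed

end
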